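(* Let $d=2$, $\frac12<H<1$ and $t>0$. Let $B^H$ be a $2$-dimensional fractional Brownian motion with Hurst parameter $H$ and, for $\epsilon>0$, let $$\hat\alpha^{(1)}_{t,\epsilon}=\int_0^t\int_0^s\partial_{x_1}\delta_\epsilon(B^H_s-B^H_r)\,dr\,ds .$$ Then, as $\epsilon\to0$, $\epsilon^{2-\frac1H}\,\hat\alpha^{(1)}_{t,\epsilon}$ converges in distribution to the Gaussian law $\mathcal{N}(0,\sigma_1^2)$, where $$\sigma_1^2=\frac{(2H-1)t^{2H}}{8\pi^2H}\,B(2,2H-1)\,B\!\left(\frac1H,\frac{4H-2}{2H}\right)^2$$ and $B(\cdot,\cdot)$ is the Beta function.
   Context: A $d$-dimensional fractional Brownian motion $B^H=(B^{H,1},\dots,B^{H,d})$ with Hurst parameter $H\in(0,1)$ is an a.s. continuous centered Gaussian process whose components are independent copies of a one-dimensional fractional Brownian motion with covariance $\mathbb{E}[B^{H,j}_tB^{H,j}_s]=\tfrac12(t^{2H}+s^{2H}-|t-s|^{2H})$. For $\epsilon>0$ and $x\in\mathbb{R}^d$, $\delta_\epsilon(x)=(2\pi\epsilon)^{-d/2}e^{-|x|^2/(2\epsilon)}$. The superscript $(1)$ denotes the multi-index $(1,0,\dots,0)$, i.e. one derivative in the first coordinate. *)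

theory Defs
  imports "HOL-Probability.Probability"
begin

(* Variance parameter v; v = 0 is the point mass. The library's normal_density takes the
   standard deviation and is identically 0 for standard deviation 0. *)
definition normal_law :: "real \<Rightarrow> real \<Rightarrow> real measure" where
  "normal_law \<mu> v =
     (if v = 0 then return borel \<mu> else density lborel (normal_density \<mu> (sqrt v)))"

definition gaussian_process :: "'w measure \<Rightarrow> 't set \<Rightarrow> ('t \<Rightarrow> 'w \<Rightarrow> real) \<Rightarrow> bool" where
  "gaussian_process M T X \<longleftrightarrow>
     (\<forall>t\<in>T. X t \<in> borel_measurable M) \<and>
     (\<forall>S c. finite S \<and> S \<subseteq> T \<longrightarrow>
        (\<exists>\<mu> v. v \<ge> 0 \<and> distr M borel (\<lambda>\<omega>. \<Sum>t\<in>S. c t * X t \<omega>) = normal_law \<mu> v))"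

definition fractional_brownian_motion ::
  "real \<Rightarrow> 'w measure \<Rightarrow> (real \<Rightarrow> 'w \<Rightarrow> real) \<Rightarrow> bool" where
  "fractional_brownian_motion H M X \<longleftrightarrow>
     0 < H \<and> H < 1 \<and>
     gaussian_process M {0..} X \<and>
     (\<forall>t\<ge>0. integral\<^sup>L M (X t) = 0) \<and>
     (\<forall>s\<ge>0. \<forall>t\<ge>0. integral\<^sup>L M (\<lambda>\<omega>. X t \<omega> * X s \<omega>) =
        (t powr (2 * H) + s powr (2 * H) - \<bar>t - s\<bar> powr (2 * H)) / 2) \<and>
     (AE \<omega> in M. continuous_on {0..} (\<lambda>t. X t \<omega>))"

(* The coordinates are independent as processes, i.e. as random elements of the product space
   over the index set [0, \<infinity>). *)
definition vector_fractional_brownian_motion ::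
  "real \<Rightarrow> 'w measure \<Rightarrow> (real \<Rightarrow> 'w \<Rightarrow> real ^ 'd::finite) \<Rightarrow> bool" where
  "vector_fractional_brownian_motion H M B \<longleftrightarrow>
     (\<forall>j. fractional_brownian_motion H M (\<lambda>t \<omega>. B t \<omega> $ j)) \<and>
     prob_space.indep_vars M (\<lambda>j. Pi\<^sub>M {0..} (\<lambda>t. borel :: real measure))
       (\<lambda>j \<omega>. \<lambda>t\<in>{0..}. B t \<omega> $ j) UNIV"

definition heat_kernel :: "real \<Rightarrow> real ^ 'd::finite \<Rightarrow> real" where
  "heat_kernel \<epsilon> x =
     (2 * pi * \<epsilon>) powr (- (real CARD('d) / 2)) * exp (- ((norm x)\<^sup>2 / (2 * \<epsilon>)))"

definition partial_deriv :: "'d \<Rightarrow> (real ^ 'd::finite \<Rightarrow> real) \<Rightarrow> real ^ 'd \<Rightarrow> real" where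
  "partial_deriv i f x = deriv (\<lambda>h. f (x + h *\<^sub>R axis i 1)) 0"

definition approx_DSLT ::
  "(real \<Rightarrow> 'w \<Rightarrow> real ^ 'd::finite) \<Rightarrow> 'd \<Rightarrow> real \<Rightarrow> real \<Rightarrow> 'w \<Rightarrow> real" where
  "approx_DSLT B i t \<epsilon> \<omega> =
     (LBINT s:{0..t}. (LBINT r:{0..s}. partial_deriv i (heat_kernel \<epsilon>) (B s \<omega> - B r \<omega>)))"

(* weak_conv_m is restricted to sequences; this is the same notion along an arbitrary filter.
   Measurability is part of the definition because distr is the null measure for a
   non-measurable function. *)
definition converges_in_distribution ::
  "'w measure \<Rightarrow> ('i \<Rightarrow> 'w \<Rightarrow> real) \<Rightarrow> real measure \<Rightarrow> 'i filter \<Rightarrow> bool" where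
  "converges_in_distribution M X N F \<longleftrightarrow>
     (\<forall>\<^sub>F i in F. X i \<in> borel_measurable M) \<and>
     (\<forall>x. isCont (cdf N) x \<longrightarrow> ((\<lambda>i. cdf (distr M borel (X i)) x) \<longlongrightarrow> cdf N x) F)"

lemma converges_in_distribution_sequentially:
  assumes "\<And>n. X n \<in> borel_measurable M"
  shows "converges_in_distribution M X N sequentially \<longleftrightarrow>
    weak_conv_m (\<lambda>n. distr M borel (X n)) N"
  using assms by (simp add: converges_in_distribution_def weak_conv_m_def weak_conv_def)

end

(* The approximations converge in mean square, to a multiple of the first coordinate of B_t.  With
   eps = eta^(2H), the second moment of the scaled approximation is an integral of
   eta^(2H-2) m / (4 pi^2 D^2) over pairs of increments of lengths eta a and eta b, where m is the
   scaled covariance and D the determinant of the identity plus the scaled covariance matrix.  For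
   well separated increments m ~ H (2H-1) a b eta^(2-2H) |s' - s|^(2H-2) and
   D ~ (1 + a^(2H)) (1 + b^(2H)), which gives the limit by dominated convergence; the pairs of nearly
   coinciding increments contribute O(eta^(2H-1)), by an elementary lower bound for D.  The same
   scaling shows that the cross moment with B_t converges to the covariance that makes the mean
   square distance vanish.  All Gaussian integrals are computed from characteristic functions. *)
theory Submission
  imports Defs
begin

section \<open>The covariance of two increments\<close>

text \<open>Throughout, \<open>p\<close> is 2H. The limit can be guessed from the first Wiener
  chaos: at an increment of length eta a the kernel has linear part -(increment) / (2 pi eps^2 (1 +
  a^p)^2), and the increments over [s - eta a, s], integrated over s in [0, t], give eta a B_t to
  leading order. Integration in a then yields -c B_t, where 2 pi c is the integral of a / (1 +
  a^p)^2 over the half-line. The proof verifies the guess by expanding E (V - Z)^2; since a square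
  is nonnegative, an upper bound for the limit superior of E V^2 is all that the second moment must
  supply. The difficulty is the factor 1 / D^2. For coinciding increments D drops from the order of
  (1 + a^p)(1 + b^p) to that of 1 + a^p, so the integrand is not dominated by a multiple of its
  limit. A quantitative gap in the Cauchy-Schwarz inequality measures this loss by the offsets of
  the end points. A second obstacle is measurability: paths are continuous only off a null set, so
  Fubini's theorem is applied to regular versions, and the result is carried to the completed
  measure at the end.\<close>

locale hurst_exponent =
  fixes p :: real
  assumes p_gt_1: "1 < p" and p_lt_2: "p < 2"
begin

text \<open>The odd extension of x^(p-1). As p > 1, \<open>p * spow x\<close> is the derivative of
  |x|^p on the whole line, zero included, so the mean value theorem also applies across a sign
  change.\<close>

abbreviation spow :: "real \<Rightarrow> real" where
  "spow x \<equiv> sgn x * \<bar>x\<bar> powr (p - 1)"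

lemma DERIV_abs_powr:
  "((\<lambda>x. \<bar>x\<bar> powr p) has_real_derivative p * (spow x)) (at x)"
proof -
  consider "x > 0" | "x < 0" | "x = 0" by linarith
  then show ?thesis
  proof cases
    case 1
    have "((\<lambda>x. x powr p) has_real_derivative p * x powr (p - 1)) (at x)"
      using 1 by (auto intro!: derivative_eq_intros)
    moreover have "\<forall>\<^sub>F z in nhds x. z powr p = \<bar>z\<bar> powr p"
      using eventually_nhds_in_open[of "{0<..}" x] 1 by (auto elim!: eventually_mono)
    ultimately show ?thesis using 1 by (subst DERIV_cong_ev[OF refl _ refl, symmetric]) auto
  next
    case 2
    have "((\<lambda>x. (- x) powr p) has_real_derivative - p * (- x) powr (p - 1)) (at x)"
      using 2 by (auto intro!: derivative_eq_intros)
    moreover have "\<forall>\<^sub>F z in nhds x. (- z) powr p = \<bar>z\<bar> powr p"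
      using eventually_nhds_in_open[of "{..<0}" x] 2 by (auto elim!: eventually_mono)
    ultimately show ?thesis using 2
      by (subst DERIV_cong_ev[OF refl _ refl, symmetric]) (auto simp: sgn_if)
  next
    case 3
    \<comment> \<open>At 0 the difference quotient of |x|^p is \<open>spow h\<close> itself.\<close>
    have "((\<lambda>h. \<bar>h\<bar> powr (p - 1) * sgn h) \<longlongrightarrow> 0) (at 0)"
    proof (rule Lim_null_comparison)
      show "\<forall>\<^sub>F h in at 0. norm (\<bar>h\<bar> powr (p - 1) * sgn h) \<le> \<bar>h\<bar> powr (p - 1)"
        by (auto simp: abs_mult abs_sgn_eq)
      have "((\<lambda>h::real. \<bar>h\<bar> powr (p - 1)) \<longlongrightarrow> 0 powr (p - 1)) (at 0)"
        using p_gt_1 by (intro tendsto_powr2) (auto intro!: tendsto_eq_intros)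
      then show "((\<lambda>h::real. \<bar>h\<bar> powr (p - 1)) \<longlongrightarrow> 0) (at 0)"
        using p_gt_1 by simp
    qed
    moreover have "\<bar>h\<bar> powr p / h = \<bar>h\<bar> powr (p - 1) * sgn h" for h :: real
      by (cases "h = 0") (auto simp: powr_diff sgn_if)
    ultimately show ?thesis using 3 p_gt_1 by (simp add: DERIV_def)
  qed
qed

lemma sgn_powr_mono:
  assumes "x \<le> y" shows "spow x \<le> spow y"
proof -
  consider "0 \<le> x" | "y \<le> 0" | "x < 0" "0 < y" by linarith
  then show ?thesis
  proof cases
    case 1
    then show ?thesis using assms p_gt_1 by (auto simp: sgn_if intro!: powr_mono2)
  next
    case 2
    then show ?thesis using assms p_gt_1 by (auto simp: sgn_if intro!: powr_mono2)
  next
    case 3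
    then have "spow x \<le> 0" "0 \<le> spow y" by auto
    then show ?thesis by linarith
  qed
qed

text \<open>The covariance of the increments over $[s - a, s]$ and $[s' - b, s']$, where $y = s' - s$.\<close>

definition inc_cov :: "real \<Rightarrow> real \<Rightarrow> real \<Rightarrow> real" where
  "inc_cov a b y = (\<bar>y + a\<bar> powr p + \<bar>y - b\<bar> powr p - \<bar>y\<bar> powr p - \<bar>y + a - b\<bar> powr p) / 2"

lemma inc_cov_commute: "inc_cov a b y = inc_cov b a (- y)"
proof -
  have "\<bar>- y + b\<bar> = \<bar>y - b\<bar>" "\<bar>- y - a\<bar> = \<bar>y + a\<bar>" "\<bar>- y + b - a\<bar> = \<bar>y + a - b\<bar>"
    by (simp_all add: abs_if)
  then show ?thesis by (simp add: inc_cov_def)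
qed

lemma inc_cov_scale:
  assumes "0 < c" shows "inc_cov (c * a) (c * b) (c * y) = c powr p * inc_cov a b y"
proof -
  have *: "\<bar>c * u\<bar> powr p = c powr p * \<bar>u\<bar> powr p" for u
    using assms by (simp add: abs_mult powr_mult)
  have "c * y + c * a = c * (y + a)" "c * y - c * b = c * (y - b)"
    "c * y + c * a - c * b = c * (y + a - b)" by (simp_all add: algebra_simps)
  then show ?thesis unfolding inc_cov_def
    by (simp only: *) (simp add: algebra_simps add_divide_distrib diff_divide_distrib)
qed

text \<open>The covariance is half the change of |x + a|^p - |x|^p over [y - b, y]. One derivative
  makes sense for every \<open>y\<close>, also for overlapping increments, where the second
  derivative is singular.\<close>

lemma inc_cov_mvt:
  assumes "0 < b"
  obtains s where "y - b < s" "s < y"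
    "inc_cov a b y = b * p * (spow (s + a) - spow s) / 2"
proof -
  let ?f = "\<lambda>s. \<bar>s + a\<bar> powr p - \<bar>s\<bar> powr p"
  let ?f' = "\<lambda>s. p * (spow (s + a)) - p * (spow s)"
  have d: "(?f has_real_derivative ?f' s) (at s)" for s
    by (auto intro!: DERIV_diff DERIV_abs_powr
        DERIV_shift[THEN iffD1, OF DERIV_abs_powr, of _ _, simplified])
  obtain s where s: "y - b < s" "s < y" "?f y - ?f (y - b) = (y - (y - b)) * ?f' s"
    using MVT2[of "y - b" y ?f ?f'] assms d by auto
  have "inc_cov a b y = (?f y - ?f (y - b)) / 2"
    by (simp add: inc_cov_def algebra_simps)
  also have "\<dots> = b * p * (spow (s + a) - spow s) / 2"
    unfolding s(3) by (simp add: algebra_simps)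
  finally show ?thesis using s that by blast
qed

section \<open>Sign, upper bounds and scaling limit of the covariance\<close>

lemma inc_cov_nonneg:
  assumes "0 \<le> a" "0 \<le> b" shows "0 \<le> inc_cov a b y"
proof (cases "b = 0")
  case True
  then show ?thesis by (simp add: inc_cov_def)
next
  case False
  then obtain s where "inc_cov a b y =
      b * p * (spow (s + a) - spow s) / 2"
    using inc_cov_mvt[of b y a] assms by (metis less_eq_real_def)
  moreover have "0 \<le> b * p * (spow (s + a) - spow s) / 2"
    using sgn_powr_mono[of s "s + a"] assms p_gt_1 by (intro divide_nonneg_pos mult_nonneg_nonneg) auto
  ultimately show ?thesis by simp
qed

text \<open>The hypothesis \<open>b < y\<close> says that the increments are disjoint: the first
  intermediate point is then positive, and a second derivative can be taken on the positive
  axis.\<close>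

lemma inc_cov_mvt2:
  assumes "0 < a" "0 < b" "b < y"
  obtains \<xi> where "y - b < \<xi>" "\<xi> < y + a"
    "inc_cov a b y = a * b * (p * (p - 1) / 2) * \<xi> powr (p - 2)"
proof -
  obtain s where s: "y - b < s" "s < y" "inc_cov a b y =
      b * p * (spow (s + a) - spow s) / 2"
    using inc_cov_mvt[of b y a] assms by blast
  have "\<exists>\<xi>. s < \<xi> \<and> \<xi> < s + a \<and> (s + a) powr (p - 1) - s powr (p - 1)
      = (s + a - s) * ((p - 1) * \<xi> powr (p - 1 - 1))"
    using s assms by (intro MVT2) (auto intro!: derivative_eq_intros)
  then obtain \<xi> where \<xi>: "s < \<xi>" "\<xi> < s + a"
    "(s + a) powr (p - 1) - s powr (p - 1) = a * ((p - 1) * \<xi> powr (p - 2))"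
    by (auto simp: algebra_simps)
  have "inc_cov a b y = a * b * (p * (p - 1) / 2) * \<xi> powr (p - 2)"
    using s assms \<xi> by simp
  then show ?thesis using s \<xi> that[of \<xi>] by auto
qed

text \<open>The intermediate point is at least y/2; as the exponent p - 2 lies in (-1, 0), replacing
  it by y costs at most a factor 2, while p (p - 1) / 2 is at most 1.\<close>

lemma inc_cov_le_far:
  assumes "0 < a" "0 < b" "2 * max a b \<le> y"
  shows "inc_cov a b y \<le> 2 * (a * b * y powr (p - 2))"
proof -
  obtain \<xi> where \<xi>: "y - b < \<xi>" "\<xi> < y + a"
    "inc_cov a b y = a * b * (p * (p - 1) / 2) * \<xi> powr (p - 2)"
    using inc_cov_mvt2[of a b y] assms by (auto simp: max_def split: if_splits)
  have y: "0 < y" "y / 2 \<le> \<xi>" using assms \<xi> by (auto simp: max_def split: if_splits)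
  have "\<xi> powr (p - 2) \<le> (y / 2) powr (p - 2)"
    using y p_lt_2 by (intro powr_mono2') auto
  also have "\<dots> = y powr (p - 2) * 2 powr (2 - p)"
    using y by (simp add: powr_divide powr_diff divide_simps)
  also have "\<dots> \<le> y powr (p - 2) * 2 powr 1"
    using p_gt_1 by (intro mult_left_mono powr_mono) auto
  finally have 1: "\<xi> powr (p - 2) \<le> 2 * y powr (p - 2)" by simp
  have "p * (p - 1) \<le> 2 * 1" using p_gt_1 p_lt_2 by (intro mult_mono) auto
  then have "inc_cov a b y \<le> a * b * 1 * (2 * y powr (p - 2))"
    unfolding \<xi>(3) using 1 assms p_gt_1 by (intro mult_mono) auto
  then show ?thesis by simp
qed

text \<open>Here one derivative suffices: its arguments are at most 4a in modulus, and a^(p-2) is at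
  most 2 |y|^(p-2) because |y| is at most 2a. The constant is p 4^(p-1) \<le> 8 times this
  2.\<close>

lemma inc_cov_le_near:
  assumes "0 < a" "0 < b" "b \<le> a" "\<bar>y\<bar> \<le> 2 * a" "y \<noteq> 0"
  shows "inc_cov a b y \<le> 16 * (a * b * \<bar>y\<bar> powr (p - 2))"
proof -
  obtain s where s: "y - b < s" "s < y" "inc_cov a b y =
      b * p * (spow (s + a) - spow s) / 2"
    using inc_cov_mvt[of b y a] assms by blast
  have "spow z \<le> (4 * a) powr (p - 1)"
    "- ((4 * a) powr (p - 1)) \<le> spow z" if "\<bar>z\<bar> \<le> 4 * a" for z
    using sgn_powr_mono[of z "4 * a"] sgn_powr_mono[of "- (4 * a)" z] that assms
    by (auto simp: abs_if split: if_splits)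
  moreover have "\<bar>s + a\<bar> \<le> 4 * a" "\<bar>s\<bar> \<le> 4 * a"
    using s(1,2) assms by linarith+
  ultimately have "spow (s + a) \<le> (4 * a) powr (p - 1)"
    "- ((4 * a) powr (p - 1)) \<le> spow s" by blast+
  then have "spow (s + a) - spow s \<le> 2 * (4 * a) powr (p - 1)"
    by linarith
  then have "inc_cov a b y \<le> b * p * (2 * (4 * a) powr (p - 1)) / 2"
    unfolding s(3) using assms p_gt_1 by (intro divide_right_mono mult_left_mono) auto
  also have "\<dots> = b * p * (4 * a) powr (p - 1)" by simp
  also have "(4 * a) powr (p - 1) = 4 powr (p - 1) * (a * a powr (p - 2))"
    using assms by (simp add: powr_mult powr_diff power2_eq_square)
  also have "b * p * (4 powr (p - 1) * (a * a powr (p - 2))) = p * 4 powr (p - 1) * (a * b) * a powr (p - 2)"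
    by simp
  also have "\<dots> \<le> 2 * 4 powr 1 * (a * b) * (2 * \<bar>y\<bar> powr (p - 2))"
  proof (rule mult_mono)
    have "a powr (p - 2) \<le> (\<bar>y\<bar> / 2) powr (p - 2)"
      using assms p_lt_2 by (intro powr_mono2') auto
    also have "\<dots> = \<bar>y\<bar> powr (p - 2) * 2 powr (2 - p)"
      using assms by (simp add: powr_divide powr_diff divide_simps)
    also have "\<dots> \<le> \<bar>y\<bar> powr (p - 2) * 2 powr 1"
      using p_gt_1 by (intro mult_left_mono powr_mono) auto
    finally show "a powr (p - 2) \<le> 2 * \<bar>y\<bar> powr (p - 2)" by simp
    show "p * 4 powr (p - 1) * (a * b) \<le> 2 * 4 powr 1 * (a * b)"
      using assms p_gt_1 p_lt_2 powr_mono[of "p - 1" 1 4] by (intro mult_mono) auto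
  qed (use assms p_gt_1 p_lt_2 in auto)
  finally show ?thesis by simp
qed

text \<open>The bound has the same power of |y| as the scaling limit, and p - 2 > -1 makes it
  integrable across y = 0, so the time diagonal need not be cut out. Exchanging the increments by
  \<open>inc_cov_commute\<close> leaves two cases.\<close>

lemma inc_cov_le:
  assumes "0 < a" "0 < b" "y \<noteq> 0"
  shows "inc_cov a b y \<le> 16 * (a * b * \<bar>y\<bar> powr (p - 2))"
proof -
  have far: "inc_cov a b y \<le> 16 * (a * b * \<bar>y\<bar> powr (p - 2))"
    if "0 < a" "0 < b" "2 * max a b \<le> y" for a b y
  proof -
    have "0 < y" using that by (auto simp: max_def split: if_splits)
    moreover have "0 \<le> a * b * y powr (p - 2)" using that by simp
    ultimately show ?thesis using inc_cov_le_far[OF that] by simp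
  qed
  consider "2 * max a b \<le> y" | "2 * max a b \<le> - y" | "b \<le> a" "\<bar>y\<bar> \<le> 2 * a" | "a \<le> b" "\<bar>y\<bar> \<le> 2 * b"
    by (auto simp: max_def abs_if split: if_splits) (smt (verit))+
  then show ?thesis
  proof cases
    case 1
    then show ?thesis using far assms by blast
  next
    case 2
    then show ?thesis using far[of b a "- y"] assms
      by (simp add: inc_cov_commute[of a b] max.commute mult.commute)
  next
    case 3
    then show ?thesis using inc_cov_le_near assms by blast
  next
    case 4
    then show ?thesis using inc_cov_le_near[of b a "- y"] assms
      by (simp add: inc_cov_commute[of a b] mult.commute)
  qed
qed

text \<open>The intermediate point of \<open>inc_cov_mvt2\<close> at y = z / eta, multiplied by eta,
  is squeezed between z - eta b and z + eta a. Negative z is reduced to positive z by exchanging the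
  increments.\<close>

lemma inc_cov_scaling_limit:
  assumes "0 < a" "0 < b" "z \<noteq> 0" "\<And>n. 0 < \<eta> n" "\<eta> \<longlonglongrightarrow> 0"
  shows "(\<lambda>n. \<eta> n powr (p - 2) * inc_cov a b (z / \<eta> n))
    \<longlonglongrightarrow> a * b * (p * (p - 1) / 2) * \<bar>z\<bar> powr (p - 2)"
proof -
  have main: "(\<lambda>n. \<eta> n powr (p - 2) * inc_cov a b (z / \<eta> n))
      \<longlonglongrightarrow> a * b * (p * (p - 1) / 2) * \<bar>z\<bar> powr (p - 2)"
    if "0 < a" "0 < b" "0 < z" for a b z
  proof -
    have "(\<lambda>n. \<eta> n * b) \<longlonglongrightarrow> 0 * b" by (intro tendsto_intros assms)
    then have "\<forall>\<^sub>F n in sequentially. \<eta> n * b < z" using that by (intro order_tendstoD(2)) auto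
    then have ev: "\<forall>\<^sub>F n in sequentially. \<exists>\<xi>. z - \<eta> n * b < \<xi> \<and> \<xi> < z + \<eta> n * a \<and>
      \<eta> n powr (p - 2) * inc_cov a b (z / \<eta> n) = a * b * (p * (p - 1) / 2) * \<xi> powr (p - 2)"
    proof (rule eventually_mono)
      fix n assume n: "\<eta> n * b < z"
      have "b < z / \<eta> n" using n assms(4)[of n] by (simp add: field_simps)
      then obtain \<xi> where \<xi>: "z / \<eta> n - b < \<xi>" "\<xi> < z / \<eta> n + a"
        "inc_cov a b (z / \<eta> n) = a * b * (p * (p - 1) / 2) * \<xi> powr (p - 2)"
        using inc_cov_mvt2[of a b "z / \<eta> n"] \<open>0 < a\<close> \<open>0 < b\<close> by blast
      have pos: "0 < \<xi>" using \<xi> \<open>b < z / \<eta> n\<close> by linarith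
      have "\<eta> n powr (p - 2) * \<xi> powr (p - 2) = (\<eta> n * \<xi>) powr (p - 2)"
        using assms(4)[of n] pos by (simp add: powr_mult)
      then have "\<eta> n powr (p - 2) * inc_cov a b (z / \<eta> n) = a * b * (p * (p - 1) / 2) * (\<eta> n * \<xi>) powr (p - 2)"
        unfolding \<xi>(3) by (simp add: mult_ac)
      moreover have "z - \<eta> n * b < \<eta> n * \<xi>" "\<eta> n * \<xi> < z + \<eta> n * a"
        using \<xi>(1,2) assms(4)[of n] by (simp_all add: field_simps)
      ultimately show "\<exists>\<xi>. z - \<eta> n * b < \<xi> \<and> \<xi> < z + \<eta> n * a \<and>
        \<eta> n powr (p - 2) * inc_cov a b (z / \<eta> n) = a * b * (p * (p - 1) / 2) * \<xi> powr (p - 2)"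
        by blast
    qed
    then obtain \<xi> where \<xi>: "\<forall>\<^sub>F n in sequentially. z - \<eta> n * b < \<xi> n \<and> \<xi> n < z + \<eta> n * a \<and>
      \<eta> n powr (p - 2) * inc_cov a b (z / \<eta> n) = a * b * (p * (p - 1) / 2) * \<xi> n powr (p - 2)"
      by (auto simp: eventually_ex)
    have l: "(\<lambda>n. z - \<eta> n * b) \<longlonglongrightarrow> z" "(\<lambda>n. z + \<eta> n * a) \<longlonglongrightarrow> z"
      using assms(5) by (auto intro!: tendsto_eq_intros)
    have "\<xi> \<longlonglongrightarrow> z"
      by (rule tendsto_sandwich[OF _ _ l]) (use \<xi> in \<open>auto elim!: eventually_mono\<close>)
    then have "(\<lambda>n. a * b * (p * (p - 1) / 2) * \<xi> n powr (p - 2))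
      \<longlonglongrightarrow> a * b * (p * (p - 1) / 2) * z powr (p - 2)"
      using that by (intro tendsto_intros) auto
    moreover have "\<forall>\<^sub>F n in sequentially. a * b * (p * (p - 1) / 2) * \<xi> n powr (p - 2) =
        \<eta> n powr (p - 2) * inc_cov a b (z / \<eta> n)"
      using \<xi> by (auto elim!: eventually_mono)
    ultimately show ?thesis using that by (auto intro: Lim_transform_eventually)
  qed
  show ?thesis
  proof (cases "0 < z")
    case True
    then show ?thesis using main assms by blast
  next
    case False
    then show ?thesis using main[of b a "- z"] assms
      by (simp add: inc_cov_commute[of a b] mult.commute[of b a])
  qed
qed

section \<open>Correlation of two increments in midpoint coordinates\<close>

lemma powr_concave_increment:
  assumes "0 \<le> x" "x \<le> y" "0 \<le> d"
  shows "(y + d) powr (p - 1) - y powr (p - 1) \<le> (x + d) powr (p - 1) - x powr (p - 1)"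
proof (cases "d = 0")
  case False
  let ?f = "\<lambda>u. (u + d) powr (p - 1) - u powr (p - 1)"
  show ?thesis
  proof (rule DERIV_nonpos_imp_decreasing_open[of x y ?f])
    show "x \<le> y" by fact
    fix u assume u: "x < u" "u < y"
    have "(?f has_real_derivative (p - 1) * (u + d) powr (p - 2) - (p - 1) * u powr (p - 2)) (at u)"
      using u assms by (auto intro!: derivative_eq_intros)
    moreover have "(u + d) powr (p - 2) \<le> u powr (p - 2)"
      using u assms p_lt_2 by (intro powr_mono2') auto
    moreover have "(p - 1) * (u + d) powr (p - 2) \<le> (p - 1) * u powr (p - 2)"
      using calculation(2) p_gt_1 by (intro mult_left_mono) auto
    ultimately show "\<exists>z. (?f has_real_derivative z) (at u) \<and> z \<le> 0"
      by (metis diff_le_0_iff_le)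
  next
    show "continuous_on {x..y} ?f"
      using assms False p_gt_1 by (intro continuous_intros continuous_on_powr') auto
  qed
qed simp

text \<open>This gives the sign of the derivative of \<open>mid_cov\<close> in the distance of the
  midpoints. It rests on the concavity of x^(p-1) on the positive axis, with cases according to
  which of w - 1 and w - v are negative.\<close>

lemma sgn_powr_pair_antimono:
  assumes "0 \<le> w" "0 \<le> v" "v \<le> 1"
  shows "spow (w + 1) + spow (w - 1)
    \<le> spow (w + v) + spow (w - v)"
proof -
  have pos: "spow z = z powr (p - 1)" if "0 \<le> z" for z
    using that by (auto simp: sgn_if)
  have neg: "spow z = - ((- z) powr (p - 1))" if "z \<le> 0" for z
    using that by (auto simp: sgn_if)
  have 0: "0 \<le> w + 1" "0 \<le> w + v" using assms by auto
  consider "0 \<le> w - 1" "0 \<le> w - v" | "w - 1 \<le> 0" "0 \<le> w - v" | "w - 1 \<le> 0" "w - v \<le> 0" using assms by linarith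
  then show ?thesis
  proof cases
    case 1
    then show ?thesis unfolding pos[OF 0(1)] pos[OF 0(2)] pos[OF 1(1)] pos[OF 1(2)]
      using powr_concave_increment[of "w - 1" "w + v" "1 - v"] assms by simp
  next
    \<comment> \<open>Both sides are compared with (2w)^(p-1): each application of concavity moves
      an increment to the origin.\<close>
    case 2
    then show ?thesis unfolding pos[OF 0(1)] pos[OF 0(2)] neg[OF 2(1)] pos[OF 2(2)]
      using powr_concave_increment[of 0 "1 - w" "2 * w"] powr_concave_increment[of 0 "w + v" "w - v"] assms p_gt_1
      by (simp add: add.commute)
  next
    case 3
    then show ?thesis unfolding pos[OF 0(1)] pos[OF 0(2)] neg[OF 3(1)] neg[OF 3(2)]
      using powr_concave_increment[of "v - w" "1 - w" "2 * w"] assms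
      by (simp add: add.commute)
  qed
qed

text \<open>The covariance of two increments whose lengths are $1 - v$ and $1 + v$ and whose midpoints
  are at distance $w$.\<close>

definition mid_cov :: "real \<Rightarrow> real \<Rightarrow> real" where
  "mid_cov w v = (\<bar>w + 1\<bar> powr p + \<bar>w - 1\<bar> powr p - \<bar>w + v\<bar> powr p - \<bar>w - v\<bar> powr p) / 2"

lemma mid_cov_abs: "mid_cov \<bar>w\<bar> \<bar>v\<bar> = mid_cov w v"
proof -
  have "\<bar>- w + 1\<bar> = \<bar>w - 1\<bar>" "\<bar>- w - 1\<bar> = \<bar>w + 1\<bar>" "\<bar>- w + v\<bar> = \<bar>w - v\<bar>" "\<bar>- w - v\<bar> = \<bar>w + v\<bar>" for v
    by (simp_all add: abs_if)
  then show ?thesis by (auto simp: mid_cov_def abs_if[of w] abs_if[of v])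
qed

lemma mid_cov_antimono:
  assumes "0 \<le> w" "w \<le> w'" "0 \<le> v" "v \<le> 1"
  shows "mid_cov w' v \<le> mid_cov w v"
proof (rule DERIV_nonpos_imp_nonincreasing[OF assms(2)])
  fix x assume "w \<le> x"
  have d: "((\<lambda>w. \<bar>w + c\<bar> powr p) has_real_derivative p * (spow (x + c))) (at x)" for c
    using DERIV_shift[THEN iffD1, OF DERIV_abs_powr[of "x + c"]] by simp
  have eq: "mid_cov w v = (\<bar>w + 1\<bar> powr p + \<bar>w + - 1\<bar> powr p - \<bar>w + v\<bar> powr p - \<bar>w + - v\<bar> powr p) / 2" for w
    by (simp add: mid_cov_def)
  have "((\<lambda>w. mid_cov w v) has_real_derivative
      (p * (spow (x + 1)) + p * (spow (x + - 1))
      - p * (spow (x + v)) - p * (spow (x + - v))) / 2) (at x)"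
    unfolding eq by (intro derivative_intros d DERIV_cdivide)
  moreover have "p * (spow (x + 1)) + p * (spow (x + - 1))
      \<le> p * (spow (x + v)) + p * (spow (x + - v))"
    using sgn_powr_pair_antimono[of x v] assms \<open>w \<le> x\<close> p_gt_1 by (simp flip: distrib_left)
  ultimately show "\<exists>y. ((\<lambda>w. mid_cov w v) has_real_derivative y) (at x) \<and> y \<le> 0"
    by fastforce
qed

text \<open>At p = 2 both sides vanish, since all increments are then perfectly correlated. For p <
  2 the terms |w + 1|^p and |w - 1|^p are bounded by the tangent of x^(p/2) at 1, while the two
  other terms are kept and produce the gap. The power of 1 - v^2 is the geometric mean of the
  variances.\<close>

lemma mid_cov_gap:
  assumes "\<bar>v\<bar> \<le> 1"
  shows "((\<bar>w + v\<bar> powr p - (w + v)\<^sup>2) + (\<bar>w - v\<bar> powr p - (w - v)\<^sup>2)) / 2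
    \<le> (1 - v\<^sup>2) powr (p / 2) - mid_cov w v"
proof -
  have v: "v\<^sup>2 \<le> 1" using assms by (simp add: abs_square_le_1)
  have 1: "1 - v\<^sup>2 \<le> (1 - v\<^sup>2) powr (p / 2)"
    using powr_mono'[of "p / 2" 1 "1 - v\<^sup>2"] v p_lt_2 by simp
  have tangent: "x powr (p / 2) \<le> p / 2 * x + (1 - p / 2)" if "0 \<le> x" for x :: real
    using Youngs_inequality_0[of "p / 2" "1 - p / 2" x 1] that p_gt_1 p_lt_2 by (cases "x = 0") auto
  have sq: "\<bar>z\<bar> powr p = (z\<^sup>2) powr (p / 2)" for z :: real
    using powr_powr[of "\<bar>z\<bar>" 2 "p / 2"] by simp
  have "\<bar>w + 1\<bar> powr p + \<bar>w - 1\<bar> powr p \<le> p / 2 * (w + 1)\<^sup>2 + (1 - p / 2) + (p / 2 * (w - 1)\<^sup>2 + (1 - p / 2))"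
    unfolding sq by (intro add_mono tangent) auto
  also have "\<dots> = 2 + p * w\<^sup>2" by (simp add: power2_eq_square field_simps)
  also have "\<dots> \<le> 2 + 2 * w\<^sup>2" using p_lt_2 by (intro add_left_mono mult_right_mono) auto
  finally have "\<bar>w + 1\<bar> powr p + \<bar>w - 1\<bar> powr p \<le> 2 + 2 * w\<^sup>2" .
  moreover have "(w + v)\<^sup>2 + (w - v)\<^sup>2 = 2 * w\<^sup>2 + 2 * v\<^sup>2" by (simp add: power2_eq_square algebra_simps)
  ultimately show ?thesis using 1 by (simp add: mid_cov_def field_simps)
qed

text \<open>The quotient |u|^(2-p) of the two terms must stay away from 1; this is the origin of the
  threshold 1/2 between near and far pairs.\<close>

lemma abs_powr_minus_square:
  assumes "\<bar>u\<bar> \<le> 1 / 2"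
  shows "(1 - (1 / 2) powr (2 - p)) * \<bar>u\<bar> powr p \<le> \<bar>u\<bar> powr p - u\<^sup>2"
proof -
  have "u\<^sup>2 = \<bar>u\<bar> powr p * \<bar>u\<bar> powr (2 - p)"
    by (cases "u = 0") (auto simp flip: powr_add)
  also have "\<dots> \<le> \<bar>u\<bar> powr p * (1 / 2) powr (2 - p)"
    using assms p_lt_2 by (intro mult_left_mono powr_mono2) auto
  finally show ?thesis by (simp add: algebra_simps)
qed

lemma mid_cov_gap_near:
  assumes "\<bar>w + v\<bar> \<le> 1 / 2" "\<bar>w - v\<bar> \<le> 1 / 2"
  shows "(1 - (1 / 2) powr (2 - p)) / 2 * (\<bar>w + v\<bar> powr p + \<bar>w - v\<bar> powr p)
    \<le> (1 - v\<^sup>2) powr (p / 2) - mid_cov w v"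
proof -
  have "\<bar>v\<bar> \<le> 1" using assms by linarith
  have "c / 2 * (x + y) = (c * x + c * y) / 2" for c x y :: real by (simp add: algebra_simps)
  with mid_cov_gap[OF \<open>\<bar>v\<bar> \<le> 1\<close>, of w] abs_powr_minus_square[OF assms(1)] abs_powr_minus_square[OF assms(2)]
  show ?thesis by simp
qed

text \<open>Since \<open>w\<close> ranges over an unbounded set, monotonicity in \<open>w\<close>
  does the work of compactness: lengths that differ (|v| at least 1/4) are compared with w = 0, and
  otherwise w exceeds 1/4 and is lowered to 1/4.\<close>

lemma mid_cov_gap_far:
  obtains c where "0 < c" "c \<le> 1"
    "\<And>w v. \<lbrakk>\<bar>v\<bar> < 1; 1 / 2 < \<bar>w\<bar> + \<bar>v\<bar>\<rbrakk> \<Longrightarrow> mid_cov w v \<le> (1 - c) * (1 - v\<^sup>2) powr (p / 2)"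
proof -
  \<comment> \<open>\<open>c1\<close> comes from 1 - v^2 \<le> 15/16 for v \<ge> 1/4.
    \<open>c2\<close> is the gap of \<open>mid_cov_gap_near\<close> at w = 1/4, where |w + v|^p is
    at least (1/4)^p.\<close>
  define c1 where "c1 = 1 - (15 / 16) powr (1 - p / 2)"
  define c2 where "c2 = (1 - (1 / 2) powr (2 - p)) / 2 * (1 / 4) powr p"
  have c: "0 < c1" "c1 \<le> 1" "0 < c2"
    using p_lt_2 p_gt_1 powr_less_mono'[of "15/16" 0 "1 - p / 2"] powr_less_mono'[of "1/2" 0 "2 - p"]
    by (auto simp: c1_def c2_def)
  have "mid_cov w v \<le> (1 - min c1 c2) * (1 - v\<^sup>2) powr (p / 2)"
    if wv: "0 \<le> w" "0 \<le> v" "v < 1" "1 / 2 < w + v" for w v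
  proof (cases "1 / 4 \<le> v")
    case True
    have v: "1 / 16 \<le> v\<^sup>2" "v\<^sup>2 < 1"
      using power_mono[OF True, of 2] wv by (auto simp: power2_eq_square abs_square_less_1[simplified power2_eq_square])
    have "mid_cov w v \<le> mid_cov 0 v" using wv by (intro mid_cov_antimono) auto
    also have "\<dots> = 1 - v powr p" using wv by (simp add: mid_cov_def)
    also have "\<dots> \<le> 1 - v\<^sup>2"
      using powr_mono'[of p 2 v] wv p_lt_2 by simp
    \<comment> \<open>The power 1 - p/2 > 0 is split off as the contraction factor.\<close>
    also have "\<dots> = (1 - v\<^sup>2) powr (1 - p / 2) * (1 - v\<^sup>2) powr (p / 2)"
      using v by (simp flip: powr_add)
    also have "\<dots> \<le> (15 / 16) powr (1 - p / 2) * (1 - v\<^sup>2) powr (p / 2)"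
      using v p_lt_2 by (intro mult_right_mono powr_mono2) auto
    also have "\<dots> \<le> (1 - min c1 c2) * (1 - v\<^sup>2) powr (p / 2)"
      by (intro mult_right_mono) (auto simp: c1_def)
    finally show ?thesis .
  next
    case False
    have "mid_cov w v \<le> mid_cov (1 / 4) v" using wv False by (intro mid_cov_antimono) auto
    also have "\<dots> \<le> (1 - v\<^sup>2) powr (p / 2) - (1 - (1 / 2) powr (2 - p)) / 2 * (\<bar>1 / 4 + v\<bar> powr p + \<bar>1 / 4 - v\<bar> powr p)"
      using mid_cov_gap_near[of "1 / 4" v] wv False by simp
    also have "\<dots> \<le> (1 - v\<^sup>2) powr (p / 2) - c2"
    proof -
      have "(1 / 4) powr p \<le> \<bar>1 / 4 + v\<bar> powr p"
        using wv p_gt_1 by (intro powr_mono2) auto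
      then have "(1 / 4) powr p \<le> \<bar>1 / 4 + v\<bar> powr p + \<bar>1 / 4 - v\<bar> powr p"
        by (metis add_increasing2 powr_ge_zero)
      moreover have "0 \<le> (1 - (1 / 2) powr (2 - p)) / 2" using powr_mono'[of 0 "2 - p" "1 / 2"] p_lt_2 by simp
      ultimately show ?thesis unfolding c2_def by (intro diff_left_mono mult_left_mono) auto
    qed
    also have "\<dots> \<le> (1 - v\<^sup>2) powr (p / 2) - min c1 c2 * (1 - v\<^sup>2) powr (p / 2)"
    proof -
      have "(1 - v\<^sup>2) powr (p / 2) \<le> 1 powr (p / 2)"
        using wv p_gt_1 by (intro powr_mono2) (auto simp: power_le_one)
      then have "min c1 c2 * (1 - v\<^sup>2) powr (p / 2) \<le> min c1 c2 * 1"
        using c by (intro mult_left_mono) auto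
      then show ?thesis by simp
    qed
    finally show ?thesis by (simp add: algebra_simps)
  qed
  from this[of "\<bar>w\<bar>" "\<bar>v\<bar>" for w v] show ?thesis
    using c by (intro that[of "min c1 c2"]) (auto simp: mid_cov_abs)
qed

text \<open>Self-similarity normalises the mean length \<open>m\<close> to 1. The signed distance of
  the midpoints is y + (a - b)/2, and m (w + v), m (w - v) are the offsets of the right and of the
  left end points.\<close>

lemma inc_cov_eq_mid_cov:
  assumes "0 < a" "0 < b"
  defines "m \<equiv> (a + b) / 2"
  shows "inc_cov a b y = m powr p * mid_cov ((y + (a - b) / 2) / m) ((b - a) / 2 / m)"
    "(a * b) powr (p / 2) = m powr p * (1 - ((b - a) / 2 / m)\<^sup>2) powr (p / 2)"
proof -
  have m: "0 < m" using assms by simp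
  have *: "m powr p * \<bar>u\<bar> powr p = \<bar>m * u\<bar> powr p" for u
    using m by (simp add: abs_mult powr_mult)
  have e: "m * (u / m + 1) = u + m" "m * (u / m - 1) = u - m"
    "m * (u / m + u' / m) = u + u'" "m * (u / m - u' / m) = u - u'" for u u'
    using m by (simp_all add: algebra_simps)
  have "m * ((y + (a - b) / 2) / m + 1) = y + a" "m * ((y + (a - b) / 2) / m - 1) = y - b"
    "m * ((y + (a - b) / 2) / m + (b - a) / 2 / m) = y"
    "m * ((y + (a - b) / 2) / m - (b - a) / 2 / m) = y + a - b"
    by (simp_all only: e) (simp_all add: m_def field_simps)
  then show "inc_cov a b y = m powr p * mid_cov ((y + (a - b) / 2) / m) ((b - a) / 2 / m)"
    by (simp only: mid_cov_def inc_cov_def times_divide_eq_right distrib_left right_diff_distrib *)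
  have "m powr p = (m\<^sup>2) powr (p / 2)" using m by (simp add: power2_eq_square powr_mult flip: powr_add)
  then have "m powr p * (1 - ((b - a) / 2 / m)\<^sup>2) powr (p / 2) = (m\<^sup>2 * (1 - ((b - a) / 2 / m)\<^sup>2)) powr (p / 2)"
  proof -
    have "\<bar>(b - a) / 2 / m\<bar> \<le> 1" using assms by (simp add: m_def abs_le_iff field_simps)
    then have "0 \<le> 1 - ((b - a) / 2 / m)\<^sup>2" by (simp add: abs_square_le_1)
    then show ?thesis using \<open>m powr p = _\<close> by (simp add: powr_mult)
  qed
  also have "m\<^sup>2 * (1 - ((b - a) / 2 / m)\<^sup>2) = m\<^sup>2 - ((b - a) / 2)\<^sup>2"
    using m by (simp add: right_diff_distrib power_divide)
  also have "\<dots> = a * b" by (simp add: m_def power2_eq_square field_simps)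
  finally show "(a * b) powr (p / 2) = m powr p * (1 - ((b - a) / 2 / m)\<^sup>2) powr (p / 2)" ..
qed

text \<open>A quantitative substitute for the local nondeterminism of fractional Brownian motion: only the
  second alternative, of nearly coinciding increments, lets the determinant below degenerate.\<close>

lemma inc_cov_correlation_gap:
  obtains c where "0 < c" "c \<le> 1"
    "\<And>a b y. \<lbrakk>0 < a; 0 < b\<rbrakk> \<Longrightarrow> inc_cov a b y \<le> (1 - c) * (a * b) powr (p / 2) \<or>
      (c * (\<bar>y\<bar> powr p + \<bar>y + a - b\<bar> powr p) \<le> (a * b) powr (p / 2) - inc_cov a b y
        \<and> a \<le> 3 * b \<and> b \<le> 3 * a \<and> \<bar>y\<bar> \<le> a \<and> \<bar>y + a - b\<bar> \<le> a)"
proof -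
  obtain c1 where c1: "0 < c1" "c1 \<le> 1"
    "\<And>w v. \<lbrakk>\<bar>v\<bar> < 1; 1 / 2 < \<bar>w\<bar> + \<bar>v\<bar>\<rbrakk> \<Longrightarrow> mid_cov w v \<le> (1 - c1) * (1 - v\<^sup>2) powr (p / 2)"
    using mid_cov_gap_far by blast
  define c2 where "c2 = (1 - (1 / 2) powr (2 - p)) / 2"
  have c2: "0 < c2" using p_lt_2 powr_less_mono'[of "1/2" 0 "2 - p"] by (auto simp: c2_def)
  show ?thesis
  proof (rule that[of "min c1 c2"])
    fix a b y :: real assume ab: "0 < a" "0 < b"
    define m w v where "m = (a + b) / 2" and "w = (y + (a - b) / 2) / m" and "v = (b - a) / 2 / m"
    have m: "0 < m" using ab by (simp add: m_def)
    note eq = inc_cov_eq_mid_cov(1)[OF ab, of y, folded m_def, folded w_def v_def]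
      inc_cov_eq_mid_cov(2)[OF ab, folded m_def, folded w_def v_def]
    have v: "\<bar>v\<bar> < 1" using ab by (simp add: v_def m_def abs_less_iff field_simps)
    show "inc_cov a b y \<le> (1 - min c1 c2) * (a * b) powr (p / 2) \<or>
      (min c1 c2 * (\<bar>y\<bar> powr p + \<bar>y + a - b\<bar> powr p) \<le> (a * b) powr (p / 2) - inc_cov a b y
        \<and> a \<le> 3 * b \<and> b \<le> 3 * a \<and> \<bar>y\<bar> \<le> a \<and> \<bar>y + a - b\<bar> \<le> a)"
    proof (cases "1 / 2 < \<bar>w\<bar> + \<bar>v\<bar>")
      case True
      have "mid_cov w v \<le> (1 - c1) * (1 - v\<^sup>2) powr (p / 2)" using c1 v True by blast
      also have "\<dots> \<le> (1 - min c1 c2) * (1 - v\<^sup>2) powr (p / 2)" by (intro mult_right_mono) auto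
      finally have "m powr p * mid_cov w v \<le> m powr p * ((1 - min c1 c2) * (1 - v\<^sup>2) powr (p / 2))"
        by (rule mult_left_mono) simp
      then have "inc_cov a b y \<le> (1 - min c1 c2) * (a * b) powr (p / 2)"
        unfolding eq by (simp add: mult_ac)
      then show ?thesis by blast
    next
      case False
      have xy: "y = m * (w + v)" "y + a - b = m * (w - v)"
        using m by (simp_all add: w_def v_def distrib_left right_diff_distrib) (simp_all add: field_simps)
      have le: "\<bar>w + v\<bar> \<le> 1 / 2" "\<bar>w - v\<bar> \<le> 1 / 2" "\<bar>v\<bar> \<le> 1 / 2" using False by linarith+
      \<comment> \<open>With |v| \<le> 1/2 the lengths differ by at most their mean, which gives the
        ratio 3.\<close>
      have "b - a = 2 * m * v" using m by (simp add: v_def)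
      moreover have "\<bar>2 * m * v\<bar> \<le> m" using le(3) m by (simp add: abs_mult)
      ultimately have "\<bar>b - a\<bar> \<le> m" by simp
      then have ab3: "a \<le> 3 * b" "b \<le> 3 * a" unfolding m_def abs_le_iff by (simp_all add: field_simps)
      have "\<bar>m * (w + v)\<bar> \<le> m / 2" "\<bar>m * (w - v)\<bar> \<le> m / 2"
        using le m by (simp_all add: abs_mult)
      then have "\<bar>y\<bar> \<le> m / 2" "\<bar>y + a - b\<bar> \<le> m / 2"
        using xy by simp_all
      then have le': "\<bar>y\<bar> \<le> a" "\<bar>y + a - b\<bar> \<le> a" using ab3 by (auto simp: m_def)
      have "min c1 c2 * (\<bar>w + v\<bar> powr p + \<bar>w - v\<bar> powr p) \<le> c2 * (\<bar>w + v\<bar> powr p + \<bar>w - v\<bar> powr p)"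
        by (intro mult_right_mono) auto
      also have "\<dots> \<le> (1 - v\<^sup>2) powr (p / 2) - mid_cov w v"
        unfolding c2_def using mid_cov_gap_near le by blast
      finally have "m powr p * (min c1 c2 * (\<bar>w + v\<bar> powr p + \<bar>w - v\<bar> powr p))
          \<le> m powr p * ((1 - v\<^sup>2) powr (p / 2) - mid_cov w v)"
        by (rule mult_left_mono) simp
      moreover have "\<bar>y\<bar> powr p = m powr p * \<bar>w + v\<bar> powr p" "\<bar>y + a - b\<bar> powr p = m powr p * \<bar>w - v\<bar> powr p"
        using m arg_cong[OF xy(1), of "\<lambda>z. \<bar>z\<bar> powr p"] arg_cong[OF xy(2), of "\<lambda>z. \<bar>z\<bar> powr p"]
        by (simp_all add: abs_mult powr_mult)
      ultimately have "min c1 c2 * (\<bar>y\<bar> powr p + \<bar>y + a - b\<bar> powr p) \<le> (a * b) powr (p / 2) - inc_cov a b y"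
        unfolding eq by (simp add: algebra_simps)
      then show ?thesis using ab3 le' by blast
    qed
  qed (use c1 c2 in auto)
qed

section \<open>Lower bounds for the determinant\<close>

text \<open>The determinant of the identity plus the covariance matrix of these two increments.\<close>

definition inc_det :: "real \<Rightarrow> real \<Rightarrow> real \<Rightarrow> real" where
  "inc_det a b y = (1 + a powr p) * (1 + b powr p) - (inc_cov a b y)\<^sup>2"

text \<open>The Cauchy-Schwarz inequality for two increments, read off from the correlation gap and
  hence available before any process is given.\<close>

lemma inc_cov_le_geometric_mean:
  assumes "0 < a" "0 < b" shows "inc_cov a b y \<le> (a * b) powr (p / 2)"
proof -
  obtain c where c: "0 < c" "c \<le> 1" "inc_cov a b y \<le> (1 - c) * (a * b) powr (p / 2) \<or>
      c * (\<bar>y\<bar> powr p + \<bar>y + a - b\<bar> powr p) \<le> (a * b) powr (p / 2) - inc_cov a b y"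
    using inc_cov_correlation_gap assms by metis
  have "(1 - c) * (a * b) powr (p / 2) \<le> 1 * (a * b) powr (p / 2)"
    using c by (intro mult_right_mono) auto
  moreover have "0 \<le> c * (\<bar>y\<bar> powr p + \<bar>y + a - b\<bar> powr p)" using c by simp
  ultimately show ?thesis using c(3) by linarith
qed

lemma powr_half_square:
  assumes "0 < a" "0 < b" shows "((a * b) powr (p / 2))\<^sup>2 = a powr p * b powr p"
proof -
  have "x powr (p / 2) * x powr (p / 2) = x powr p" for x :: real by (simp flip: powr_add)
  moreover have "((a * b) powr (p / 2))\<^sup>2 = (a powr (p / 2) * a powr (p / 2)) * (b powr (p / 2) * b powr (p / 2))"
    using assms by (simp only: power2_eq_square powr_mult less_imp_le mult_ac)
  ultimately show ?thesis by (simp only:)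
qed

lemma inc_det_ge_1:
  assumes "0 < a" "0 < b" shows "1 + a powr p + b powr p \<le> inc_det a b y"
proof -
  have "(inc_cov a b y)\<^sup>2 \<le> ((a * b) powr (p / 2))\<^sup>2"
    using inc_cov_le_geometric_mean inc_cov_nonneg assms by (intro power_mono) auto
  then show ?thesis unfolding powr_half_square[OF assms] by (simp add: inc_det_def algebra_simps)
qed

text \<open>If the correlation is bounded away from 1, D is at least a multiple of (1 + a^p)(1 +
  b^p), which gives the first term. Otherwise the lengths are comparable and D is at least a
  multiple of (1 + a^p)(1 + g), where g sums the p-th powers of the end point offsets; this gives
  the second term.\<close>

lemma inc_cov_det_bound:
  obtains C where "0 < C"
    "\<And>a b y. \<lbrakk>0 < a; 0 < b; y \<noteq> 0\<rbrakk> \<Longrightarrow> inc_cov a b y / (inc_det a b y)\<^sup>2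
      \<le> C * (a * b * \<bar>y\<bar> powr (p - 2) / ((1 + a powr p)\<^sup>2 * (1 + b powr p)\<^sup>2))
        + C * (a powr p / ((1 + a powr p)\<^sup>2 * ((1 + \<bar>y\<bar> powr p) * (1 + \<bar>y + a - b\<bar> powr p))))"
proof -
  obtain c where c: "0 < c" "c \<le> 1"
    "\<And>a b y. \<lbrakk>0 < a; 0 < b\<rbrakk> \<Longrightarrow> inc_cov a b y \<le> (1 - c) * (a * b) powr (p / 2) \<or>
      (c * (\<bar>y\<bar> powr p + \<bar>y + a - b\<bar> powr p) \<le> (a * b) powr (p / 2) - inc_cov a b y
        \<and> a \<le> 3 * b \<and> b \<le> 3 * a \<and> \<bar>y\<bar> \<le> a \<and> \<bar>y + a - b\<bar> \<le> a)"
    using inc_cov_correlation_gap by blast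
  show ?thesis
  \<comment> \<open>243 = 3 * 9^2: the numerator is at most 3 l and D is at least (c/9)(1 + l)(1 +
    g). The far case needs only 16.\<close>
  proof (rule that[of "243 / c\<^sup>2"])
    fix a b y :: real assume ab: "0 < a" "0 < b" "y \<noteq> 0"
    define l r P m D g where "l = a powr p" and "r = b powr p" and "P = (a * b) powr (p / 2)"
      and "m = inc_cov a b y" and "D = inc_det a b y" and "g = \<bar>y\<bar> powr p + \<bar>y + a - b\<bar> powr p"
    have pos: "0 < l" "0 < r" "0 < P" "0 \<le> m" "m \<le> P" "0 \<le> g" "P\<^sup>2 = l * r"
      using ab inc_cov_nonneg inc_cov_le_geometric_mean powr_half_square
      by (auto simp: l_def r_def P_def m_def g_def)
    have D: "D = (1 + l) * (1 + r) - m\<^sup>2" by (simp add: D_def l_def r_def m_def inc_det_def)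
    let ?A = "a * b * \<bar>y\<bar> powr (p - 2) / ((1 + l)\<^sup>2 * (1 + r)\<^sup>2)"
    let ?B = "l / ((1 + l)\<^sup>2 * ((1 + \<bar>y\<bar> powr p) * (1 + \<bar>y + a - b\<bar> powr p)))"
    have nn: "0 \<le> 243 / c\<^sup>2 * ?A" "0 \<le> 243 / c\<^sup>2 * ?B" using ab pos by auto
    consider (far) "m \<le> (1 - c) * P"
      | (near) "c * g \<le> P - m" "a \<le> 3 * b" "b \<le> 3 * a" "\<bar>y\<bar> \<le> a" "\<bar>y + a - b\<bar> \<le> a"
      using c(3)[OF ab(1,2), of y] by (auto simp: m_def P_def g_def)
    then have "m / D\<^sup>2 \<le> 243 / c\<^sup>2 * ?A + 243 / c\<^sup>2 * ?B"
    proof cases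
      case far
      have "m\<^sup>2 \<le> ((1 - c) * P)\<^sup>2" using far pos by (intro power_mono) auto
      also have "\<dots> = (1 - c)\<^sup>2 * (l * r)" using pos by (simp add: power_mult_distrib)
      also have "\<dots> \<le> (1 - c) * (l * r)"
        using c pos by (intro mult_right_mono) (auto simp: power2_eq_square mult_left_le)
      finally have "c * ((1 + l) * (1 + r)) \<le> D"
      proof -
        assume "m\<^sup>2 \<le> (1 - c) * (l * r)"
        then have "1 + l + r + c * (l * r) \<le> D" by (simp add: D algebra_simps)
        moreover have "c * (1 + l + r) \<le> 1 * (1 + l + r)" using c pos by (intro mult_right_mono) auto
        ultimately show ?thesis by (simp add: algebra_simps)
      qed
      then have "(c * ((1 + l) * (1 + r)))\<^sup>2 \<le> D\<^sup>2" using c pos by (intro power_mono) auto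
      moreover have "0 < (c * ((1 + l) * (1 + r)))\<^sup>2" using c pos by auto
      ultimately have "m / D\<^sup>2 \<le> (16 * (a * b * \<bar>y\<bar> powr (p - 2))) / (c * ((1 + l) * (1 + r)))\<^sup>2"
        using inc_cov_le[OF ab] pos by (intro frac_le) (auto simp: m_def)
      also have "\<dots> = 16 / c\<^sup>2 * ?A" by (simp add: power_mult_distrib)
      also have "\<dots> \<le> 243 / c\<^sup>2 * ?A" using c ab pos by (intro mult_right_mono divide_right_mono) auto
      finally show ?thesis using nn by linarith
    next
      case near
      have P_up: "P \<le> 3 * l"
      proof -
        have "P \<le> (3 * (a * a)) powr (p / 2)"
          unfolding P_def using near ab p_gt_1 by (intro powr_mono2) auto
        also have "\<dots> = 3 powr (p / 2) * l"
          using ab by (simp add: powr_mult l_def flip: powr_add)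
        also have "\<dots> \<le> 3 powr 1 * l" using p_lt_2 pos by (intro mult_right_mono powr_mono) auto
        finally show ?thesis by simp
      qed
      have P_lo: "l \<le> 3 * P"
      proof -
        have "l = (a * a) powr (p / 2)" using ab by (simp add: powr_mult l_def flip: powr_add)
        also have "\<dots> \<le> (3 * (a * b)) powr (p / 2)"
          using near ab p_gt_1 by (intro powr_mono2) auto
        also have "\<dots> = 3 powr (p / 2) * P" using ab by (simp add: powr_mult P_def)
        also have "\<dots> \<le> 3 powr 1 * P" using p_lt_2 pos by (intro mult_right_mono powr_mono) auto
        finally show ?thesis by simp
      qed
      have "\<bar>y\<bar> powr p \<le> l" "\<bar>y + a - b\<bar> powr p \<le> l"
        unfolding l_def using near p_gt_1 by (auto intro!: powr_mono2)
      then have g: "g \<le> 2 * l" by (simp add: g_def)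
      \<comment> \<open>Since l r = P^2, the degenerate part of D factors: the gap bounds P - m
        below by c g, and P + m is at least P \<ge> l/3.\<close>
      have "D = 1 + l + r + (P - m) * (P + m)"
        using pos(7) by (simp add: D algebra_simps power2_eq_square)
      moreover have "c * g * (l / 3) \<le> (P - m) * (P + m)"
        using near P_lo c pos by (intro mult_mono) auto
      ultimately have "1 + l + c * g * (l / 3) \<le> D" using pos by linarith
      \<comment> \<open>The bound g \<le> 2 l lets 1 + l absorb the linear term g.\<close>
      moreover have "c / 9 * ((1 + l) * (1 + g)) \<le> 1 + l + c * g * (l / 3)"
      proof -
        have "c / 9 * (1 + l + g) \<le> 1 / 9 * (1 + l + g)" using c pos by (intro mult_right_mono) auto
        moreover have "c / 9 * (l * g) \<le> c / 3 * (l * g)" using c pos by (intro mult_right_mono) auto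
        ultimately have "c / 9 * (1 + l + g) + c / 9 * (l * g) \<le> 1 / 9 * (1 + l + g) + c / 3 * (l * g)"
          by (rule add_mono)
        moreover have "1 / 9 * (1 + l + g) \<le> 1 + l" using g pos by simp
        ultimately have "c / 9 * (1 + l + g) + c / 9 * (l * g) \<le> 1 + l + c / 3 * (l * g)" by linarith
        moreover have "c / 9 * ((1 + l) * (1 + g)) = c / 9 * (1 + l + g) + c / 9 * (l * g)"
          "c * g * (l / 3) = c / 3 * (l * g)" by (simp_all add: field_simps)
        ultimately show ?thesis by (simp only:)
      qed
      ultimately have "c / 9 * ((1 + l) * (1 + g)) \<le> D" by linarith
      then have "(c / 9 * ((1 + l) * (1 + g)))\<^sup>2 \<le> D\<^sup>2" using c pos by (intro power_mono) auto
      moreover have pos': "0 < (c / 9 * ((1 + l) * (1 + g)))\<^sup>2" using c pos by auto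
      ultimately have "m / D\<^sup>2 \<le> 3 * l / (c / 9 * ((1 + l) * (1 + g)))\<^sup>2"
        using pos P_up by (intro frac_le) auto
      also have "\<dots> = 243 / c\<^sup>2 * (l / ((1 + l)\<^sup>2 * ((1 + g) * (1 + g))))"
        using c by (simp add: power_mult_distrib power_divide power2_eq_square)
      \<comment> \<open>Both powers in \<open>?B\<close> are at most g, so one factor 1 + g is spent
        on each offset. The resulting weights are integrable one variable at a time.\<close>
      also have "\<dots> \<le> 243 / c\<^sup>2 * ?B"
        using pos by (intro mult_left_mono divide_left_mono mult_mono mult_pos_pos)
          (auto simp: g_def add_pos_nonneg)
      finally show ?thesis using nn by linarith
    qed
    then show "inc_cov a b y / (inc_det a b y)\<^sup>2
      \<le> 243 / c\<^sup>2 * (a * b * \<bar>y\<bar> powr (p - 2) / ((1 + a powr p)\<^sup>2 * (1 + b powr p)\<^sup>2))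
        + 243 / c\<^sup>2 * (a powr p / ((1 + a powr p)\<^sup>2 * ((1 + \<bar>y\<bar> powr p) * (1 + \<bar>y + a - b\<bar> powr p))))"
      by (simp only: m_def D_def l_def r_def)
  qed (use c in auto)
qed

end

section \<open>Explicit integrals\<close>

context hurst_exponent
begin

text \<open>The integral of a / (1 + a^p)^2 over the positive axis. With p = 2H the Beta arguments
  are 1/H and (4H - 2)/(2H), those of the asserted variance.\<close>

definition beta_int :: real where "beta_int = Beta (2 / p) (2 - 2 / p) / p"

lemma beta_int_nonneg: "0 \<le> beta_int"
proof -
  have "0 < 2 / p" "0 < 2 - 2 / p" using p_gt_1 by (simp_all add: field_simps)
  note G = Gamma_real_pos[OF this(1)] Gamma_real_pos[OF this(2)] Gamma_real_pos[OF add_pos_pos[OF this]]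
  have "0 < Beta (2 / p) (2 - 2 / p)"
    unfolding Beta_def by (rule divide_pos_pos[OF mult_pos_pos[OF G(1,2)] G(3)])
  then show ?thesis using p_gt_1 by (simp add: beta_int_def)
qed

text \<open>The substitution u = a^p / (1 + a^p) maps the half-line onto (0, 1) and produces the
  Beta integrand; its second exponent is admissible because p > 1.\<close>

lemma nn_integral_beta_int:
  "(\<integral>\<^sup>+a. ennreal (a / (1 + a powr p)\<^sup>2) * indicator {0<..} a \<partial>lborel) = ennreal beta_int"
proof -
  let ?g = "\<lambda>a. a powr p / (1 + a powr p)" and ?g' = "\<lambda>a. p * a powr (p - 1) / (1 + a powr p)\<^sup>2"
  let ?f = "\<lambda>u. u powr (2 / p - 1) * (1 - u) powr ((2 - 2 / p) - 1)"
  have pos: "0 < 1 + a powr p" for a by (simp add: add_pos_nonneg)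
  have der: "(?g has_field_derivative ?g' a) (at a within {0<..})" if "a \<in> {0<..}" for a
    using that pos[of a] by (auto intro!: derivative_eq_intros simp: field_simps power2_eq_square)
  have inj: "inj_on ?g {0<..}"
  proof (rule inj_onI)
    fix a b :: real assume ab: "a \<in> {0<..}" "b \<in> {0<..}" "?g a = ?g b"
    have "a powr p * (1 + b powr p) = b powr p * (1 + a powr p)"
      using ab(3) pos[of a] pos[of b] by (simp add: field_simps)
    then have "a powr p = b powr p" by (simp add: algebra_simps)
    then show "a = b" using ab p_gt_1 powr_inj[of p a b] by (metis greaterThan_iff less_eq_real_def not_one_less_zero powr_powr powr_one_gt_zero_iff right_inverse)
  qed
  have img: "?g ` {0<..} = {0<..<1}"
  proof (intro equalityI subsetI)
    fix u assume "u \<in> ?g ` {0<..}"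
    then show "u \<in> {0<..<1}" using pos by (auto simp: divide_less_eq)
  next
    fix u :: real assume u: "u \<in> {0<..<1}"
    let ?a = "(u / (1 - u)) powr (1 / p)"
    have a: "?a powr p = u / (1 - u)" using u p_gt_1 by (simp add: powr_powr)
    have "?g ?a = u" unfolding a using u by (simp add: field_simps)
    moreover have "?a \<in> {0<..}" using u by simp
    ultimately show "u \<in> ?g ` {0<..}" by (intro rev_image_eqI[of ?a]) (simp_all only:)
  qed
  have eq: "\<bar>?g' a\<bar> * ?f (?g a) = p * (a / (1 + a powr p)\<^sup>2)" if "a \<in> {0<..}" for a
  proof -
    have a: "0 < a" using that by simp
    have "1 - ?g a = 1 / (1 + a powr p)" using pos[of a] by (simp add: field_simps)
    moreover have "?g a powr (2 / p - 1) = a powr (2 - p) / (1 + a powr p) powr (2 / p - 1)"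
      using a p_gt_1 pos[of a] by (simp add: powr_divide powr_powr right_diff_distrib)
    moreover have "(1 / (1 + a powr p)) powr ((2 - 2 / p) - 1) = (1 + a powr p) powr (2 / p - 1)"
      using pos[of a] by (simp add: powr_divide flip: powr_minus_divide)
    ultimately have "?f (?g a) = a powr (2 - p)" using pos[of a] by simp
    moreover have "a powr (p - 1) * a powr (2 - p) = a" using a by (simp flip: powr_add)
    ultimately show ?thesis using p_gt_1 a by (simp add: abs_of_pos mult.assoc)
  qed
  have b: "0 < 2 / p" "0 < 2 - 2 / p" using p_gt_1 by (simp_all add: field_simps)
  have B: "(?f has_integral Beta (2 / p) (2 - 2 / p)) {0<..<1}"
    using has_integral_Beta_real[OF b] by (simp add: has_integral_Icc_iff_Ioo)
  have "?f absolutely_integrable_on {0<..<1}"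
    by (rule nonnegative_absolutely_integrable_1) (use B in auto)
  then have "(\<lambda>a. \<bar>?g' a\<bar> * ?f (?g a)) absolutely_integrable_on {0<..} \<and>
      integral {0<..} (\<lambda>a. \<bar>?g' a\<bar> * ?f (?g a)) = Beta (2 / p) (2 - 2 / p)"
    using B by (subst has_absolute_integral_change_of_variables_1'[OF _ der inj]) (auto simp: img)
  then have "((\<lambda>a. \<bar>?g' a\<bar> * ?f (?g a)) has_integral Beta (2 / p) (2 - 2 / p)) {0<..}"
    using integrable_integral[OF set_lebesgue_integral_eq_integral(1)] by fastforce
  then have "((\<lambda>a. p * (a / (1 + a powr p)\<^sup>2)) has_integral Beta (2 / p) (2 - 2 / p)) {0<..}"
    by (subst (asm) has_integral_cong[OF eq])
  from has_integral_divide[OF this, of p]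
  have "((\<lambda>a. a / (1 + a powr p)\<^sup>2) has_integral beta_int) {0<..}"
    using p_gt_1 by (simp add: beta_int_def)
  then show ?thesis by (rule nn_integral_has_integral_lebesgue'[rotated]) auto
qed

text \<open>Finite because p > 1. Its cube is the constant in the contribution of nearly coinciding
  increments.\<close>

definition tail_int :: ennreal where "tail_int = (\<integral>\<^sup>+x. ennreal (1 / (1 + \<bar>x\<bar> powr p)) \<partial>lborel)"

lemma tail_int_finite: "tail_int < \<infinity>"
proof -
  have h: "((\<lambda>x. x powr - p) has_integral - (1 powr (- p + 1)) / (- p + 1)) {1..}"
    using p_gt_1 by (intro has_integral_powr_to_inf) auto
  have half: "(\<integral>\<^sup>+x. ennreal (x powr - p) * indicator {1..} x \<partial>lborel) < \<infinity>"
    unfolding nn_integral_has_integral_lebesgue'[OF _ h, simplified] by simp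
  have "tail_int \<le> (\<integral>\<^sup>+x. indicator {-1..1} x + (ennreal (x powr - p) * indicator {1..} x
      + ennreal ((- x) powr - p) * indicator {1..} (- x)) \<partial>lborel)"
    unfolding tail_int_def
  proof (rule nn_integral_mono)
    fix x :: real
    have le: "1 / (1 + y powr p) \<le> y powr - p" if "1 \<le> y" for y :: real
      using that unfolding powr_minus_divide by (intro divide_left_mono) (auto intro!: mult_pos_pos add_pos_nonneg)
    consider "x \<in> {-1..1}" | "1 < x" | "x < - 1" by fastforce
    then show "ennreal (1 / (1 + \<bar>x\<bar> powr p)) \<le> indicator {-1..1} x + (ennreal (x powr - p) * indicator {1..} x
      + ennreal ((- x) powr - p) * indicator {1..} (- x))"
    proof cases
      case 1
      have "1 / (1 + \<bar>x\<bar> powr p) \<le> 1" by (simp add: divide_le_eq_1 add_pos_nonneg)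
      then have "ennreal (1 / (1 + \<bar>x\<bar> powr p)) \<le> 1" by (simp add: ennreal_le_1)
      then show ?thesis using 1 by (simp add: add_increasing2)
    next
      case 2
      then show ?thesis using le[of x] by (simp add: ennreal_leI)
    next
      case 3
      then show ?thesis using le[of "- x"] by (simp add: ennreal_leI)
    qed
  qed
  also have "\<dots> = (\<integral>\<^sup>+x. indicator {-1..1::real} x \<partial>lborel) + ((\<integral>\<^sup>+x. ennreal (x powr - p) * indicator {1..} x \<partial>lborel)
      + (\<integral>\<^sup>+x. ennreal ((- x) powr - p) * indicator {1..} (- x) \<partial>lborel))"
    by (subst nn_integral_add; (subst nn_integral_add)?; simp)
  also have "(\<integral>\<^sup>+x. ennreal ((- x) powr - p) * indicator {1..} (- x) \<partial>lborel) = (\<integral>\<^sup>+x. ennreal (x powr - p) * indicator {1..} x \<partial>lborel)"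
    using nn_integral_real_affine[of "\<lambda>x. ennreal (x powr - p) * indicator {1..} x" "- 1" 0] by simp
  also have "(\<integral>\<^sup>+x. indicator {-1..1::real} x \<partial>lborel) + ((\<integral>\<^sup>+x. ennreal (x powr - p) * indicator {1..} x \<partial>lborel)
      + (\<integral>\<^sup>+x. ennreal (x powr - p) * indicator {1..} x \<partial>lborel)) < \<infinity>"
    using half by simp
  finally show ?thesis .
qed

lemma nn_integral_shifted_tail:
  assumes "0 < c" shows "(\<integral>\<^sup>+x. ennreal (1 / (1 + \<bar>(x - d) / c\<bar> powr p)) \<partial>lborel) = ennreal c * tail_int"
proof -
  have "(d + c * x - d) / c = x" "\<bar>c\<bar> = c" for x using assms by auto
  then show ?thesis unfolding tail_int_def
    using nn_integral_real_affine[of "\<lambda>x. ennreal (1 / (1 + \<bar>(x - d) / c\<bar> powr p))" c d] assms by (simp only:) simp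
qed

lemma nn_integral_abs_powr:
  assumes "0 \<le> s" "s \<le> t"
  shows "(\<integral>\<^sup>+r. ennreal (\<bar>r - s\<bar> powr (p - 2)) * indicator {0..t} r \<partial>lborel)
    = ennreal ((s powr (p - 1) + (t - s) powr (p - 1)) / (p - 1))"
proof -
  have base: "(\<integral>\<^sup>+x. ennreal (x powr (p - 2)) * indicator {0..c} x \<partial>lborel) = ennreal (c powr (p - 1) / (p - 1))"
    if "0 \<le> c" for c :: real
    using has_integral_powr_from_0[of "p - 2" c] that p_gt_1
    by (intro nn_integral_has_integral_lebesgue') (auto simp: diff_add_eq)
  have 1: "(\<integral>\<^sup>+r. ennreal (\<bar>r - s\<bar> powr (p - 2)) * indicator {s..t} r \<partial>lborel) = ennreal ((t - s) powr (p - 1) / (p - 1))"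
  proof -
    have "(\<integral>\<^sup>+r. ennreal (\<bar>r - s\<bar> powr (p - 2)) * indicator {s..t} r \<partial>lborel)
      = (\<integral>\<^sup>+x. ennreal (\<bar>x\<bar> powr (p - 2)) * indicator {s..t} (s + x) \<partial>lborel)"
      using nn_integral_real_affine[of "\<lambda>r. ennreal (\<bar>r - s\<bar> powr (p - 2)) * indicator {s..t} r" 1 s] by simp
    also have "\<dots> = (\<integral>\<^sup>+x. ennreal (x powr (p - 2)) * indicator {0..t - s} x \<partial>lborel)"
      by (intro nn_integral_cong) (auto simp: indicator_def)
    finally show ?thesis using base[of "t - s"] assms by simp
  qed
  have 2: "(\<integral>\<^sup>+r. ennreal (\<bar>r - s\<bar> powr (p - 2)) * indicator {0..s} r \<partial>lborel) = ennreal (s powr (p - 1) / (p - 1))"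
  proof -
    have "(\<integral>\<^sup>+r. ennreal (\<bar>r - s\<bar> powr (p - 2)) * indicator {0..s} r \<partial>lborel)
      = (\<integral>\<^sup>+x. ennreal (\<bar>x\<bar> powr (p - 2)) * indicator {0..s} (s - x) \<partial>lborel)"
      using nn_integral_real_affine[of "\<lambda>r. ennreal (\<bar>r - s\<bar> powr (p - 2)) * indicator {0..s} r" "- 1" s] by simp
    also have "\<dots> = (\<integral>\<^sup>+x. ennreal (x powr (p - 2)) * indicator {0..s} x \<partial>lborel)"
      by (intro nn_integral_cong) (auto simp: indicator_def)
    finally show ?thesis using base[of s] assms by simp
  qed
  have "(\<integral>\<^sup>+r. ennreal (\<bar>r - s\<bar> powr (p - 2)) * indicator {0..t} r \<partial>lborel)
    = (\<integral>\<^sup>+r. ennreal (\<bar>r - s\<bar> powr (p - 2)) * indicator {0..s} r + ennreal (\<bar>r - s\<bar> powr (p - 2)) * indicator {s..t} r \<partial>lborel)"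
    using assms by (intro nn_integral_cong) (auto simp: indicator_def)
  also have "\<dots> = ennreal (s powr (p - 1) / (p - 1)) + ennreal ((t - s) powr (p - 1) / (p - 1))"
    by (subst nn_integral_add) (auto simp: 1 2)
  also have "\<dots> = ennreal ((s powr (p - 1) + (t - s) powr (p - 1)) / (p - 1))"
    using p_gt_1 by (simp add: add_divide_distrib flip: ennreal_plus)
  finally show ?thesis .
qed

lemma nn_integral_powr_sum:
  assumes "0 < t"
  shows "(\<integral>\<^sup>+s. ennreal (s powr (p - 1) + (t - s) powr (p - 1)) * indicator {0..t} s \<partial>lborel) = ennreal (2 * t powr p / p)"
proof -
  have base: "(\<integral>\<^sup>+x. ennreal (x powr (p - 1)) * indicator {0..t} x \<partial>lborel) = ennreal (t powr p / p)"
    using has_integral_powr_from_0[of "p - 1" t] assms p_gt_1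
    by (intro nn_integral_has_integral_lebesgue') auto
  have "(\<integral>\<^sup>+x. ennreal ((t - x) powr (p - 1)) * indicator {0..t} x \<partial>lborel)
    = (\<integral>\<^sup>+x. ennreal (x powr (p - 1)) * indicator {0..t} (t - x) \<partial>lborel)"
    using nn_integral_real_affine[of "\<lambda>x. ennreal ((t - x) powr (p - 1)) * indicator {0..t} x" "- 1" t] by simp
  also have "\<dots> = (\<integral>\<^sup>+x. ennreal (x powr (p - 1)) * indicator {0..t} x \<partial>lborel)"
    by (intro nn_integral_cong) (auto simp: indicator_def)
  finally have refl: "(\<integral>\<^sup>+x. ennreal ((t - x) powr (p - 1)) * indicator {0..t} x \<partial>lborel) = ennreal (t powr p / p)"
    using base by simp
  have "(\<integral>\<^sup>+s. ennreal (s powr (p - 1) + (t - s) powr (p - 1)) * indicator {0..t} s \<partial>lborel)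
    = (\<integral>\<^sup>+s. ennreal (s powr (p - 1)) * indicator {0..t} s + ennreal ((t - s) powr (p - 1)) * indicator {0..t} s \<partial>lborel)"
    by (intro nn_integral_cong) (simp add: distrib_right)
  also have "\<dots> = ennreal (t powr p / p) + ennreal (t powr p / p)"
    by (subst nn_integral_add) (auto simp: base refl)
  also have "\<dots> = ennreal (2 * t powr p / p)" using p_gt_1 by (simp flip: ennreal_plus)
  finally show ?thesis .
qed

end

section \<open>Gaussian calculus\<close>

lemma abs_mult_le_sum_squares: "\<bar>x * y\<bar> \<le> x\<^sup>2 + y\<^sup>2" for x y :: real
proof -
  have "0 \<le> (\<bar>x\<bar> - \<bar>y\<bar>)\<^sup>2" by simp
  then have "2 * \<bar>x * y\<bar> \<le> x\<^sup>2 + y\<^sup>2" by (simp add: power2_diff abs_mult)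
  then show ?thesis using abs_ge_zero[of "x * y"] by linarith
qed

interpretation std_normal: real_distribution std_normal_distribution
  by (rule real_dist_normal_dist)

text \<open>The phase \<open>c\<close> carries the other variable when two averages are iterated;
  shifting it by pi/2 exchanges sine and cosine.\<close>

lemma integral_std_normal_cos:
  "(\<integral>\<xi>. cos (x * \<xi> + c) \<partial>std_normal_distribution) = cos c * exp (- x\<^sup>2 / 2)"
proof -
  have i: "integrable std_normal_distribution (\<lambda>\<xi>. iexp (x * \<xi>))"
    by (rule std_normal.integrable_iexp) auto
  have "(\<integral>\<xi>. cos (x * \<xi> + c) \<partial>std_normal_distribution) = (\<integral>\<xi>. Re (iexp c * iexp (x * \<xi>)) \<partial>std_normal_distribution)"
    by (simp add: Re_exp Im_exp cos_add mult.commute)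
  also have "\<dots> = Re (\<integral>\<xi>. iexp c * iexp (x * \<xi>) \<partial>std_normal_distribution)"
    using i by (intro integral_Re integrable_mult_right) auto
  also have "\<dots> = Re (iexp c * char std_normal_distribution x)"
    by (simp add: char_def)
  also have "\<dots> = cos c * exp (- x\<^sup>2 / 2)"
    by (simp add: char_std_normal_distribution Re_exp Im_exp)
  finally show ?thesis .
qed

text \<open>Differentiation of E cos(U + h W) at h = 0 under the expectation: the difference
  quotients are dominated by |W|, as the cosine is 1-Lipschitz. Moments linear in \<open>W\<close>
  are thus read off from a characteristic function.\<close>

lemma (in prob_space) expectation_mult_sin:
  fixes U W :: "'a \<Rightarrow> real"
  assumes [measurable]: "U \<in> borel_measurable M" and W: "integrable M W"
    and \<phi>: "\<And>h. expectation (\<lambda>\<omega>. cos (U \<omega> + h * W \<omega>)) = \<phi> h"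
    and d: "(\<phi> has_real_derivative d) (at 0)"
  shows "expectation (\<lambda>\<omega>. W \<omega> * sin (U \<omega>)) = - d"
proof -
  have [measurable]: "W \<in> borel_measurable M" using W by auto
  let ?h = "\<lambda>n. inverse (real (Suc n))"
  let ?q = "\<lambda>n \<omega>. (cos (U \<omega> + ?h n * W \<omega>) - cos (U \<omega>)) / ?h n"
  have h0: "?h \<longlonglongrightarrow> 0" by (rule LIMSEQ_inverse_real_of_nat)
  have h: "filterlim ?h (at 0) sequentially"
    using h0 by (auto simp: filterlim_at)
  have "(\<lambda>n. expectation (?q n)) \<longlonglongrightarrow> expectation (\<lambda>\<omega>. - (W \<omega> * sin (U \<omega>)))"
  proof (rule integral_dominated_convergence[where w = "\<lambda>\<omega>. \<bar>W \<omega>\<bar>"])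
    show "AE \<omega> in M. (\<lambda>n. ?q n \<omega>) \<longlonglongrightarrow> - (W \<omega> * sin (U \<omega>))"
    proof (rule AE_I2)
      fix \<omega>
      have "((\<lambda>h. cos (U \<omega> + h * W \<omega>)) has_real_derivative - (W \<omega> * sin (U \<omega>))) (at 0)"
        by (auto intro!: derivative_eq_intros)
      then have "((\<lambda>h. (cos (U \<omega> + h * W \<omega>) - cos (U \<omega>)) / h) \<longlongrightarrow> - (W \<omega> * sin (U \<omega>))) (at 0)"
        by (simp add: DERIV_def)
      from filterlim_compose[OF this h] show "(\<lambda>n. ?q n \<omega>) \<longlonglongrightarrow> - (W \<omega> * sin (U \<omega>))" .
    qed
    fix n show "AE \<omega> in M. norm (?q n \<omega>) \<le> \<bar>W \<omega>\<bar>"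
    proof (rule AE_I2)
      fix \<omega>
      have "\<bar>cos (U \<omega> + ?h n * W \<omega>) - cos (U \<omega>)\<bar> \<le> \<bar>?h n * W \<omega>\<bar>"
      proof -
        have "cos (U \<omega> + ?h n * W \<omega>) - cos (U \<omega>)
          = 2 * sin ((U \<omega> + ?h n * W \<omega> + U \<omega>) / 2) * sin ((U \<omega> - (U \<omega> + ?h n * W \<omega>)) / 2)"
          by (rule cos_diff_cos)
        also have "\<bar>\<dots>\<bar> = 2 * (\<bar>sin ((U \<omega> + ?h n * W \<omega> + U \<omega>) / 2)\<bar> * \<bar>sin ((- (?h n * W \<omega>)) / 2)\<bar>)"
          by (simp add: abs_mult)
        also have "\<dots> \<le> 2 * (1 * \<bar>(- (?h n * W \<omega>)) / 2\<bar>)"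
          by (intro mult_left_mono mult_mono abs_sin_x_le_abs_x) auto
        finally show ?thesis by simp
      qed
      also have "\<dots> = \<bar>W \<omega>\<bar> * ?h n" by (simp add: abs_mult mult.commute)
      finally show "norm (?q n \<omega>) \<le> \<bar>W \<omega>\<bar>"
        by (simp only: real_norm_def abs_divide) (simp add: field_simps)
    qed
  qed (use W in auto)
  moreover have "expectation (?q n) = (\<phi> (0 + ?h n) - \<phi> 0) / ?h n" for n
  proof -
    have 1: "integrable M (\<lambda>\<omega>. cos (U \<omega> + c * W \<omega>))" for c
      by (rule integrable_const_bound[where B = 1]) auto
    have "expectation (?q n) = (expectation (\<lambda>\<omega>. cos (U \<omega> + ?h n * W \<omega>)) - expectation (\<lambda>\<omega>. cos (U \<omega> + 0 * W \<omega>))) / ?h n"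
      using 1[of "?h n"] 1[of 0] by simp
    then show ?thesis by (simp only: \<phi> add_0)
  qed
  moreover have "(\<lambda>n. (\<phi> (0 + ?h n) - \<phi> 0) / ?h n) \<longlonglongrightarrow> d"
    using filterlim_compose[OF d[unfolded DERIV_def] h] by simp
  ultimately have "expectation (\<lambda>\<omega>. - (W \<omega> * sin (U \<omega>))) = d"
    using LIMSEQ_unique by auto
  then show ?thesis by simp
qed

lemma integrable_std_normal_ident: "integrable std_normal_distribution (\<lambda>\<xi>. \<xi>)"
  using integrable_std_normal_distribution_moment[of 1] by (simp only: power_one_right)

lemma integral_std_normal_mult_sin:
  "(\<integral>\<xi>. \<xi> * sin (x * \<xi> + c) \<partial>std_normal_distribution) = cos c * (x * exp (- x\<^sup>2 / 2))"
proof -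
  have "(\<integral>\<xi>. \<xi> * sin (x * \<xi> + c) \<partial>std_normal_distribution) = - (- (cos c * (x * exp (- x\<^sup>2 / 2))))"
  proof (rule std_normal.expectation_mult_sin)
    show "(\<integral>\<xi>. cos (x * \<xi> + c + h * \<xi>) \<partial>std_normal_distribution) = cos c * exp (- (x + h)\<^sup>2 / 2)" for h
      using integral_std_normal_cos[of "x + h" c] by (simp add: algebra_simps)
    show "((\<lambda>h. cos c * exp (- (x + h)\<^sup>2 / 2)) has_real_derivative - (cos c * (x * exp (- x\<^sup>2 / 2)))) (at 0)"
      by (auto intro!: derivative_eq_intros)
    show "(\<lambda>\<xi>. x * \<xi> + c) \<in> borel_measurable std_normal_distribution" by measurable
  qed (rule integrable_std_normal_ident)
  then show ?thesis by (simp only: minus_minus)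
qed

lemma integral_std_normal_mult_cos:
  "(\<integral>\<xi>. \<xi> * cos (x * \<xi> + c) \<partial>std_normal_distribution) = - (sin c * (x * exp (- x\<^sup>2 / 2)))"
proof -
  have "sin (u + (c + pi / 2)) = cos (u + c)" "cos (c + pi / 2) = - sin c" for u :: real
    by (simp_all add: sin_add cos_add)
  then show ?thesis using integral_std_normal_mult_sin[of x "c + pi / 2"]
    by simp
qed

text \<open>Completing the square gives a normal density with variance 1/(1 + r) and mean -b/(1 +
  r), whose known moments then yield the integrals.\<close>

lemma std_normal_density_mult_exp:
  assumes "0 \<le> r"
  defines "\<sigma> \<equiv> 1 / sqrt (1 + r)"
  shows "std_normal_density x * exp (- (r * x\<^sup>2) / 2 - b * x)
    = \<sigma> * exp (\<sigma>\<^sup>2 * b\<^sup>2 / 2) * normal_density (- (\<sigma>\<^sup>2 * b)) \<sigma> x"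
proof -
  have s: "0 < \<sigma>" "\<sigma>\<^sup>2 = 1 / (1 + r)" using assms by (auto simp: \<sigma>_def power_divide)
  have "- x\<^sup>2 / 2 + (- (r * x\<^sup>2) / 2 - b * x) = \<sigma>\<^sup>2 * b\<^sup>2 / 2 + - (x - - (\<sigma>\<^sup>2 * b))\<^sup>2 / (2 * \<sigma>\<^sup>2)"
    unfolding s(2) using assms(1) by (simp add: power2_eq_square divide_simps) (simp add: algebra_simps)
  moreover have "sqrt (2 * pi * \<sigma>\<^sup>2) = sqrt (2 * pi) * \<sigma>" using s(1) by (simp add: real_sqrt_mult)
  ultimately show ?thesis using s(1)
    by (simp add: normal_density_def std_normal_density_def mult_exp_exp)
qed

lemma integral_std_normal_exp:
  assumes "0 \<le> r"
  shows "(\<integral>\<xi>. exp (- (r * \<xi>\<^sup>2) / 2 - b * \<xi>) \<partial>std_normal_distribution) = exp (b\<^sup>2 / (2 * (1 + r))) / sqrt (1 + r)"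
    and "(\<integral>\<xi>. \<xi> * exp (- (r * \<xi>\<^sup>2) / 2 - b * \<xi>) \<partial>std_normal_distribution)
      = - (b / (1 + r)) * (exp (b\<^sup>2 / (2 * (1 + r))) / sqrt (1 + r))"
proof -
  let ?s = "1 / sqrt (1 + r)"
  have s: "0 < ?s" "?s\<^sup>2 = 1 / (1 + r)" using assms by (auto simp: power_divide)
  have "(\<integral>\<xi>. exp (- (r * \<xi>\<^sup>2) / 2 - b * \<xi>) \<partial>std_normal_distribution)
    = (\<integral>\<xi>. ?s * exp (?s\<^sup>2 * b\<^sup>2 / 2) * normal_density (- (?s\<^sup>2 * b)) ?s \<xi> \<partial>lborel)"
    unfolding std_normal_density_mult_exp[OF assms, symmetric] by (subst integral_density) auto
  also have "\<dots> = ?s * exp (?s\<^sup>2 * b\<^sup>2 / 2)" using s(1) by simp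
  finally show "(\<integral>\<xi>. exp (- (r * \<xi>\<^sup>2) / 2 - b * \<xi>) \<partial>std_normal_distribution) = exp (b\<^sup>2 / (2 * (1 + r))) / sqrt (1 + r)"
    unfolding s(2) by (simp add: mult.commute)
  have "(\<integral>\<xi>. \<xi> * exp (- (r * \<xi>\<^sup>2) / 2 - b * \<xi>) \<partial>std_normal_distribution)
    = (\<integral>\<xi>. std_normal_density \<xi> * exp (- (r * \<xi>\<^sup>2) / 2 - b * \<xi>) * \<xi> \<partial>lborel)"
    by (subst integral_density) (auto simp: mult_ac)
  also have "\<dots> = (\<integral>\<xi>. ?s * exp (?s\<^sup>2 * b\<^sup>2 / 2) * (normal_density (- (?s\<^sup>2 * b)) ?s \<xi> * \<xi>) \<partial>lborel)"
    unfolding std_normal_density_mult_exp[OF assms] by (simp add: mult_ac)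
  also have "\<dots> = ?s * exp (?s\<^sup>2 * b\<^sup>2 / 2) * - (?s\<^sup>2 * b)"
    using integral_normal_moment_nz_1[OF s(1), of "- (?s\<^sup>2 * b)"] by simp
  finally show "(\<integral>\<xi>. \<xi> * exp (- (r * \<xi>\<^sup>2) / 2 - b * \<xi>) \<partial>std_normal_distribution)
      = - (b / (1 + r)) * (exp (b\<^sup>2 / (2 * (1 + r))) / sqrt (1 + r))"
    unfolding s(2) by (simp add: mult_ac)
qed

text \<open>Stated for every \<open>A > 0\<close>, including exponents with a positive coefficient:
  it is applied to a Schur complement that is known only to be positive.\<close>

lemma integral_std_normal_exp_square:
  assumes "0 < A"
  shows "(\<integral>\<xi>. exp ((1 - A) * \<xi>\<^sup>2 / 2) \<partial>std_normal_distribution) = 1 / sqrt A"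
    and "(\<integral>\<xi>. \<xi>\<^sup>2 * exp ((1 - A) * \<xi>\<^sup>2 / 2) \<partial>std_normal_distribution) = 1 / (A * sqrt A)"
proof -
  let ?s = "1 / sqrt A"
  have s: "0 < ?s" "?s\<^sup>2 = 1 / A" using assms by (auto simp: power_divide)
  have eq: "std_normal_density x * exp ((1 - A) * x\<^sup>2 / 2) = ?s * normal_density 0 ?s x" for x
  proof -
    have "sqrt (2 * pi * ?s\<^sup>2) = sqrt (2 * pi) * ?s"
      unfolding real_sqrt_mult using s(1) by simp
    moreover have "- x\<^sup>2 / 2 + (1 - A) * x\<^sup>2 / 2 = - (x - 0)\<^sup>2 / (2 * ?s\<^sup>2)"
      unfolding s(2) using assms by (simp add: field_simps)
    ultimately show ?thesis using s(1)
      by (simp only: normal_density_def std_normal_density_def) (simp add: mult_exp_exp)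
  qed
  have "(\<integral>\<xi>. exp ((1 - A) * \<xi>\<^sup>2 / 2) \<partial>std_normal_distribution) = (\<integral>\<xi>. ?s * normal_density 0 ?s \<xi> \<partial>lborel)"
    unfolding eq[symmetric] by (subst integral_density) auto
  then show "(\<integral>\<xi>. exp ((1 - A) * \<xi>\<^sup>2 / 2) \<partial>std_normal_distribution) = 1 / sqrt A"
    using s(1) by simp
  have "(\<integral>\<xi>. \<xi>\<^sup>2 * exp ((1 - A) * \<xi>\<^sup>2 / 2) \<partial>std_normal_distribution)
      = (\<integral>\<xi>. std_normal_density \<xi> * exp ((1 - A) * \<xi>\<^sup>2 / 2) * \<xi>\<^sup>2 \<partial>lborel)"
    by (subst integral_density) (auto simp: mult_ac)
  also have "\<dots> = (\<integral>\<xi>. ?s * (normal_density 0 ?s \<xi> * (\<xi> - 0)^(2 * 1)) \<partial>lborel)"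
    unfolding eq by (simp add: mult_ac)
  also have "\<dots> = ?s * ?s\<^sup>2"
    using integral_normal_moment_even[OF s(1), of 0 1] by (simp add: power_divide)
  finally show "(\<integral>\<xi>. \<xi>\<^sup>2 * exp ((1 - A) * \<xi>\<^sup>2 / 2) \<partial>std_normal_distribution) = 1 / (A * sqrt A)"
    unfolding s(2) by simp
qed

lemma (in pair_sigma_finite) integrable_product_bound:
  fixes f :: "'a \<times> 'b \<Rightarrow> real"
  assumes [measurable]: "f \<in> borel_measurable (M1 \<Otimes>\<^sub>M M2)"
    and g: "integrable M1 g" and h: "integrable M2 h"
    and le: "\<And>x y. \<lbrakk>x \<in> space M1; y \<in> space M2\<rbrakk> \<Longrightarrow> \<bar>f (x, y)\<bar> \<le> g x * h y"
  shows "integrable (M1 \<Otimes>\<^sub>M M2) f"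
proof -
  have [measurable]: "g \<in> borel_measurable M1" "h \<in> borel_measurable M2" using g h by auto
  have "integrable (M1 \<Otimes>\<^sub>M M2) (\<lambda>z. g (fst z) * h (snd z))"
    using g h by (intro Fubini_integrable) (auto simp: norm_mult abs_mult)
  then show ?thesis
    by (rule Bochner_Integration.integrable_bound)
      (auto simp: space_pair_measure intro!: AE_I2 order_trans[OF le] abs_ge_self)
qed

lemma (in prob_space) std_normal_expectation_swap:
  fixes f :: "'a \<Rightarrow> real \<Rightarrow> real \<Rightarrow> real"
  assumes m: "(\<lambda>(\<omega>, \<xi>, \<eta>). f \<omega> \<xi> \<eta>) \<in> borel_measurable (M \<Otimes>\<^sub>M (borel \<Otimes>\<^sub>M borel))"
    and g: "integrable std_normal_distribution g"
    and le: "\<And>\<omega> \<xi> \<eta>. \<bar>f \<omega> \<xi> \<eta>\<bar> \<le> g \<xi> * g \<eta>"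
  shows "expectation (\<lambda>\<omega>. \<integral>\<xi>. \<integral>\<eta>. f \<omega> \<xi> \<eta> \<partial>std_normal_distribution \<partial>std_normal_distribution)
    = (\<integral>\<xi>. \<integral>\<eta>. expectation (\<lambda>\<omega>. f \<omega> \<xi> \<eta>) \<partial>std_normal_distribution \<partial>std_normal_distribution)"
proof -
  let ?N = std_normal_distribution
  interpret NN: pair_prob_space ?N ?N ..
  interpret P: pair_prob_space M "?N \<Otimes>\<^sub>M ?N" ..
  have sets_N: "sets (?N \<Otimes>\<^sub>M ?N) = sets (borel \<Otimes>\<^sub>M borel)" by (intro sets_pair_measure_cong) auto
  have m': "(\<lambda>(\<omega>, \<xi>, \<eta>). f \<omega> \<xi> \<eta>) \<in> borel_measurable (M \<Otimes>\<^sub>M (?N \<Otimes>\<^sub>M ?N))"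
  proof -
    have "(M \<Otimes>\<^sub>M (?N \<Otimes>\<^sub>M ?N)) \<rightarrow>\<^sub>M (borel :: real measure) = (M \<Otimes>\<^sub>M (borel \<Otimes>\<^sub>M borel)) \<rightarrow>\<^sub>M borel"
      by (intro measurable_cong_sets sets_pair_measure_cong sets_N) auto
    then show ?thesis using m by (simp only:)
  qed
  have [measurable]: "g \<in> borel_measurable ?N" using g by auto
  have gg: "integrable (?N \<Otimes>\<^sub>M ?N) (\<lambda>z. g (fst z) * g (snd z))"
    using g by (intro NN.Fubini_integrable) (auto simp: norm_mult abs_mult)
  have i: "integrable (M \<Otimes>\<^sub>M (?N \<Otimes>\<^sub>M ?N)) (\<lambda>(\<omega>, z). f \<omega> (fst z) (snd z))"
  proof (rule P.integrable_product_bound[where g = "\<lambda>_. 1", OF _ _ gg])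
    show "(\<lambda>(\<omega>, z). f \<omega> (fst z) (snd z)) \<in> borel_measurable (M \<Otimes>\<^sub>M (?N \<Otimes>\<^sub>M ?N))"
      using m' by (simp add: case_prod_beta')
  qed (use le in auto)
  have inner: "integrable (?N \<Otimes>\<^sub>M ?N) (\<lambda>z. f \<omega> (fst z) (snd z))" if "\<omega> \<in> space M" for \<omega>
  proof (rule Bochner_Integration.integrable_bound[OF gg])
    have "(\<lambda>z. (\<omega>, z)) \<in> (?N \<Otimes>\<^sub>M ?N) \<rightarrow>\<^sub>M (M \<Otimes>\<^sub>M (?N \<Otimes>\<^sub>M ?N))"
      using that by simp
    from measurable_compose[OF this m']
    show "(\<lambda>z. f \<omega> (fst z) (snd z)) \<in> borel_measurable (?N \<Otimes>\<^sub>M ?N)"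
      by (simp add: case_prod_beta')
  qed (auto intro!: AE_I2 order_trans[OF le] abs_ge_self)
  have "expectation (\<lambda>\<omega>. \<integral>\<xi>. \<integral>\<eta>. f \<omega> \<xi> \<eta> \<partial>?N \<partial>?N) = expectation (\<lambda>\<omega>. \<integral>z. f \<omega> (fst z) (snd z) \<partial>(?N \<Otimes>\<^sub>M ?N))"
    by (intro Bochner_Integration.integral_cong refl) (use NN.integral_fst'[OF inner] in simp)
  also have "\<dots> = (\<integral>z. expectation (\<lambda>\<omega>. f \<omega> (fst z) (snd z)) \<partial>(?N \<Otimes>\<^sub>M ?N))"
    using P.Fubini_integral[OF i] by simp
  also have "\<dots> = (\<integral>\<xi>. \<integral>\<eta>. expectation (\<lambda>\<omega>. f \<omega> \<xi> \<eta>) \<partial>?N \<partial>?N)"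
  proof -
    have "integrable (?N \<Otimes>\<^sub>M ?N) (\<lambda>z. expectation (\<lambda>\<omega>. f \<omega> (fst z) (snd z)))"
      using P.integrable_snd[OF i] by simp
    from NN.integral_fst'[OF this] show ?thesis by simp
  qed
  finally show ?thesis .
qed

section \<open>Pairs of jointly Gaussian variables\<close>

text \<open>The entries of the covariance matrix are \<open>l\<close>, \<open>m\<close>,
  \<open>r\<close>. Prescribing a characteristic function instead of a density admits degenerate
  pairs, for instance with \<open>Y\<close> equal to 0.\<close>

locale gaussian_pair = prob_space M for M :: "'a measure" +
  fixes X Y :: "'a \<Rightarrow> real" and l m r :: real
  assumes X [measurable]: "X \<in> borel_measurable M" and Y [measurable]: "Y \<in> borel_measurable M"
    and expectation_cos: "\<And>\<alpha> \<beta>. expectation (\<lambda>\<omega>. cos (\<alpha> * X \<omega> + \<beta> * Y \<omega>))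
      = exp (- (\<alpha>\<^sup>2 * l + 2 * \<alpha> * \<beta> * m + \<beta>\<^sup>2 * r) / 2)"
begin

text \<open>Both exponentials are written as standard Gaussian averages of characteristic functions, so
  that the joint density, which need not exist, is not used.\<close>

lemma expectation_exp:
  assumes r: "0 \<le> r" and det: "0 < (1 + l) * (1 + r) - m\<^sup>2"
  shows "expectation (\<lambda>\<omega>. exp (- ((X \<omega>)\<^sup>2 + (Y \<omega>)\<^sup>2) / 2)) = 1 / sqrt ((1 + l) * (1 + r) - m\<^sup>2)"
    and "expectation (\<lambda>\<omega>. X \<omega> * Y \<omega> * exp (- ((X \<omega>)\<^sup>2 + (Y \<omega>)\<^sup>2) / 2))
      = m / (((1 + l) * (1 + r) - m\<^sup>2) * sqrt ((1 + l) * (1 + r) - m\<^sup>2))"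
proof -
  let ?N = std_normal_distribution
  \<comment> \<open>The Schur complement of 1 + r in the identity plus the covariance matrix:
    integrating out one frequency leaves a one-dimensional Gaussian integral with parameter
    \<open>A\<close>, and the determinant is A (1 + r).\<close>
  define A where "A = 1 + l - m\<^sup>2 / (1 + r)"
  have detA: "(1 + l) * (1 + r) - m\<^sup>2 = A * (1 + r)" using r by (simp add: A_def field_simps)
  have A: "0 < A" using det r unfolding detA by (simp add: zero_less_mult_iff)
  have cf: "expectation (\<lambda>\<omega>. cos (\<xi> * X \<omega> + \<eta> * Y \<omega>))
      = exp (- (\<xi>\<^sup>2 * l) / 2) * exp (- (r * \<eta>\<^sup>2) / 2 - (m * \<xi>) * \<eta>)" for \<xi> \<eta>
    unfolding expectation_cos by (simp add: mult_exp_exp algebra_simps add_divide_distrib diff_divide_distrib)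
  have eA: "exp (- (\<xi>\<^sup>2 * l) / 2) * exp ((m * \<xi>)\<^sup>2 / (2 * (1 + r))) = exp ((1 - A) * \<xi>\<^sup>2 / 2)" for \<xi>
  proof -
    have "- (\<xi>\<^sup>2 * l) / 2 + (m * \<xi>)\<^sup>2 / (2 * (1 + r)) = (1 - A) * \<xi>\<^sup>2 / 2"
      using r by (simp add: A_def power_mult_distrib divide_simps) (simp add: algebra_simps)
    then show ?thesis by (simp only: mult_exp_exp)
  qed
  have "expectation (\<lambda>\<omega>. exp (- ((X \<omega>)\<^sup>2 + (Y \<omega>)\<^sup>2) / 2))
      = expectation (\<lambda>\<omega>. \<integral>\<xi>. \<integral>\<eta>. cos (\<xi> * X \<omega> + \<eta> * Y \<omega>) \<partial>?N \<partial>?N)"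
  proof (rule Bochner_Integration.integral_cong[OF refl])
    fix \<omega>
    have "(\<integral>\<eta>. cos (\<xi> * X \<omega> + \<eta> * Y \<omega>) \<partial>?N) = exp (- (Y \<omega>)\<^sup>2 / 2) * cos (X \<omega> * \<xi> + 0)" for \<xi>
      using integral_std_normal_cos[of "Y \<omega>" "\<xi> * X \<omega>"] by (simp add: add.commute mult.commute)
    then show "exp (- ((X \<omega>)\<^sup>2 + (Y \<omega>)\<^sup>2) / 2) = (\<integral>\<xi>. \<integral>\<eta>. cos (\<xi> * X \<omega> + \<eta> * Y \<omega>) \<partial>?N \<partial>?N)"
      using integral_std_normal_cos[of "X \<omega>" 0]
      by (simp add: mult_exp_exp add_divide_distrib diff_divide_distrib)
  qed
  also have "\<dots> = (\<integral>\<xi>. \<integral>\<eta>. expectation (\<lambda>\<omega>. cos (\<xi> * X \<omega> + \<eta> * Y \<omega>)) \<partial>?N \<partial>?N)"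
    by (rule std_normal_expectation_swap[where g = "\<lambda>_. 1"]) auto
  also have "\<dots> = (\<integral>\<xi>. exp ((1 - A) * \<xi>\<^sup>2 / 2) / sqrt (1 + r) \<partial>?N)"
    unfolding cf by (simp only: integral_mult_right_zero integral_std_normal_exp[OF r] eA times_divide_eq_right)
  also have "\<dots> = 1 / sqrt ((1 + l) * (1 + r) - m\<^sup>2)"
    unfolding integral_divide_zero integral_std_normal_exp_square[OF A] detA by (simp add: real_sqrt_mult)
  finally show "expectation (\<lambda>\<omega>. exp (- ((X \<omega>)\<^sup>2 + (Y \<omega>)\<^sup>2) / 2)) = 1 / sqrt ((1 + l) * (1 + r) - m\<^sup>2)" .
  \<comment> \<open>Differentiating the representation above in both variables turns the cosine into
    -\<xi> \<eta> times itself, and the Gaussian into x y times itself.\<close>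
  have "expectation (\<lambda>\<omega>. X \<omega> * Y \<omega> * exp (- ((X \<omega>)\<^sup>2 + (Y \<omega>)\<^sup>2) / 2))
      = expectation (\<lambda>\<omega>. \<integral>\<xi>. \<integral>\<eta>. - (\<xi> * (\<eta> * cos (\<xi> * X \<omega> + \<eta> * Y \<omega>))) \<partial>?N \<partial>?N)"
  proof (rule Bochner_Integration.integral_cong[OF refl])
    fix \<omega>
    have "(\<integral>\<eta>. - (\<xi> * (\<eta> * cos (\<xi> * X \<omega> + \<eta> * Y \<omega>))) \<partial>?N)
        = (Y \<omega> * exp (- (Y \<omega>)\<^sup>2 / 2)) * (\<xi> * sin (X \<omega> * \<xi> + 0))" for \<xi>
    proof -
      have "(\<integral>\<eta>. - (\<xi> * (\<eta> * cos (\<xi> * X \<omega> + \<eta> * Y \<omega>))) \<partial>?N)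
          = (\<integral>\<eta>. (- \<xi>) * (\<eta> * cos (Y \<omega> * \<eta> + \<xi> * X \<omega>)) \<partial>?N)"
        by (intro Bochner_Integration.integral_cong refl) (simp add: ac_simps)
      also have "\<dots> = (Y \<omega> * exp (- (Y \<omega>)\<^sup>2 / 2)) * (\<xi> * sin (X \<omega> * \<xi> + 0))"
        unfolding integral_mult_right_zero integral_std_normal_mult_cos by (simp add: mult_ac)
      finally show ?thesis .
    qed
    then have eq: "(\<integral>\<xi>. \<integral>\<eta>. - (\<xi> * (\<eta> * cos (\<xi> * X \<omega> + \<eta> * Y \<omega>))) \<partial>?N \<partial>?N)
      = (Y \<omega> * exp (- (Y \<omega>)\<^sup>2 / 2)) * (X \<omega> * exp (- (X \<omega>)\<^sup>2 / 2))"
      using integral_std_normal_mult_sin[of "X \<omega>" 0] by (simp only: integral_mult_right_zero cos_zero mult_1)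
    show "X \<omega> * Y \<omega> * exp (- ((X \<omega>)\<^sup>2 + (Y \<omega>)\<^sup>2) / 2)
      = (\<integral>\<xi>. \<integral>\<eta>. - (\<xi> * (\<eta> * cos (\<xi> * X \<omega> + \<eta> * Y \<omega>))) \<partial>?N \<partial>?N)"
    proof -
      have "- ((X \<omega>)\<^sup>2 + (Y \<omega>)\<^sup>2) / 2 = - (Y \<omega>)\<^sup>2 / 2 + - (X \<omega>)\<^sup>2 / 2" by simp
      then have "exp (- ((X \<omega>)\<^sup>2 + (Y \<omega>)\<^sup>2) / 2) = exp (- (Y \<omega>)\<^sup>2 / 2) * exp (- (X \<omega>)\<^sup>2 / 2)"
        by (simp only: exp_add)
      then show ?thesis unfolding eq by (simp only: mult_ac)
    qed
  qed
  also have "\<dots> = (\<integral>\<xi>. \<integral>\<eta>. expectation (\<lambda>\<omega>. - (\<xi> * (\<eta> * cos (\<xi> * X \<omega> + \<eta> * Y \<omega>)))) \<partial>?N \<partial>?N)"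
  proof (rule std_normal_expectation_swap)
    show "integrable ?N (\<lambda>\<xi>. \<bar>\<xi>\<bar>)" by (intro integrable_abs integrable_std_normal_ident)
    fix \<omega> \<xi> \<eta>
    have "\<bar>\<xi>\<bar> * (\<bar>\<eta>\<bar> * \<bar>cos (\<xi> * X \<omega> + \<eta> * Y \<omega>)\<bar>) \<le> \<bar>\<xi>\<bar> * (\<bar>\<eta>\<bar> * 1)"
      by (intro mult_left_mono) auto
    then show "\<bar>- (\<xi> * (\<eta> * cos (\<xi> * X \<omega> + \<eta> * Y \<omega>)))\<bar> \<le> \<bar>\<xi>\<bar> * \<bar>\<eta>\<bar>"
      by (simp add: abs_mult)
  qed measurable
  also have "\<dots> = (\<integral>\<xi>. \<integral>\<eta>. - (\<xi> * exp (- (\<xi>\<^sup>2 * l) / 2)) * (\<eta> * exp (- (r * \<eta>\<^sup>2) / 2 - (m * \<xi>) * \<eta>)) \<partial>?N \<partial>?N)"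
  proof -
    have "expectation (\<lambda>\<omega>. - (\<xi> * (\<eta> * cos (\<xi> * X \<omega> + \<eta> * Y \<omega>))))
      = - (\<xi> * exp (- (\<xi>\<^sup>2 * l) / 2)) * (\<eta> * exp (- (r * \<eta>\<^sup>2) / 2 - (m * \<xi>) * \<eta>))" for \<xi> \<eta>
      by (simp only: Bochner_Integration.integral_minus integral_mult_right_zero cf) (simp add: mult_ac)
    then show ?thesis by (simp only:)
  qed
  also have "\<dots> = (\<integral>\<xi>. (m / ((1 + r) * sqrt (1 + r))) * (\<xi>\<^sup>2 * exp ((1 - A) * \<xi>\<^sup>2 / 2)) \<partial>?N)"
  proof (rule Bochner_Integration.integral_cong[OF refl])
    fix \<xi>
    show "(\<integral>\<eta>. - (\<xi> * exp (- (\<xi>\<^sup>2 * l) / 2)) * (\<eta> * exp (- (r * \<eta>\<^sup>2) / 2 - (m * \<xi>) * \<eta>)) \<partial>?N)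
      = (m / ((1 + r) * sqrt (1 + r))) * (\<xi>\<^sup>2 * exp ((1 - A) * \<xi>\<^sup>2 / 2))"
      unfolding integral_mult_right_zero integral_std_normal_exp[OF r] eA[symmetric]
      by (simp add: power2_eq_square)
  qed
  also have "\<dots> = m / (((1 + l) * (1 + r) - m\<^sup>2) * sqrt ((1 + l) * (1 + r) - m\<^sup>2))"
    unfolding integral_mult_right_zero integral_std_normal_exp_square[OF A] detA by (simp add: real_sqrt_mult)
  finally show "expectation (\<lambda>\<omega>. X \<omega> * Y \<omega> * exp (- ((X \<omega>)\<^sup>2 + (Y \<omega>)\<^sup>2) / 2))
      = m / (((1 + l) * (1 + r) - m\<^sup>2) * sqrt ((1 + l) * (1 + r) - m\<^sup>2))" .
qed

text \<open>\<open>Y\<close> enters linearly, so only the function of \<open>X\<close> is written as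
  a Gaussian average, of \<xi> sin(\<xi> X); \<open>expectation_mult_sin\<close> deals with the
  factor \<open>Y\<close>.\<close>

lemma expectation_exp_mult:
  assumes l: "0 \<le> l" and Yi: "integrable M Y"
  shows "expectation (\<lambda>\<omega>. X \<omega> * exp (- (X \<omega>)\<^sup>2 / 2) * Y \<omega>) = m / ((1 + l) * sqrt (1 + l))"
proof -
  let ?N = std_normal_distribution
  interpret P: pair_prob_space M ?N ..
  have s: "expectation (\<lambda>\<omega>. Y \<omega> * sin (\<xi> * X \<omega>)) = \<xi> * m * exp (- (\<xi>\<^sup>2 * l) / 2)" for \<xi>
  proof -
    have "expectation (\<lambda>\<omega>. Y \<omega> * sin (\<xi> * X \<omega>)) = - (- (\<xi> * m * exp (- (\<xi>\<^sup>2 * l) / 2)))"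
    proof (rule expectation_mult_sin[OF _ Yi expectation_cos])
      show "((\<lambda>h. exp (- (\<xi>\<^sup>2 * l + 2 * \<xi> * h * m + h\<^sup>2 * r) / 2)) has_real_derivative
          - (\<xi> * m * exp (- (\<xi>\<^sup>2 * l) / 2))) (at 0)"
        by (auto intro!: derivative_eq_intros)
    qed simp
    then show ?thesis by simp
  qed
  have i: "integrable (M \<Otimes>\<^sub>M ?N) (\<lambda>(\<omega>, \<xi>). \<xi> * (Y \<omega> * sin (\<xi> * X \<omega>)))"
  proof (rule P.integrable_product_bound)
    show "integrable M (\<lambda>\<omega>. \<bar>Y \<omega>\<bar>)" "integrable ?N (\<lambda>\<xi>. \<bar>\<xi>\<bar>)"
      by (intro integrable_abs Yi integrable_std_normal_ident)+
    fix \<omega> \<xi>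
    have "\<bar>\<xi>\<bar> * (\<bar>Y \<omega>\<bar> * \<bar>sin (\<xi> * X \<omega>)\<bar>) \<le> \<bar>\<xi>\<bar> * (\<bar>Y \<omega>\<bar> * 1)"
      by (intro mult_left_mono) auto
    then show "\<bar>case (\<omega>, \<xi>) of (\<omega>, \<xi>) \<Rightarrow> \<xi> * (Y \<omega> * sin (\<xi> * X \<omega>))\<bar> \<le> \<bar>Y \<omega>\<bar> * \<bar>\<xi>\<bar>"
      by (simp add: abs_mult mult.commute)
  qed measurable
  have "expectation (\<lambda>\<omega>. X \<omega> * exp (- (X \<omega>)\<^sup>2 / 2) * Y \<omega>)
    = expectation (\<lambda>\<omega>. \<integral>\<xi>. \<xi> * (Y \<omega> * sin (\<xi> * X \<omega>)) \<partial>?N)"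
  proof (rule Bochner_Integration.integral_cong[OF refl])
    fix \<omega>
    have "(\<integral>\<xi>. \<xi> * (Y \<omega> * sin (\<xi> * X \<omega>)) \<partial>?N) = (\<integral>\<xi>. Y \<omega> * (\<xi> * sin (X \<omega> * \<xi> + 0)) \<partial>?N)"
      by (simp add: mult_ac)
    also have "\<dots> = Y \<omega> * (X \<omega> * exp (- (X \<omega>)\<^sup>2 / 2))"
      unfolding integral_mult_right_zero integral_std_normal_mult_sin by simp
    finally show "X \<omega> * exp (- (X \<omega>)\<^sup>2 / 2) * Y \<omega> = (\<integral>\<xi>. \<xi> * (Y \<omega> * sin (\<xi> * X \<omega>)) \<partial>?N)"
      by simp
  qed
  also have "\<dots> = (\<integral>\<xi>. expectation (\<lambda>\<omega>. \<xi> * (Y \<omega> * sin (\<xi> * X \<omega>))) \<partial>?N)"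
    using P.Fubini_integral[OF i] by simp
  also have "\<dots> = (\<integral>\<xi>. m * (\<xi>\<^sup>2 * exp ((1 - (1 + l)) * \<xi>\<^sup>2 / 2)) \<partial>?N)"
  proof (rule Bochner_Integration.integral_cong[OF refl])
    fix \<xi>
    have "1 - (1 + l) = - l" by simp
    then show "expectation (\<lambda>\<omega>. \<xi> * (Y \<omega> * sin (\<xi> * X \<omega>))) = m * (\<xi>\<^sup>2 * exp ((1 - (1 + l)) * \<xi>\<^sup>2 / 2))"
      by (simp only: integral_mult_right_zero s) (simp add: power2_eq_square mult_ac)
  qed
  also have "\<dots> = m / ((1 + l) * sqrt (1 + l))"
    unfolding integral_mult_right_zero using l by (subst integral_std_normal_exp_square) auto
  finally show ?thesis .
qed

end

section \<open>Normal laws and linear spans of Gaussian processes\<close>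

text \<open>As an affine image of the standard normal law, the point mass at \<open>v = 0\<close>
  and the laws with a density are treated alike.\<close>

lemma normal_law_eq_distr:
  assumes "0 \<le> v"
  shows "normal_law \<mu> v = distr std_normal_distribution borel (\<lambda>x. \<mu> + sqrt v * x)"
proof (cases "v = 0")
  case True
  then show ?thesis by (simp add: normal_law_def std_normal.distr_const)
next
  case False
  have "distributed std_normal_distribution lborel (\<lambda>x. x) (normal_density 0 1)"
    by (auto simp: distributed_def distr_id2 cong: distr_cong)
  then have "distributed std_normal_distribution lborel (\<lambda>x. \<mu> + sqrt v * x) (normal_density (\<mu> + sqrt v * 0) (\<bar>sqrt v\<bar> * 1))"
    using False by (intro std_normal.normal_density_affine) auto
  then have "distr std_normal_distribution lborel (\<lambda>x. \<mu> + sqrt v * x) = density lborel (normal_density \<mu> (sqrt v))"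
    using assms by (simp add: distributed_def)
  moreover have "distr std_normal_distribution lborel (\<lambda>x. \<mu> + sqrt v * x) = distr std_normal_distribution borel (\<lambda>x. \<mu> + sqrt v * x)"
    by (rule distr_cong) auto
  ultimately show ?thesis using False by (simp add: normal_law_def)
qed

lemma (in prob_space) centered_normal_law:
  fixes scaled_DSLT :: "'a \<Rightarrow> real"
  assumes [measurable]: "V \<in> borel_measurable M" and "0 \<le> v" and d: "distr M borel V = normal_law \<mu> v"
  shows "integrable M (\<lambda>\<omega>. (V \<omega>)\<^sup>2)" and "expectation V = \<mu>"
    and "\<mu> = 0 \<Longrightarrow> expectation (\<lambda>\<omega>. (V \<omega>)\<^sup>2) = v"
    and "\<mu> = 0 \<Longrightarrow> expectation (\<lambda>\<omega>. cos (V \<omega>)) = exp (- v / 2)"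
proof -
  let ?N = std_normal_distribution
  note d' = d[unfolded normal_law_eq_distr[OF \<open>0 \<le> v\<close>]]
  have E: "expectation (\<lambda>\<omega>. f (V \<omega>)) = (\<integral>x. f (\<mu> + sqrt v * x) \<partial>?N)"
    if [measurable]: "f \<in> borel_measurable borel" for f :: "real \<Rightarrow> real"
    using integral_distr[of V M borel f] integral_distr[of "\<lambda>x. \<mu> + sqrt v * x" ?N borel f] d' by simp
  have i1: "integrable ?N (\<lambda>x. x)" and i2: "integrable ?N (\<lambda>x. x\<^sup>2)"
    by (rule integrable_std_normal_ident, rule integrable_std_normal_distribution_moment)
  have sq: "(\<mu> + sqrt v * x)\<^sup>2 = \<mu>\<^sup>2 + 2 * \<mu> * sqrt v * x + v * x\<^sup>2" for x
    using \<open>0 \<le> v\<close> by (simp add: power2_sum power_mult_distrib)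
  have "integrable ?N (\<lambda>x. (\<mu> + sqrt v * x)\<^sup>2)"
    unfolding sq by (intro Bochner_Integration.integrable_add integrable_mult_right i1 i2) simp
  then have "integrable (distr ?N borel (\<lambda>x. \<mu> + sqrt v * x)) (\<lambda>x. x\<^sup>2)"
    by (subst integrable_distr_eq) auto
  then show "integrable M (\<lambda>\<omega>. (V \<omega>)\<^sup>2)"
    unfolding d'[symmetric] by (subst (asm) integrable_distr_eq) auto
  have m1: "(\<integral>x. x \<partial>?N) = 0" using integral_std_normal_distribution_moment_odd[of 1] by simp
  have m2: "(\<integral>x. x\<^sup>2 \<partial>?N) = 1"
    using integral_std_normal_exp_square(2)[of 1] by simp
  show "expectation V = \<mu>"
  proof -
    have "(\<integral>x. \<mu> + sqrt v * x \<partial>?N) = (\<integral>x. \<mu> \<partial>?N) + (\<integral>x. sqrt v * x \<partial>?N)"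
      by (intro Bochner_Integration.integral_add integrable_mult_right i1) simp
    also have "\<dots> = \<mu>"
      unfolding integral_mult_right_zero m1 using std_normal.prob_space by simp
    finally show ?thesis using E[of "\<lambda>x. x"] by simp
  qed
  show "expectation (\<lambda>\<omega>. (V \<omega>)\<^sup>2) = v" if "\<mu> = 0"
  proof -
    have "(\<integral>x. (\<mu> + sqrt v * x)\<^sup>2 \<partial>?N) = (\<integral>x. v * x\<^sup>2 \<partial>?N)"
      unfolding sq using that by simp
    also have "\<dots> = v" unfolding integral_mult_right_zero m2 by simp
    finally show ?thesis using E[of "\<lambda>x. x\<^sup>2"] by simp
  qed
  show "expectation (\<lambda>\<omega>. cos (V \<omega>)) = exp (- v / 2)" if "\<mu> = 0"
    using E[of cos] that integral_std_normal_cos[of "sqrt v" 0] \<open>0 \<le> v\<close> by simp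
qed

text \<open>\<open>gaussian_process\<close> speaks of combinations over one finite index set. The
  span is closed under sums and multiples, so that increments and combinations of two increments are
  visibly Gaussian.\<close>

definition linear_span_on :: "'t set \<Rightarrow> ('t \<Rightarrow> 'w \<Rightarrow> real) \<Rightarrow> ('w \<Rightarrow> real) set" where
  "linear_span_on T X = {V. \<exists>S c. finite S \<and> S \<subseteq> T \<and> V = (\<lambda>\<omega>. \<Sum>t\<in>S. c t * X t \<omega>)}"

lemma linear_span_on_base: "t \<in> T \<Longrightarrow> X t \<in> linear_span_on T X"
  unfolding linear_span_on_def by (intro CollectI exI[of _ "{t}"] exI[of _ "\<lambda>_. 1"]) auto

lemma linear_span_on_scale:
  assumes "V \<in> linear_span_on T X" shows "(\<lambda>\<omega>. a * V \<omega>) \<in> linear_span_on T X"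
proof -
  obtain S c where "finite S" "S \<subseteq> T" "V = (\<lambda>\<omega>. \<Sum>t\<in>S. c t * X t \<omega>)"
    using assms by (auto simp: linear_span_on_def)
  then show ?thesis unfolding linear_span_on_def
    by (intro CollectI exI[of _ S] exI[of _ "\<lambda>t. a * c t"]) (auto simp: sum_distrib_left mult.assoc)
qed

lemma linear_span_on_add:
  assumes "V \<in> linear_span_on T X" "W \<in> linear_span_on T X"
  shows "(\<lambda>\<omega>. V \<omega> + W \<omega>) \<in> linear_span_on T X"
proof -
  obtain S c where V: "finite S" "S \<subseteq> T" "V = (\<lambda>\<omega>. \<Sum>t\<in>S. c t * X t \<omega>)"
    using assms(1) by (auto simp: linear_span_on_def)
  obtain S' c' where W: "finite S'" "S' \<subseteq> T" "W = (\<lambda>\<omega>. \<Sum>t\<in>S'. c' t * X t \<omega>)"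
    using assms(2) by (auto simp: linear_span_on_def)
  \<comment> \<open>Coefficients are extended by 0 to the union of the two index sets.\<close>
  let ?c = "\<lambda>t. (if t \<in> S then c t else 0) + (if t \<in> S' then c' t else 0)"
  have "V \<omega> + W \<omega> = (\<Sum>t\<in>S \<union> S'. ?c t * X t \<omega>)" for \<omega>
  proof -
    have "(\<Sum>t\<in>S \<union> S'. ?c t * X t \<omega>)
      = (\<Sum>t\<in>S \<union> S'. if t \<in> S then c t * X t \<omega> else 0) + (\<Sum>t\<in>S \<union> S'. if t \<in> S' then c' t * X t \<omega> else 0)"
    proof -
      have "?c t * X t \<omega> = (if t \<in> S then c t * X t \<omega> else 0) + (if t \<in> S' then c' t * X t \<omega> else 0)" for t
        by (simp add: distrib_right)
      then show ?thesis by (simp only: sum.distrib)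
    qed
    also have "\<dots> = (\<Sum>t\<in>S. c t * X t \<omega>) + (\<Sum>t\<in>S'. c' t * X t \<omega>)"
      using V(1) W(1) by (simp add: Int_absorb1 Int_absorb2 flip: sum.inter_restrict)
    finally show ?thesis unfolding V W by simp
  qed
  then show ?thesis using V W unfolding linear_span_on_def
    by (intro CollectI exI[of _ "S \<union> S'"] exI[of _ ?c]) auto
qed

lemma linear_span_on_diff:
  assumes "V \<in> linear_span_on T X" "W \<in> linear_span_on T X"
  shows "(\<lambda>\<omega>. V \<omega> - W \<omega>) \<in> linear_span_on T X"
  using linear_span_on_add[OF assms(1) linear_span_on_scale[OF assms(2), of "- 1"]] by simp

locale centered_gaussian_process = prob_space M for M :: "'a measure" +
  fixes T :: "'t set" and X :: "'t \<Rightarrow> 'a \<Rightarrow> real"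
  assumes gaussian: "gaussian_process M T X" and centered: "\<And>t. t \<in> T \<Longrightarrow> expectation (X t) = 0"
begin

lemma span_measurable:
  assumes "V \<in> linear_span_on T X" shows "V \<in> borel_measurable M"
proof -
  obtain S c where V: "finite S" "S \<subseteq> T" "V = (\<lambda>\<omega>. \<Sum>t\<in>S. c t * X t \<omega>)"
    using assms by (auto simp: linear_span_on_def)
  have "X t \<in> borel_measurable M" if "t \<in> S" for t
    using gaussian V that by (auto simp: gaussian_process_def)
  then show ?thesis unfolding V by (intro borel_measurable_sum borel_measurable_times) auto
qed

lemma span_law:
  assumes "V \<in> linear_span_on T X"
  obtains \<mu> v where "0 \<le> v" "distr M borel V = normal_law \<mu> v"
proof -
  obtain S c where V: "finite S" "S \<subseteq> T" "V = (\<lambda>\<omega>. \<Sum>t\<in>S. c t * X t \<omega>)"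
    using assms by (auto simp: linear_span_on_def)
  then show ?thesis using gaussian that unfolding gaussian_process_def by blast
qed

lemma span_square_integrable:
  assumes "V \<in> linear_span_on T X" shows "integrable M (\<lambda>\<omega>. (V \<omega>)\<^sup>2)"
  using span_law[OF assms] centered_normal_law(1)[OF span_measurable[OF assms]] by metis

lemma span_integrable:
  assumes "V \<in> linear_span_on T X" shows "integrable M V"
  using square_integrable_imp_integrable[OF span_measurable[OF assms]] span_square_integrable[OF assms] by simp

lemma span_mult_integrable:
  assumes V: "V \<in> linear_span_on T X" and W: "W \<in> linear_span_on T X"
  shows "integrable M (\<lambda>\<omega>. V \<omega> * W \<omega>)"
proof (rule Bochner_Integration.integrable_bound)
  show "integrable M (\<lambda>\<omega>. (V \<omega>)\<^sup>2 + (W \<omega>)\<^sup>2)" using V W span_square_integrable by auto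
  show "(\<lambda>\<omega>. V \<omega> * W \<omega>) \<in> borel_measurable M" using V W span_measurable by auto
  show "AE \<omega> in M. norm (V \<omega> * W \<omega>) \<le> norm ((V \<omega>)\<^sup>2 + (W \<omega>)\<^sup>2)"
    using abs_mult_le_sum_squares by (intro AE_I2) simp
qed

lemma span_centered:
  assumes "V \<in> linear_span_on T X" shows "expectation V = 0"
proof -
  obtain S c where V: "finite S" "S \<subseteq> T" "V = (\<lambda>\<omega>. \<Sum>t\<in>S. c t * X t \<omega>)"
    using assms by (auto simp: linear_span_on_def)
  have "integrable M (X t)" if "t \<in> S" for t
    using V that by (intro span_integrable linear_span_on_base) auto
  then have "expectation V = (\<Sum>t\<in>S. c t * expectation (X t))" unfolding V by simp
  also have "\<dots> = 0" using V centered by (intro sum.neutral) auto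
  finally show ?thesis .
qed

lemma span_normal_law:
  assumes "V \<in> linear_span_on T X" shows "distr M borel V = normal_law 0 (expectation (\<lambda>\<omega>. (V \<omega>)\<^sup>2))"
proof -
  obtain \<mu> v where v: "0 \<le> v" "distr M borel V = normal_law \<mu> v" using span_law[OF assms] .
  note * = centered_normal_law[OF span_measurable[OF assms] v]
  have "\<mu> = 0" using *(2) span_centered[OF assms] by simp
  then show ?thesis using *(3) v by simp
qed

text \<open>Every combination of \<open>V\<close> and \<open>W\<close> is again in the span, hence
  centred normal, and its variance is the quadratic form of the covariance matrix.\<close>

lemma span_gaussian_pair:
  assumes V: "V \<in> linear_span_on T X" and W: "W \<in> linear_span_on T X"
  shows "gaussian_pair M V W (expectation (\<lambda>\<omega>. (V \<omega>)\<^sup>2)) (expectation (\<lambda>\<omega>. V \<omega> * W \<omega>)) (expectation (\<lambda>\<omega>. (W \<omega>)\<^sup>2))"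
proof
  show "V \<in> borel_measurable M" "W \<in> borel_measurable M" using V W span_measurable by auto
  fix \<alpha> \<beta>
  let ?U = "\<lambda>\<omega>. \<alpha> * V \<omega> + \<beta> * W \<omega>"
  have U: "?U \<in> linear_span_on T X" by (intro linear_span_on_add linear_span_on_scale V W)
  obtain \<mu> v where v: "0 \<le> v" "distr M borel ?U = normal_law \<mu> v" using span_law[OF U] .
  note * = centered_normal_law[OF span_measurable[OF U] v]
  have "\<mu> = 0" using *(2) span_centered[OF U] by simp
  then have "expectation (\<lambda>\<omega>. cos (?U \<omega>)) = exp (- expectation (\<lambda>\<omega>. (?U \<omega>)\<^sup>2) / 2)" using *(3,4) by simp
  also have "expectation (\<lambda>\<omega>. (?U \<omega>)\<^sup>2) = expectation (\<lambda>\<omega>. \<alpha>\<^sup>2 * (V \<omega>)\<^sup>2 + 2 * \<alpha> * \<beta> * (V \<omega> * W \<omega>) + \<beta>\<^sup>2 * (W \<omega>)\<^sup>2)"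
    by (simp add: power2_sum power_mult_distrib mult_ac add_ac)
  also have "\<dots> = \<alpha>\<^sup>2 * expectation (\<lambda>\<omega>. (V \<omega>)\<^sup>2) + 2 * \<alpha> * \<beta> * expectation (\<lambda>\<omega>. V \<omega> * W \<omega>) + \<beta>\<^sup>2 * expectation (\<lambda>\<omega>. (W \<omega>)\<^sup>2)"
    using span_square_integrable[OF V] span_square_integrable[OF W] span_mult_integrable[OF V W] by simp
  finally show "expectation (\<lambda>\<omega>. cos (?U \<omega>)) = exp (- (\<alpha>\<^sup>2 * expectation (\<lambda>\<omega>. (V \<omega>)\<^sup>2) + 2 * \<alpha> * \<beta> * expectation (\<lambda>\<omega>. V \<omega> * W \<omega>)
      + \<beta>\<^sup>2 * expectation (\<lambda>\<omega>. (W \<omega>)\<^sup>2)) / 2)" .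
qed

end

section \<open>Planar fractional Brownian motion\<close>

lemma norm_square_2: "(norm (x :: real ^ 2))\<^sup>2 = (x $ 1)\<^sup>2 + (x $ 2)\<^sup>2"
  by (simp only: power2_norm_eq_inner inner_vec_def sum_2) (simp add: power2_eq_square)

lemma partial_deriv_heat_kernel:
  assumes "0 < \<epsilon>"
  shows "partial_deriv 1 (heat_kernel \<epsilon>) (x :: real ^ 2)
    = - (x $ 1 / \<epsilon>) / (2 * pi * \<epsilon>) * exp (- ((x $ 1)\<^sup>2 + (x $ 2)\<^sup>2) / (2 * \<epsilon>))"
proof -
  have "heat_kernel \<epsilon> (x + h *\<^sub>R axis 1 1) = 1 / (2 * pi * \<epsilon>) * exp (- ((x $ 1 + h)\<^sup>2 + (x $ 2)\<^sup>2) / (2 * \<epsilon>))" for h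
    using assms by (simp add: heat_kernel_def norm_square_2 axis_def powr_minus_divide) (simp add: field_simps)
  moreover have "((\<lambda>h. 1 / (2 * pi * \<epsilon>) * exp (- ((x $ 1 + h)\<^sup>2 + (x $ 2)\<^sup>2) / (2 * \<epsilon>))) has_real_derivative
      - (x $ 1 / \<epsilon>) / (2 * pi * \<epsilon>) * exp (- ((x $ 1)\<^sup>2 + (x $ 2)\<^sup>2) / (2 * \<epsilon>))) (at 0)"
    using assms by (auto intro!: derivative_eq_intros simp: field_simps)
  ultimately show ?thesis unfolding partial_deriv_def by (simp only: DERIV_imp_deriv)
qed

locale planar_fbm = prob_space M + hurst_exponent p for M :: "'a measure" and p :: real +
  fixes B :: "real \<Rightarrow> 'a \<Rightarrow> real ^ 2"
  assumes fbm: "vector_fractional_brownian_motion (p / 2) M B"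
begin

definition X :: "2 \<Rightarrow> real \<Rightarrow> 'a \<Rightarrow> real" where "X j t \<omega> = B t \<omega> $ j"

abbreviation span :: "2 \<Rightarrow> ('a \<Rightarrow> real) set" where "span j \<equiv> linear_span_on {0..} (X j)"

lemma fbm_component: "fractional_brownian_motion (p / 2) M (X j)"
proof -
  have "X j = (\<lambda>t \<omega>. B t \<omega> $ j)" by (intro ext) (simp add: X_def)
  then show ?thesis using fbm by (simp add: vector_fractional_brownian_motion_def)
qed

lemma X_measurable: "0 \<le> t \<Longrightarrow> X j t \<in> borel_measurable M"
  using fbm_component[of j] by (auto simp: fractional_brownian_motion_def gaussian_process_def)

lemma covariance:
  assumes "0 \<le> s" "0 \<le> t"
  shows "expectation (\<lambda>\<omega>. X j t \<omega> * X j s \<omega>) = (t powr p + s powr p - \<bar>t - s\<bar> powr p) / 2"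
  using fbm_component[of j] assms by (simp add: fractional_brownian_motion_def)

sublocale component: centered_gaussian_process M "{0..}" "X j" for j
proof
  show "gaussian_process M {0..} (X j)" using fbm_component[of j] by (simp add: fractional_brownian_motion_def)
  show "expectation (X j t) = 0" if "t \<in> {0..}" for t
    using fbm_component[of j] that by (simp add: fractional_brownian_motion_def)
qed

definition inc :: "2 \<Rightarrow> real \<Rightarrow> real \<Rightarrow> 'a \<Rightarrow> real" where "inc j s r \<omega> = X j s \<omega> - X j r \<omega>"

lemma inc_span: "0 \<le> s \<Longrightarrow> 0 \<le> r \<Longrightarrow> inc j s r \<in> span j"
  unfolding inc_def[abs_def] by (intro linear_span_on_diff linear_span_on_base) auto

lemma X_span: "0 \<le> s \<Longrightarrow> X j s \<in> span j"
  by (intro linear_span_on_base) auto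

lemma covariance_inc:
  assumes "0 \<le> s" "0 \<le> r" "0 \<le> s'" "0 \<le> r'"
  shows "expectation (\<lambda>\<omega>. inc j s r \<omega> * inc j s' r' \<omega>) = inc_cov (s - r) (s' - r') (s' - s)"
proof -
  have i: "integrable M (\<lambda>\<omega>. X j u \<omega> * X j v \<omega>)" if "0 \<le> u" "0 \<le> v" for u v
    using that by (intro component.span_mult_integrable[of _ j] X_span)
  have "expectation (\<lambda>\<omega>. inc j s r \<omega> * inc j s' r' \<omega>)
    = expectation (\<lambda>\<omega>. X j s \<omega> * X j s' \<omega> - X j s \<omega> * X j r' \<omega> - X j r \<omega> * X j s' \<omega> + X j r \<omega> * X j r' \<omega>)"
    by (simp add: inc_def algebra_simps)
  also have "\<dots> = (\<bar>s - r'\<bar> powr p + \<bar>r - s'\<bar> powr p - \<bar>s - s'\<bar> powr p - \<bar>r - r'\<bar> powr p) / 2"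
    using assms by (simp add: i covariance field_simps abs_minus_commute[of r' s])
  also have "\<dots> = inc_cov (s - r) (s' - r') (s' - s)"
  proof -
    have "\<bar>s - s'\<bar> = \<bar>s' - s\<bar>" "\<bar>s - r'\<bar> = \<bar>s' - s - (s' - r')\<bar>" "\<bar>r - s'\<bar> = \<bar>s' - s + (s - r)\<bar>"
      "\<bar>r - r'\<bar> = \<bar>s' - s + (s - r) - (s' - r')\<bar>" by (simp_all add: abs_if)
    then show ?thesis by (simp only: inc_cov_def) simp
  qed
  finally show ?thesis .
qed

lemma covariance_inc_X:
  assumes "0 \<le> s" "0 \<le> r" "0 \<le> t"
  shows "expectation (\<lambda>\<omega>. inc j s r \<omega> * X j t \<omega>) = (s powr p - r powr p + \<bar>t - r\<bar> powr p - \<bar>t - s\<bar> powr p) / 2"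
proof -
  have i: "integrable M (\<lambda>\<omega>. X j u \<omega> * X j v \<omega>)" if "0 \<le> u" "0 \<le> v" for u v
    using that by (intro component.span_mult_integrable[of _ j] X_span)
  have "expectation (\<lambda>\<omega>. inc j s r \<omega> * X j t \<omega>) = expectation (\<lambda>\<omega>. X j s \<omega> * X j t \<omega> - X j r \<omega> * X j t \<omega>)"
    by (simp add: inc_def algebra_simps)
  also have "\<dots> = (s powr p - r powr p + \<bar>t - r\<bar> powr p - \<bar>t - s\<bar> powr p) / 2"
    using assms by (simp add: i covariance field_simps abs_minus_commute)
  finally show ?thesis .
qed

section \<open>Moments of the kernel\<close>

abbreviation path :: "2 \<Rightarrow> 'a \<Rightarrow> real \<Rightarrow> real" where
  "path j \<omega> \<equiv> \<lambda>t\<in>{0..}. X j t \<omega>"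

text \<open>Independence is given for whole coordinate paths restricted to the half-line, so the
  factors are functionals on the product space.\<close>

lemma expectation_component_product:
  fixes F1 F2 :: "(real \<Rightarrow> real) \<Rightarrow> real"
  assumes F: "F1 \<in> borel_measurable (Pi\<^sub>M {0..} (\<lambda>_. borel))" "F2 \<in> borel_measurable (Pi\<^sub>M {0..} (\<lambda>_. borel))"
    and i: "integrable M (\<lambda>\<omega>. F1 (path 1 \<omega>))" "integrable M (\<lambda>\<omega>. F2 (path 2 \<omega>))"
  shows "expectation (\<lambda>\<omega>. F1 (path 1 \<omega>) * F2 (path 2 \<omega>))
    = expectation (\<lambda>\<omega>. F1 (path 1 \<omega>)) * expectation (\<lambda>\<omega>. F2 (path 2 \<omega>))"
proof -
  define F where "F j = (if j = (1::2) then F1 else F2)" for j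
  have ind: "indep_vars (\<lambda>j. Pi\<^sub>M {0..} (\<lambda>t. borel :: real measure)) (\<lambda>j \<omega>. \<lambda>t\<in>{0..}. X j t \<omega>) UNIV"
    using fbm by (simp add: vector_fractional_brownian_motion_def X_def)
  have "indep_vars (\<lambda>_. borel) (\<lambda>j \<omega>. F j (path j \<omega>)) UNIV"
    by (rule indep_vars_compose2[OF ind]) (use F in \<open>auto simp: F_def\<close>)
  then have "expectation (\<lambda>\<omega>. \<Prod>j\<in>UNIV. F j (path j \<omega>)) = (\<Prod>j\<in>UNIV. expectation (\<lambda>\<omega>. F j (path j \<omega>)))"
    using i by (intro indep_vars_lebesgue_integral) (auto simp: F_def forall_2 UNIV_2)
  then show ?thesis by (simp add: UNIV_2 F_def)
qed

definition kern :: "real \<Rightarrow> real \<Rightarrow> real \<Rightarrow> 'a \<Rightarrow> real" where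
  "kern \<epsilon> s r \<omega> = partial_deriv 1 (heat_kernel \<epsilon>) (B s \<omega> - B r \<omega>)"

lemma kern_eq:
  fixes s r :: real
  assumes "0 < \<epsilon>"
  defines "z \<equiv> \<lambda>j \<omega>. (1 / sqrt \<epsilon>) * inc j s r \<omega>"
  shows "kern \<epsilon> s r \<omega> = - (1 / (2 * pi * \<epsilon> * sqrt \<epsilon>)) * (z 1 \<omega> * exp (- (z 1 \<omega>)\<^sup>2 / 2) * exp (- (z 2 \<omega>)\<^sup>2 / 2))"
proof -
  have zz: "(z j \<omega>)\<^sup>2 = (inc j s r \<omega>)\<^sup>2 / \<epsilon>" for j
    using assms(1) by (simp add: z_def power_mult_distrib power_divide)
  have "exp (- (z 1 \<omega>)\<^sup>2 / 2) * exp (- (z 2 \<omega>)\<^sup>2 / 2) = exp (- ((inc 1 s r \<omega>)\<^sup>2 + (inc 2 s r \<omega>)\<^sup>2) / (2 * \<epsilon>))"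
    unfolding zz mult_exp_exp by (simp add: diff_divide_distrib mult.commute)
  moreover have "inc 1 s r \<omega> / \<epsilon> = z 1 \<omega> / sqrt \<epsilon>" using assms(1) by (simp add: z_def)
  ultimately show ?thesis unfolding kern_def partial_deriv_heat_kernel[OF assms(1)]
    by (simp add: inc_def X_def mult.assoc)
qed

lemma abs_mult_exp_le: "\<bar>x * exp (- x\<^sup>2 / 2)\<bar> \<le> (1 :: real)"
proof -
  have "0 \<le> (\<bar>x\<bar> - 1)\<^sup>2" by simp
  then have "\<bar>x\<bar> \<le> 1 + x\<^sup>2 / 2" by (simp add: power2_diff)
  also have "\<dots> \<le> exp (x\<^sup>2 / 2)" by (rule exp_ge_add_one_self)
  finally show ?thesis by (simp add: abs_mult exp_minus field_simps)
qed

lemma kern_bound: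
  assumes "0 < \<epsilon>" shows "\<bar>kern \<epsilon> s r \<omega>\<bar> \<le> 1 / (2 * pi * \<epsilon> * sqrt \<epsilon>)"
proof -
  have "\<bar>x * exp (- x\<^sup>2 / 2) * exp (- y\<^sup>2 / 2)\<bar> \<le> 1 * 1" for x y :: real
    unfolding abs_mult[of _ "exp (- y\<^sup>2 / 2)"] by (intro mult_mono abs_mult_exp_le) auto
  moreover have "\<bar>- c * u\<bar> \<le> c" if "\<bar>u\<bar> \<le> 1" "0 \<le> c" for c u :: real
    using mult_left_mono[OF that] that(2) by (simp add: abs_mult)
  ultimately show ?thesis using assms unfolding kern_eq[OF assms] by (metis (no_types, lifting) divide_nonneg_pos
      less_eq_real_def mult_1 mult_pos_pos pi_gt_zero real_sqrt_gt_zero zero_less_numeral zero_less_one)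
qed

lemma inc_scaled_pair:
  assumes "0 < \<epsilon>" "V \<in> span j" "W \<in> span j"
  shows "gaussian_pair M (\<lambda>\<omega>. (1 / sqrt \<epsilon>) * V \<omega>) (\<lambda>\<omega>. (1 / sqrt \<epsilon>) * W \<omega>)
    (expectation (\<lambda>\<omega>. V \<omega> * V \<omega>) / \<epsilon>) (expectation (\<lambda>\<omega>. V \<omega> * W \<omega>) / \<epsilon>) (expectation (\<lambda>\<omega>. W \<omega> * W \<omega>) / \<epsilon>)"
proof -
  have "(1 / sqrt \<epsilon> * x) * (1 / sqrt \<epsilon> * y) = x * y / \<epsilon>" for x y using assms(1) by simp
  then have "expectation (\<lambda>\<omega>. (1 / sqrt \<epsilon> * f \<omega>) * (1 / sqrt \<epsilon> * g \<omega>)) = expectation (\<lambda>\<omega>. f \<omega> * g \<omega>) / \<epsilon>" for f g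
    by (simp only: integral_divide_zero)
  then show ?thesis
    using component.span_gaussian_pair[OF linear_span_on_scale[OF assms(2)] linear_span_on_scale[OF assms(3)], of "1 / sqrt \<epsilon>" "1 / sqrt \<epsilon>"]
    by (simp only: power2_eq_square)
qed

text \<open>The coordinates factor and have the same covariance matrix: the first gives m / D^(3/2),
  the second 1 / D^(1/2), which explains the square of D. The choice eps = eta^p cancels the scaling
  of the increments.\<close>

lemma expectation_kern_mult_kern:
  assumes "0 < \<eta>" "0 < a" "0 < b" "\<eta> * a \<le> s" "\<eta> * b \<le> s'"
  defines "\<epsilon> \<equiv> \<eta> powr p"
  shows "expectation (\<lambda>\<omega>. kern \<epsilon> s (s - \<eta> * a) \<omega> * kern \<epsilon> s' (s' - \<eta> * b) \<omega>)
    = inc_cov a b ((s' - s) / \<eta>) / (4 * pi\<^sup>2 * \<epsilon> ^ 3 * (inc_det a b ((s' - s) / \<eta>))\<^sup>2)"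
proof -
  have e: "0 < \<epsilon>" using assms by simp
  define r r' where "r = s - \<eta> * a" and "r' = s' - \<eta> * b"
  have nn: "0 \<le> r" "0 \<le> r'" "0 \<le> s" "0 \<le> s'"
  proof -
    have "0 < \<eta> * a" "0 < \<eta> * b" using assms by simp_all
    with assms(4,5) show "0 \<le> r" "0 \<le> r'" "0 \<le> s" "0 \<le> s'" unfolding r_def r'_def by linarith+
  qed
  let ?c = "1 / sqrt \<epsilon>" and ?m = "inc_cov a b ((s' - s) / \<eta>)" and ?D = "inc_det a b ((s' - s) / \<eta>)"
  define x y where "x j \<omega> = ?c * inc j s r \<omega>" and "y j \<omega> = ?c * inc j s' r' \<omega>" for j \<omega>
  have sc: "inc_cov (\<eta> * u) (\<eta> * v) (\<eta> * w) / \<epsilon> = inc_cov u v w" for u v w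
    using assms by (simp add: inc_cov_scale)
  have diag: "inc_cov u u 0 = \<bar>u\<bar> powr p" for u by (simp add: inc_cov_def)
  have "gaussian_pair M (x j) (y j) (a powr p) ?m (b powr p)" for j
  proof -
    have "expectation (\<lambda>\<omega>. inc j s r \<omega> * inc j s r \<omega>) / \<epsilon> = a powr p"
      using covariance_inc[of s r s r j] nn sc[of a a 0] diag assms by (simp add: r_def)
    moreover have "expectation (\<lambda>\<omega>. inc j s' r' \<omega> * inc j s' r' \<omega>) / \<epsilon> = b powr p"
      using covariance_inc[of s' r' s' r' j] nn sc[of b b 0] diag assms by (simp add: r'_def)
    moreover have "expectation (\<lambda>\<omega>. inc j s r \<omega> * inc j s' r' \<omega>) / \<epsilon> = ?m"
      using covariance_inc[of s r s' r' j] nn sc[of a b "(s' - s) / \<eta>"] assms by (simp add: r_def r'_def)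
    ultimately show ?thesis
      using inc_scaled_pair[OF e inc_span[of s r j] inc_span[of s' r' j]] nn by (simp add: x_def[abs_def] y_def[abs_def])
  qed
  note G = gaussian_pair.expectation_exp[OF this]
  have D: "?D = (1 + a powr p) * (1 + b powr p) - ?m\<^sup>2" by (simp add: inc_det_def)
  have D_pos: "0 < ?D" using inc_det_ge_1[of a b "(s' - s) / \<eta>"] assms by (smt (verit) powr_ge_zero)
  have E1: "expectation (\<lambda>\<omega>. x 1 \<omega> * y 1 \<omega> * exp (- ((x 1 \<omega>)\<^sup>2 + (y 1 \<omega>)\<^sup>2) / 2)) = ?m / (?D * sqrt ?D)"
    and E2: "expectation (\<lambda>\<omega>. exp (- ((x 2 \<omega>)\<^sup>2 + (y 2 \<omega>)\<^sup>2) / 2)) = 1 / sqrt ?D"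
    using G D_pos unfolding D by auto
  have xm: "x j \<in> borel_measurable M" "y j \<in> borel_measurable M" for j
    unfolding x_def y_def using component.span_measurable[OF inc_span, of s r j] component.span_measurable[OF inc_span, of s' r' j] nn
    by auto
  note [measurable] = xm[of 1] xm[of 2]
  define F1 where "F1 f = (?c * (f s - f r)) * (?c * (f s' - f r')) * exp (- ((?c * (f s - f r))\<^sup>2 + (?c * (f s' - f r'))\<^sup>2) / 2)" for f :: "real \<Rightarrow> real"
  define F2 where "F2 f = exp (- ((?c * (f s - f r))\<^sup>2 + (?c * (f s' - f r'))\<^sup>2) / 2)" for f :: "real \<Rightarrow> real"
  have F1: "F1 (path 1 \<omega>) = x 1 \<omega> * y 1 \<omega> * exp (- ((x 1 \<omega>)\<^sup>2 + (y 1 \<omega>)\<^sup>2) / 2)" for \<omega>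
    using nn by (simp add: F1_def x_def y_def inc_def)
  have F2: "F2 (path 2 \<omega>) = exp (- ((x 2 \<omega>)\<^sup>2 + (y 2 \<omega>)\<^sup>2) / 2)" for \<omega>
    using nn by (simp add: F2_def x_def y_def inc_def)
  have ev: "(\<lambda>f. f u) \<in> borel_measurable (Pi\<^sub>M {0..} (\<lambda>_. borel :: real measure))" if "0 \<le> u" for u :: real
    using that by (intro measurable_component_singleton) auto
  note [measurable] = ev[OF nn(1)] ev[OF nn(2)] ev[OF nn(3)] ev[OF nn(4)]
  have split: "u * v * exp (- (u\<^sup>2 + v\<^sup>2) / 2) = (u * exp (- u\<^sup>2 / 2)) * (v * exp (- v\<^sup>2 / 2))"
    "exp (- (u\<^sup>2 + v\<^sup>2) / 2) = exp (- u\<^sup>2 / 2) * exp (- v\<^sup>2 / 2)" for u v :: real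
  proof -
    have "- (u\<^sup>2 + v\<^sup>2) / 2 = - u\<^sup>2 / 2 + - v\<^sup>2 / 2" by simp
    then show "exp (- (u\<^sup>2 + v\<^sup>2) / 2) = exp (- u\<^sup>2 / 2) * exp (- v\<^sup>2 / 2)" by (simp only: exp_add)
    then show "u * v * exp (- (u\<^sup>2 + v\<^sup>2) / 2) = (u * exp (- u\<^sup>2 / 2)) * (v * exp (- v\<^sup>2 / 2))" by (simp only: mult_ac)
  qed
  have "\<bar>u * v * exp (- (u\<^sup>2 + v\<^sup>2) / 2)\<bar> \<le> 1 * 1" for u v :: real
    unfolding split(1) abs_mult[of "u * exp (- u\<^sup>2 / 2)"] by (intro mult_mono abs_mult_exp_le) auto
  then have i1: "integrable M (\<lambda>\<omega>. F1 (path 1 \<omega>))"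
    unfolding F1 by (intro integrable_const_bound[where B = 1]) auto
  have i2: "integrable M (\<lambda>\<omega>. F2 (path 2 \<omega>))"
    unfolding F2 by (intro integrable_const_bound[where B = 1]) (auto simp: add_nonneg_nonneg)
  have "expectation (\<lambda>\<omega>. F1 (path 1 \<omega>) * F2 (path 2 \<omega>))
    = expectation (\<lambda>\<omega>. F1 (path 1 \<omega>)) * expectation (\<lambda>\<omega>. F2 (path 2 \<omega>))"
    by (rule expectation_component_product[OF _ _ i1 i2]) (unfold F1_def F2_def, measurable)
  also have "\<dots> = ?m / ?D\<^sup>2"
    unfolding F1 F2 E1 E2 using D_pos by (simp add: power2_eq_square)
  finally have E: "expectation (\<lambda>\<omega>. F1 (path 1 \<omega>) * F2 (path 2 \<omega>)) = ?m / ?D\<^sup>2" .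
  have "kern \<epsilon> s r \<omega> * kern \<epsilon> s' r' \<omega> = 1 / (4 * pi\<^sup>2 * \<epsilon> ^ 3) * (F1 (path 1 \<omega>) * F2 (path 2 \<omega>))" for \<omega>
  proof -
    have "(1 / (2 * pi * \<epsilon> * sqrt \<epsilon>)) * (1 / (2 * pi * \<epsilon> * sqrt \<epsilon>)) = 1 / (4 * pi\<^sup>2 * \<epsilon> ^ 3)"
      using e by (simp add: power2_eq_square power3_eq_cube)
    moreover have "kern \<epsilon> s r \<omega> * kern \<epsilon> s' r' \<omega> = (1 / (2 * pi * \<epsilon> * sqrt \<epsilon>)) * (1 / (2 * pi * \<epsilon> * sqrt \<epsilon>))
      * (F1 (path 1 \<omega>) * F2 (path 2 \<omega>))"
      unfolding F1 F2 kern_eq[OF e] x_def[symmetric] y_def[symmetric] split by (simp add: mult_ac)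
    ultimately show ?thesis by simp
  qed
  then have "expectation (\<lambda>\<omega>. kern \<epsilon> s r \<omega> * kern \<epsilon> s' r' \<omega>) = 1 / (4 * pi\<^sup>2 * \<epsilon> ^ 3) * (?m / ?D\<^sup>2)"
    by (simp only: integral_mult_right_zero E)
  then show ?thesis by (simp add: r_def r'_def)
qed

text \<open>The first coordinate, which also carries B_t, gives the power -3/2 of 1 + a^p, and the
  second the remaining -1/2.\<close>

lemma expectation_kern_mult_X:
  assumes "0 < \<eta>" "0 < a" "\<eta> * a \<le> s" "0 \<le> t"
  defines "\<epsilon> \<equiv> \<eta> powr p"
  shows "expectation (\<lambda>\<omega>. kern \<epsilon> s (s - \<eta> * a) \<omega> * X 1 t \<omega>)
    = - expectation (\<lambda>\<omega>. inc 1 s (s - \<eta> * a) \<omega> * X 1 t \<omega>) / (2 * pi * \<epsilon>\<^sup>2 * (1 + a powr p)\<^sup>2)"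
proof -
  have e: "0 < \<epsilon>" using assms by simp
  define r where "r = s - \<eta> * a"
  have nn: "0 \<le> r" "0 \<le> s" 
  proof -
    have "0 < \<eta> * a" using assms by simp
    with assms(3) show "0 \<le> r" "0 \<le> s" unfolding r_def by linarith+
  qed
  let ?c = "1 / sqrt \<epsilon>" and ?l = "1 + a powr p"
  define \<kappa> where "\<kappa> = expectation (\<lambda>\<omega>. inc 1 s r \<omega> * X 1 t \<omega>)"
  define x where "x j \<omega> = ?c * inc j s r \<omega>" for j \<omega>
  define W where "W \<omega> = ?c * X 1 t \<omega>" for \<omega>
  have l: "0 < ?l" by (simp add: add_pos_nonneg)
  have "expectation (\<lambda>\<omega>. inc j s r \<omega> * inc j s r \<omega>) / \<epsilon> = a powr p" for j
    using covariance_inc[of s r s r j] nn assms inc_cov_scale[of \<eta> a a 0] by (simp add: r_def inc_cov_def)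
  note var = this
  have "gaussian_pair M (x 1) W (a powr p) (\<kappa> / \<epsilon>) (expectation (\<lambda>\<omega>. X 1 t \<omega> * X 1 t \<omega>) / \<epsilon>)"
    using inc_scaled_pair[OF e inc_span[of s r 1] X_span[of t 1]] nn assms(4) var[of 1]
    by (simp add: x_def[abs_def] W_def[abs_def] \<kappa>_def)
  moreover have Wi: "integrable M W"
    unfolding W_def using component.span_integrable[OF X_span[OF assms(4)]] by (intro integrable_mult_right)
  ultimately have E1: "expectation (\<lambda>\<omega>. x 1 \<omega> * exp (- (x 1 \<omega>)\<^sup>2 / 2) * W \<omega>) = \<kappa> / \<epsilon> / (?l * sqrt ?l)"
    by (intro gaussian_pair.expectation_exp_mult) auto
  \<comment> \<open>A one-variable Gaussian integral, seen as that of a pair whose second member is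
    0.\<close>
  have "gaussian_pair M (x 2) (\<lambda>\<omega>. 0) (a powr p) 0 0"
    using inc_scaled_pair[OF e inc_span[of s r 2] linear_span_on_scale[OF X_span[of t 2], of 0]] nn assms(4) var[of 2]
    by (simp add: x_def[abs_def])
  then have E2: "expectation (\<lambda>\<omega>. exp (- (x 2 \<omega>)\<^sup>2 / 2)) = 1 / sqrt ?l"
    using gaussian_pair.expectation_exp(1)[of M "x 2" "\<lambda>\<omega>. 0" "a powr p" 0 0] l by simp
  have xm: "x j \<in> borel_measurable M" for j
    unfolding x_def using component.span_measurable[OF inc_span, of s r j] nn by auto
  note [measurable] = xm[of 1] xm[of 2]
  define F1 where "F1 f = (?c * (f s - f r)) * exp (- (?c * (f s - f r))\<^sup>2 / 2) * (?c * f t)" for f :: "real \<Rightarrow> real"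
  define F2 where "F2 f = exp (- (?c * (f s - f r))\<^sup>2 / 2)" for f :: "real \<Rightarrow> real"
  have F1: "F1 (path 1 \<omega>) = x 1 \<omega> * exp (- (x 1 \<omega>)\<^sup>2 / 2) * W \<omega>" for \<omega>
    using nn assms(4) by (simp add: F1_def x_def W_def inc_def)
  have F2: "F2 (path 2 \<omega>) = exp (- (x 2 \<omega>)\<^sup>2 / 2)" for \<omega>
    using nn by (simp add: F2_def x_def inc_def)
  have ev: "(\<lambda>f. f u) \<in> borel_measurable (Pi\<^sub>M {0..} (\<lambda>_. borel :: real measure))" if "0 \<le> u" for u :: real
    using that by (intro measurable_component_singleton) auto
  note [measurable] = ev[OF nn(1)] ev[OF nn(2)] ev[OF assms(4)]
  have i1: "integrable M (\<lambda>\<omega>. F1 (path 1 \<omega>))"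
    unfolding F1
  proof (rule Bochner_Integration.integrable_bound[OF Wi])
    show "(\<lambda>\<omega>. x 1 \<omega> * exp (- (x 1 \<omega>)\<^sup>2 / 2) * W \<omega>) \<in> borel_measurable M"
      using Wi by measurable
    have "\<bar>u * exp (- u\<^sup>2 / 2)\<bar> * \<bar>w\<bar> \<le> 1 * \<bar>w\<bar>" for u w :: real
      by (intro mult_right_mono abs_mult_exp_le) auto
    then show "AE \<omega> in M. norm (x 1 \<omega> * exp (- (x 1 \<omega>)\<^sup>2 / 2) * W \<omega>) \<le> norm (W \<omega>)"
      by (intro AE_I2) (simp add: abs_mult)
  qed
  have i2: "integrable M (\<lambda>\<omega>. F2 (path 2 \<omega>))"
    unfolding F2 by (intro integrable_const_bound[where B = 1]) auto
  have "expectation (\<lambda>\<omega>. F1 (path 1 \<omega>) * F2 (path 2 \<omega>))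
    = expectation (\<lambda>\<omega>. F1 (path 1 \<omega>)) * expectation (\<lambda>\<omega>. F2 (path 2 \<omega>))"
    by (rule expectation_component_product[OF _ _ i1 i2]) (unfold F1_def F2_def, measurable)
  also have "\<dots> = \<kappa> / (\<epsilon> * ?l\<^sup>2)"
    unfolding F1 F2 E1 E2 using l by (simp add: power2_eq_square)
  finally have E: "expectation (\<lambda>\<omega>. F1 (path 1 \<omega>) * F2 (path 2 \<omega>)) = \<kappa> / (\<epsilon> * ?l\<^sup>2)" .
  have "kern \<epsilon> s r \<omega> * X 1 t \<omega> = - (1 / (2 * pi * \<epsilon>)) * (F1 (path 1 \<omega>) * F2 (path 2 \<omega>))" for \<omega>
  proof -
    have "X 1 t \<omega> = sqrt \<epsilon> * W \<omega>" using e by (simp add: W_def)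
    then show ?thesis unfolding F1 F2 kern_eq[OF e] x_def[symmetric] using e by (simp add: mult_ac)
  qed
  then have "expectation (\<lambda>\<omega>. kern \<epsilon> s r \<omega> * X 1 t \<omega>) = - (1 / (2 * pi * \<epsilon>)) * (\<kappa> / (\<epsilon> * ?l\<^sup>2))"
    by (simp only: integral_mult_right_zero E)
  then show ?thesis by (simp add: r_def \<kappa>_def power2_eq_square mult_ac)
qed

end

section \<open>Joint measurability and Fubini's theorem\<close>

text \<open>Rounding the time down to a grid leaves countably many values, each handled by
  measurability at a fixed time; continuity of the paths gives the limit.\<close>

lemma borel_measurable_continuous_process:
  fixes f :: "real \<Rightarrow> 'a \<Rightarrow> real"
  assumes c: "\<And>\<omega>. \<omega> \<in> space M \<Longrightarrow> continuous_on UNIV (\<lambda>t. f t \<omega>)"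
    and m: "\<And>t. f t \<in> borel_measurable M"
    and u: "u \<in> borel_measurable N" and g: "g \<in> N \<rightarrow>\<^sub>M M"
  shows "(\<lambda>x. f (u x) (g x)) \<in> borel_measurable N"
proof (rule borel_measurable_LIMSEQ_real)
  let ?k = "\<lambda>n x. \<lfloor>u x * real (Suc n)\<rfloor>"
  fix n
  show "(\<lambda>x. f (of_int (?k n x) / real (Suc n)) (g x)) \<in> borel_measurable N"
    by (rule measurable_compose_countable[where f = "\<lambda>k x. f (of_int k / real (Suc n)) (g x)"])
      (use u g m in measurable)
next
  fix x assume x: "x \<in> space N"
  have "(\<lambda>n. of_int \<lfloor>u x * real (Suc n)\<rfloor> / real (Suc n)) \<longlonglongrightarrow> u x"
  proof (rule tendsto_sandwich)
    show "\<forall>\<^sub>F n in sequentially. u x - 1 / real (Suc n) \<le> of_int \<lfloor>u x * real (Suc n)\<rfloor> / real (Suc n)"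
    proof (intro always_eventually allI)
      fix n
      have "u x * real (Suc n) - 1 \<le> of_int \<lfloor>u x * real (Suc n)\<rfloor>" by linarith
      then have "(u x * real (Suc n) - 1) / real (Suc n) \<le> of_int \<lfloor>u x * real (Suc n)\<rfloor> / real (Suc n)"
        by (rule divide_right_mono) simp
      then show "u x - 1 / real (Suc n) \<le> of_int \<lfloor>u x * real (Suc n)\<rfloor> / real (Suc n)"
        by (simp add: diff_divide_distrib)
    qed
    show "\<forall>\<^sub>F n in sequentially. of_int \<lfloor>u x * real (Suc n)\<rfloor> / real (Suc n) \<le> u x"
    proof (intro always_eventually allI)
      fix n
      have "of_int \<lfloor>u x * real (Suc n)\<rfloor> / real (Suc n) \<le> (u x * real (Suc n)) / real (Suc n)"
        by (intro divide_right_mono) auto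
      then show "of_int \<lfloor>u x * real (Suc n)\<rfloor> / real (Suc n) \<le> u x" by simp
    qed
    have "(\<lambda>n. 1 / real (Suc n)) \<longlonglongrightarrow> 0"
      using LIMSEQ_inverse_real_of_nat by (simp only: inverse_eq_divide)
    from tendsto_diff[OF tendsto_const[of "u x"] this]
    show "(\<lambda>n. u x - 1 / real (Suc n)) \<longlonglongrightarrow> u x" by simp
  qed simp
  moreover have "isCont (\<lambda>t. f t (g x)) (u x)"
    using c[of "g x"] measurable_space[OF g x] by (simp add: continuous_on_eq_continuous_at)
  ultimately show "(\<lambda>n. f (of_int \<lfloor>u x * real (Suc n)\<rfloor> / real (Suc n)) (g x)) \<longlonglongrightarrow> f (u x) (g x)"
    by (rule isCont_tendsto_compose[rotated])
qed

text \<open>The test variable \<open>Y\<close> serves the cross moment (with B_t) as well as the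
  second moment (with a kernel, or with the integral itself).\<close>

lemma (in prob_space) expectation_integral_mult:
  fixes \<Phi> :: "'b \<Rightarrow> 'a \<Rightarrow> real"
  assumes Q: "sigma_finite_measure Q"
    and \<Phi>: "(\<lambda>(z, \<omega>). \<Phi> z \<omega>) \<in> borel_measurable (Q \<Otimes>\<^sub>M M)"
    and g: "integrable Q g" and le: "\<And>z \<omega>. \<bar>\<Phi> z \<omega>\<bar> \<le> g z"
    and Y: "integrable M Y"
  shows "expectation (\<lambda>\<omega>. (\<integral>z. \<Phi> z \<omega> \<partial>Q) * Y \<omega>) = (\<integral>z. expectation (\<lambda>\<omega>. \<Phi> z \<omega> * Y \<omega>) \<partial>Q)"
    and "integrable Q (\<lambda>z. expectation (\<lambda>\<omega>. \<Phi> z \<omega> * Y \<omega>))"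
    and "(\<lambda>\<omega>. \<integral>z. \<Phi> z \<omega> \<partial>Q) \<in> borel_measurable M"
    and "\<And>\<omega>. \<bar>\<integral>z. \<Phi> z \<omega> \<partial>Q\<bar> \<le> (\<integral>z. g z \<partial>Q)"
proof -
  interpret Q: sigma_finite_measure Q by fact
  interpret P: pair_sigma_finite Q M ..
  have [measurable]: "Y \<in> borel_measurable M" using Y by auto
  note [measurable] = \<Phi>
  have i: "integrable (Q \<Otimes>\<^sub>M M) (\<lambda>(z, \<omega>). \<Phi> z \<omega> * Y \<omega>)"
  proof (rule P.integrable_product_bound[OF _ g])
    show "integrable M (\<lambda>\<omega>. \<bar>Y \<omega>\<bar>)" using Y by simp
    show "\<bar>case (z, \<omega>) of (z, \<omega>) \<Rightarrow> \<Phi> z \<omega> * Y \<omega>\<bar> \<le> g z * \<bar>Y \<omega>\<bar>" for z \<omega>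
      using le[of z \<omega>] by (simp add: abs_mult mult_right_mono)
    have "(\<lambda>z. (case z of (z, \<omega>) \<Rightarrow> \<Phi> z \<omega>) * Y (snd z)) \<in> borel_measurable (Q \<Otimes>\<^sub>M M)"
      by measurable
    then show "(\<lambda>(z, \<omega>). \<Phi> z \<omega> * Y \<omega>) \<in> borel_measurable (Q \<Otimes>\<^sub>M M)"
      by (simp add: case_prod_beta')
  qed
  show "integrable Q (\<lambda>z. expectation (\<lambda>\<omega>. \<Phi> z \<omega> * Y \<omega>))"
    using P.integrable_fst'[OF i] by simp
  show "expectation (\<lambda>\<omega>. (\<integral>z. \<Phi> z \<omega> \<partial>Q) * Y \<omega>) = (\<integral>z. expectation (\<lambda>\<omega>. \<Phi> z \<omega> * Y \<omega>) \<partial>Q)"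
    using P.Fubini_integral[OF i] by simp
  show "(\<lambda>\<omega>. \<integral>z. \<Phi> z \<omega> \<partial>Q) \<in> borel_measurable M"
  proof (rule Q.borel_measurable_lebesgue_integral)
    have "(\<lambda>x. (case (snd x, fst x) of (z, \<omega>) \<Rightarrow> \<Phi> z \<omega>)) \<in> borel_measurable (M \<Otimes>\<^sub>M Q)"
      by (rule measurable_compose[OF _ \<Phi>]) simp
    then show "(\<lambda>(\<omega>, z). \<Phi> z \<omega>) \<in> borel_measurable (M \<Otimes>\<^sub>M Q)" by (simp add: case_prod_beta')
  qed
  show "\<bar>\<integral>z. \<Phi> z \<omega> \<partial>Q\<bar> \<le> (\<integral>z. g z \<partial>Q)" for \<omega>
  proof (cases "integrable Q (\<lambda>z. \<Phi> z \<omega>)")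
    case True
    have "\<bar>\<integral>z. \<Phi> z \<omega> \<partial>Q\<bar> \<le> (\<integral>z. \<bar>\<Phi> z \<omega>\<bar> \<partial>Q)" by (rule integral_abs_bound)
    also have "\<dots> \<le> (\<integral>z. g z \<partial>Q)" using True g le by (intro integral_mono) auto
    finally show ?thesis .
  next
    \<comment> \<open>A function that is not integrable has integral 0, so the bound
      persists.\<close>
    case False
    have "0 \<le> g z" for z using le[of z undefined] abs_ge_zero order_trans by blast
    then have "0 \<le> (\<integral>z. g z \<partial>Q)" by (simp add: Bochner_Integration.integral_nonneg)
    then show ?thesis using False by (simp add: not_integrable_integral_eq)
  qed
qed

abbreviation plane :: "(real \<times> real) measure" where "plane \<equiv> lborel \<Otimes>\<^sub>M lborel"

lemma sigma_finite_plane: "sigma_finite_measure plane"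
  by (rule lborel_pair.P.sigma_finite_measure_axioms)

context planar_fbm
begin

lemma AE_continuous_paths: "AE \<omega> in M. \<forall>j. continuous_on {0..} (\<lambda>t. X j t \<omega>)"
proof -
  have "AE \<omega> in M. continuous_on {0..} (\<lambda>t. X j t \<omega>)" for j
    using fbm_component[of j] by (simp add: fractional_brownian_motion_def)
  then show ?thesis by (simp add: forall_2)
qed

text \<open>A fixed measurable null set off which all coordinate paths are continuous. The set of
  discontinuous paths itself need not be measurable.\<close>

definition irregular :: "'a set" where
  "irregular = (SOME N. N \<in> null_sets M \<and> (\<forall>\<omega>\<in>space M - N. \<forall>j. continuous_on {0..} (\<lambda>t. X j t \<omega>)))"

lemma irregular_null: "irregular \<in> null_sets M"
  and continuous_paths: "\<omega> \<in> space M \<Longrightarrow> \<omega> \<notin> irregular \<Longrightarrow> continuous_on {0..} (\<lambda>t. X j t \<omega>)"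
proof -
  have "\<exists>N. N \<in> null_sets M \<and> (\<forall>\<omega>\<in>space M - N. \<forall>j. continuous_on {0..} (\<lambda>t. X j t \<omega>))"
    using AE_continuous_paths by (auto simp: eventually_ae_filter)
  then have *: "irregular \<in> null_sets M \<and> (\<forall>\<omega>\<in>space M - irregular. \<forall>j. continuous_on {0..} (\<lambda>t. X j t \<omega>))"
    unfolding irregular_def by (rule someI_ex)
  show "irregular \<in> null_sets M" using * by blast
  show "\<omega> \<in> space M \<Longrightarrow> \<omega> \<notin> irregular \<Longrightarrow> continuous_on {0..} (\<lambda>t. X j t \<omega>)" using * by blast
qed

text \<open>Jointly measurable versions of the coordinates, needed for Fubini's theorem.\<close>

definition regular_coord :: "2 \<Rightarrow> real \<Rightarrow> 'a \<Rightarrow> real" where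
  "regular_coord j t \<omega> = (if \<omega> \<in> irregular then 0 else X j (max 0 t) \<omega>)"

lemma regular_coord_measurable [measurable (raw)]:
  assumes "u \<in> borel_measurable N" "g \<in> N \<rightarrow>\<^sub>M M"
  shows "(\<lambda>x. regular_coord j (u x) (g x)) \<in> borel_measurable N"
proof (rule borel_measurable_continuous_process[OF _ _ assms])
  show "continuous_on UNIV (\<lambda>t. regular_coord j t \<omega>)" if "\<omega> \<in> space M" for \<omega>
  proof (cases "\<omega> \<in> irregular")
    case False
    have "continuous_on UNIV (\<lambda>t. X j (max 0 t) \<omega>)"
      by (rule continuous_on_compose2[OF continuous_paths[OF that False], of _ "\<lambda>t. max 0 t"])
        (auto intro!: continuous_intros)
    then show ?thesis using False by (simp add: regular_coord_def)
  qed (simp add: regular_coord_def)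
  show "regular_coord j t \<in> borel_measurable M" for t
  proof -
    have [measurable]: "X j (max 0 t) \<in> borel_measurable M" by (rule X_measurable) simp
    have [measurable]: "irregular \<in> sets M" using irregular_null by auto
    show ?thesis unfolding regular_coord_def by measurable
  qed
qed

definition rkern :: "real \<Rightarrow> real \<Rightarrow> real \<Rightarrow> 'a \<Rightarrow> real" where
  "rkern \<epsilon> s r \<omega> = - ((regular_coord 1 s \<omega> - regular_coord 1 r \<omega>) / \<epsilon>) / (2 * pi * \<epsilon>)
    * exp (- ((regular_coord 1 s \<omega> - regular_coord 1 r \<omega>)\<^sup>2 + (regular_coord 2 s \<omega> - regular_coord 2 r \<omega>)\<^sup>2) / (2 * \<epsilon>))"

lemma rkern_measurable [measurable (raw)]:
  assumes [measurable]: "u \<in> borel_measurable N" "v \<in> borel_measurable N" "g \<in> N \<rightarrow>\<^sub>M M"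
  shows "(\<lambda>x. rkern \<epsilon> (u x) (v x) (g x)) \<in> borel_measurable N"
  unfolding rkern_def by measurable

lemma rkern_same: "rkern \<epsilon> s s \<omega> = 0"
  by (simp add: rkern_def)

lemma rkern_eq_kern:
  assumes "0 < \<epsilon>" "0 \<le> s" "0 \<le> r" "\<omega> \<notin> irregular"
  shows "rkern \<epsilon> s r \<omega> = kern \<epsilon> s r \<omega>"
  using assms by (simp add: rkern_def kern_def partial_deriv_heat_kernel regular_coord_def X_def)

lemma AE_rkern_eq_kern:
  assumes "0 < \<epsilon>" "0 \<le> s" "0 \<le> r"
  shows "AE \<omega> in M. rkern \<epsilon> s r \<omega> = kern \<epsilon> s r \<omega>"
  using AE_not_in[OF irregular_null] by eventually_elim (simp add: rkern_eq_kern assms)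

lemma rkern_bound:
  assumes "0 < \<epsilon>" shows "\<bar>rkern \<epsilon> s r \<omega>\<bar> \<le> 1 / (2 * pi * \<epsilon> * sqrt \<epsilon>)"
proof (cases "\<omega> \<in> irregular")
  case True
  then show ?thesis using assms by (simp add: rkern_def regular_coord_def)
next
  case False
  have "rkern \<epsilon> s r \<omega> = rkern \<epsilon> (max 0 s) (max 0 r) \<omega>" by (simp add: rkern_def regular_coord_def)
  then show ?thesis using rkern_eq_kern[of \<epsilon> "max 0 s" "max 0 r" \<omega>] kern_bound[OF assms] assms False by simp
qed

section \<open>The rescaled local time as an integral over the plane\<close>

text \<open>The substitutions \<open>\<epsilon> = \<eta> powr p\<close> and \<open>r = s - \<eta> * a\<close> turn the scaled local time into an
  integral over the pairs \<open>(s, a)\<close> of this domain.\<close>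

definition time_domain :: "real \<Rightarrow> real \<Rightarrow> (real \<times> real) set" where
  "time_domain t \<eta> = {(s, a). 0 \<le> s \<and> s \<le> t \<and> 0 < a \<and> \<eta> * a \<le> s}"

lemma time_domain_measurable [measurable]: "time_domain t \<eta> \<in> sets plane"
proof -
  have "time_domain t \<eta> = {z \<in> space plane. 0 \<le> fst z \<and> fst z \<le> t \<and> 0 < snd z \<and> \<eta> * snd z \<le> fst z}"
    by (auto simp: time_domain_def space_pair_measure)
  also have "\<dots> \<in> sets plane" by measurable
  finally show ?thesis .
qed

lemma integrable_indicator_time_domain:
  assumes "0 < \<eta>" "0 < t" shows "integrable plane (\<lambda>z. c * indicator (time_domain t \<eta>) z :: real)"
proof -
  have "time_domain t \<eta> \<subseteq> {0..t} \<times> {0..t / \<eta>}"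
    using assms by (auto simp: time_domain_def field_simps)
  then have "emeasure plane (time_domain t \<eta>) \<le> emeasure plane ({0..t} \<times> {0..t / \<eta>})"
    by (intro emeasure_mono) auto
  also have "\<dots> < \<infinity>"
    using assms by (simp add: lborel.emeasure_pair_measure_Times ennreal_mult_less_top)
  finally have "emeasure plane (time_domain t \<eta>) < \<infinity>" .
  then have "integrable plane (indicator (time_domain t \<eta>) :: _ \<Rightarrow> real)"
    by (intro integrable_real_indicator time_domain_measurable)
  then show ?thesis by (rule integrable_mult_right)
qed

text \<open>The normalising factor eps^(2 - 1/H) is eta^(2p-2); the Jacobian of r = s - eta a
  supplies one more power of eta.\<close>

definition scaled_kern :: "real \<Rightarrow> real \<Rightarrow> real \<times> real \<Rightarrow> 'a \<Rightarrow> real" where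
  "scaled_kern t \<eta> z \<omega> = \<eta> powr (2 * p - 1) * (indicator (time_domain t \<eta>) z * rkern (\<eta> powr p) (fst z) (fst z - \<eta> * snd z) \<omega>)"

definition scaled_DSLT :: "real \<Rightarrow> real \<Rightarrow> 'a \<Rightarrow> real" where
  "scaled_DSLT t \<eta> \<omega> = (\<integral>z. scaled_kern t \<eta> z \<omega> \<partial>plane)"

lemma scaled_kern_measurable: "(\<lambda>(z, \<omega>). scaled_kern t \<eta> z \<omega>) \<in> borel_measurable (plane \<Otimes>\<^sub>M M)"
  unfolding scaled_kern_def case_prod_beta' by measurable

lemma scaled_kern_bound:
  assumes "0 < \<eta>"
  shows "\<bar>scaled_kern t \<eta> z \<omega>\<bar> \<le> \<eta> powr (2 * p - 1) * (1 / (2 * pi * \<eta> powr p * sqrt (\<eta> powr p))) * indicator (time_domain t \<eta>) z"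
proof -
  have "\<bar>scaled_kern t \<eta> z \<omega>\<bar> = \<eta> powr (2 * p - 1) * \<bar>rkern (\<eta> powr p) (fst z) (fst z - \<eta> * snd z) \<omega>\<bar> * indicator (time_domain t \<eta>) z"
    by (simp add: scaled_kern_def abs_mult)
  also have "\<dots> \<le> \<eta> powr (2 * p - 1) * (1 / (2 * pi * \<eta> powr p * sqrt (\<eta> powr p))) * indicator (time_domain t \<eta>) z"
    using assms by (intro mult_right_mono mult_left_mono rkern_bound) auto
  finally show ?thesis .
qed

lemmas scaled_kern_fubini = expectation_integral_mult[OF sigma_finite_plane scaled_kern_measurable integrable_indicator_time_domain scaled_kern_bound]

lemma scaled_DSLT_measurable:
  assumes "0 < \<eta>" "0 < t" shows "scaled_DSLT t \<eta> \<in> borel_measurable M"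
  unfolding scaled_DSLT_def using scaled_kern_fubini(3)[OF assms assms(1), of "\<lambda>_. 0"] by simp

lemma scaled_DSLT_integrable_square:
  assumes "0 < \<eta>" "0 < t" shows "integrable M (\<lambda>\<omega>. (scaled_DSLT t \<eta> \<omega>)\<^sup>2)" "integrable M (scaled_DSLT t \<eta>)"
proof -
  note [measurable] = scaled_DSLT_measurable[OF assms]
  obtain C where C: "\<And>\<omega>. \<bar>scaled_DSLT t \<eta> \<omega>\<bar> \<le> C"
    unfolding scaled_DSLT_def using scaled_kern_fubini(4)[OF assms assms(1), of "\<lambda>_. 0"] by blast
  show "integrable M (scaled_DSLT t \<eta>)" using C by (intro integrable_const_bound[where B = C]) auto
  have "(scaled_DSLT t \<eta> \<omega>)\<^sup>2 \<le> C\<^sup>2" for \<omega>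
    using C[of \<omega>] by (intro power2_le_iff_abs_le[THEN iffD2]) auto
  then show "integrable M (\<lambda>\<omega>. (scaled_DSLT t \<eta> \<omega>)\<^sup>2)" by (intro integrable_const_bound[where B = "C\<^sup>2"]) auto
qed

lemma expectation_scaled_DSLT_mult:
  assumes "0 < \<eta>" "0 < t" "integrable M Y"
  shows "expectation (\<lambda>\<omega>. scaled_DSLT t \<eta> \<omega> * Y \<omega>) = (\<integral>z. expectation (\<lambda>\<omega>. scaled_kern t \<eta> z \<omega> * Y \<omega>) \<partial>plane)"
    and "integrable plane (\<lambda>z. expectation (\<lambda>\<omega>. scaled_kern t \<eta> z \<omega> * Y \<omega>))"
  unfolding scaled_DSLT_def using scaled_kern_fubini(1,2)[OF assms(1,2,1,3)] by auto

lemma scaled_kern_integrable: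
  assumes "0 < \<eta>" shows "integrable M (scaled_kern t \<eta> z)"
proof (rule integrable_const_bound)
  show "scaled_kern t \<eta> z \<in> borel_measurable M" unfolding scaled_kern_def by measurable
  show "AE \<omega> in M. norm (scaled_kern t \<eta> z \<omega>) \<le> \<eta> powr (2 * p - 1) * (1 / (2 * pi * \<eta> powr p * sqrt (\<eta> powr p))) * indicator (time_domain t \<eta>) z"
    using scaled_kern_bound[OF assms] by (intro AE_I2) simp
qed

text \<open>Fubini's theorem is applied twice with a bounded test variable, once with the integral
  itself and once with a single kernel, instead of once to a fourfold integral.\<close>

lemma expectation_scaled_DSLT_square:
  assumes "0 < \<eta>" "0 < t"
  shows "expectation (\<lambda>\<omega>. (scaled_DSLT t \<eta> \<omega>)\<^sup>2) = (\<integral>z. \<integral>z'. expectation (\<lambda>\<omega>. scaled_kern t \<eta> z \<omega> * scaled_kern t \<eta> z' \<omega>) \<partial>plane \<partial>plane)"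
    and "integrable plane (\<lambda>z'. expectation (\<lambda>\<omega>. scaled_kern t \<eta> z \<omega> * scaled_kern t \<eta> z' \<omega>))"
    and "integrable plane (\<lambda>z. \<integral>z'. expectation (\<lambda>\<omega>. scaled_kern t \<eta> z \<omega> * scaled_kern t \<eta> z' \<omega>) \<partial>plane)"
proof -
  note V = scaled_DSLT_integrable_square(2)[OF assms]
  have inner: "expectation (\<lambda>\<omega>. scaled_kern t \<eta> z \<omega> * scaled_DSLT t \<eta> \<omega>) = (\<integral>z'. expectation (\<lambda>\<omega>. scaled_kern t \<eta> z \<omega> * scaled_kern t \<eta> z' \<omega>) \<partial>plane)" for z
    using expectation_scaled_DSLT_mult(1)[OF assms scaled_kern_integrable[OF assms(1), of t z]] by (simp add: mult.commute)
  show "expectation (\<lambda>\<omega>. (scaled_DSLT t \<eta> \<omega>)\<^sup>2) = (\<integral>z. \<integral>z'. expectation (\<lambda>\<omega>. scaled_kern t \<eta> z \<omega> * scaled_kern t \<eta> z' \<omega>) \<partial>plane \<partial>plane)"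
    using expectation_scaled_DSLT_mult(1)[OF assms V] unfolding inner power2_eq_square .
  show "integrable plane (\<lambda>z. \<integral>z'. expectation (\<lambda>\<omega>. scaled_kern t \<eta> z \<omega> * scaled_kern t \<eta> z' \<omega>) \<partial>plane)"
    using expectation_scaled_DSLT_mult(2)[OF assms V] unfolding inner .
  show "integrable plane (\<lambda>z'. expectation (\<lambda>\<omega>. scaled_kern t \<eta> z \<omega> * scaled_kern t \<eta> z' \<omega>))"
    using expectation_scaled_DSLT_mult(2)[OF assms scaled_kern_integrable[OF assms(1), of t z]] by (simp add: mult.commute)
qed

lemma approx_DSLT_eq_scaled_DSLT:
  assumes "0 < \<eta>" "0 < t" "\<omega> \<in> space M" "\<omega> \<notin> irregular"
  shows "\<eta> powr (2 * p - 2) * approx_DSLT B 1 t (\<eta> powr p) \<omega> = scaled_DSLT t \<eta> \<omega>"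
proof -
  let ?e = "\<eta> powr p"
  have e: "0 < ?e" using assms by simp
  let ?f = "\<lambda>z. indicator (time_domain t \<eta>) z * rkern ?e (fst z) (fst z - \<eta> * snd z) \<omega>"
  have inner: "(LBINT r:{0..s}. kern ?e s r \<omega>) = \<eta> * (\<integral>a. ?f (s, a) \<partial>lborel)" if "s \<in> {0..t}" for s
  proof -
    have "(LBINT r:{0..s}. kern ?e s r \<omega>) = (\<integral>r. indicator {0..s} r * rkern ?e s r \<omega> \<partial>lborel)"
      unfolding set_lebesgue_integral_def using assms e that
      by (intro Bochner_Integration.integral_cong refl) (auto simp: indicator_def rkern_eq_kern)
    also have "\<dots> = \<eta> * (\<integral>a. indicator {0..s} (s + - \<eta> * a) * rkern ?e s (s + - \<eta> * a) \<omega> \<partial>lborel)"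
      using lborel_integral_real_affine[of "- \<eta>" "\<lambda>r. indicator {0..s} r * rkern ?e s r \<omega>" s] assms by simp
    also have "(\<lambda>a. indicator {0..s} (s + - \<eta> * a) * rkern ?e s (s + - \<eta> * a) \<omega>) = (\<lambda>a. ?f (s, a))"
    proof
      fix a
      \<comment> \<open>At a = 0 the domain omits a point that [0, s] contains; the kernel vanishes
        there, both times being equal.\<close>
      show "indicator {0..s} (s + - \<eta> * a) * rkern ?e s (s + - \<eta> * a) \<omega> = ?f (s, a)"
        using assms that by (cases "a = 0") (auto simp: indicator_def time_domain_def rkern_same zero_le_mult_iff)
    qed
    finally show ?thesis .
  qed
  have int: "integrable plane ?f"
  proof (rule Bochner_Integration.integrable_bound)
    show "integrable plane (\<lambda>z. 1 / (2 * pi * ?e * sqrt ?e) * indicator (time_domain t \<eta>) z)"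
      by (rule integrable_indicator_time_domain) (use assms in auto)
    show "?f \<in> borel_measurable plane" using assms(3) by measurable
    show "AE z in plane. norm (?f z) \<le> norm (1 / (2 * pi * ?e * sqrt ?e) * indicator (time_domain t \<eta>) z :: real)"
      using rkern_bound[OF e] by (intro AE_I2) (auto simp: indicator_def)
  qed
  have "approx_DSLT B 1 t ?e \<omega> = (LBINT s:{0..t}. (LBINT r:{0..s}. kern ?e s r \<omega>))"
    by (simp add: approx_DSLT_def kern_def)
  also have "\<dots> = (LBINT s:{0..t}. \<eta> * (\<integral>a. ?f (s, a) \<partial>lborel))"
    by (rule set_lebesgue_integral_cong) (use inner in auto)
  also have "\<dots> = (\<integral>s. \<eta> * (\<integral>a. ?f (s, a) \<partial>lborel) \<partial>lborel)"
    unfolding set_lebesgue_integral_def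
  proof (rule Bochner_Integration.integral_cong[OF refl])
    fix s
    show "indicator {0..t} s *\<^sub>R (\<eta> * (\<integral>a. ?f (s, a) \<partial>lborel)) = \<eta> * (\<integral>a. ?f (s, a) \<partial>lborel)"
    proof (cases "s \<in> {0..t}")
      case False
      then have "?f (s, a) = 0" for a by (auto simp: time_domain_def)
      then have "(\<integral>a. ?f (s, a) \<partial>lborel) = 0" by (simp only:) simp
      then show ?thesis by simp
    qed simp
  qed
  also have "\<dots> = \<eta> * (\<integral>s. \<integral>a. ?f (s, a) \<partial>lborel \<partial>lborel)" by (rule integral_mult_right_zero)
  also have "(\<integral>s. \<integral>a. ?f (s, a) \<partial>lborel \<partial>lborel) = (\<integral>z. ?f z \<partial>plane)"
    by (rule lborel_pair.integral_fst'[OF int])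
  finally have "\<eta> powr (2 * p - 2) * approx_DSLT B 1 t ?e \<omega> = \<eta> powr (2 * p - 2) * \<eta> * (\<integral>z. ?f z \<partial>plane)"
    by simp
  moreover have "\<eta> powr (2 * p - 2) * \<eta> = \<eta> powr (2 * p - 1)"
    using assms powr_add[of \<eta> "2 * p - 2" 1] by simp
  ultimately show ?thesis unfolding scaled_DSLT_def scaled_kern_def by simp
qed

end

section \<open>Moments in the limit\<close>

lemma nn_integral_plane_pair:
  assumes [measurable]: "f \<in> borel_measurable (plane \<Otimes>\<^sub>M plane)"
  shows "(\<integral>\<^sup>+x. f x \<partial>(plane \<Otimes>\<^sub>M plane)) = (\<integral>\<^sup>+z. \<integral>\<^sup>+z'. f (z, z') \<partial>plane \<partial>plane)"
  by (rule lborel_pair.P.nn_integral_fst[symmetric]) fact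

lemma AE_plane_fst_neq: "AE z in plane. fst z \<noteq> s"
proof (rule AE_I')
  have "emeasure plane ({s} \<times> UNIV) = 0"
    by (subst lborel.emeasure_pair_measure_Times) auto
  then show "{s} \<times> UNIV \<in> null_sets plane" by (intro null_setsI) auto
  show "{z \<in> space plane. \<not> fst z \<noteq> s} \<subseteq> {s} \<times> UNIV" by auto
qed

context hurst_exponent
begin

section \<open>Dominating functions and their integrals\<close>

definition size_weight :: "real \<Rightarrow> ennreal" where
  "size_weight a = ennreal (a / (1 + a powr p)\<^sup>2) * indicator {0<..} a"

definition tail_weight :: "real \<Rightarrow> ennreal" where
  "tail_weight x = ennreal (1 / (1 + \<bar>x\<bar> powr p))"

lemma size_weight_measurable [measurable]: "size_weight \<in> borel_measurable borel"
  unfolding size_weight_def by measurable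

lemma tail_weight_measurable [measurable]: "tail_weight \<in> borel_measurable borel"
  unfolding tail_weight_def by measurable

lemma nn_integral_size_weight: "(\<integral>\<^sup>+a. size_weight a \<partial>lborel) = ennreal beta_int"
  unfolding size_weight_def by (rule nn_integral_beta_int)

text \<open>Dominating functions for pairs of increments of scaled lengths \<open>a\<close> and \<open>b\<close> that do not nearly
  coincide, and for those that do.  The first does not depend on the scale \<open>\<eta>\<close> and allows
  dominated convergence; the integral of the second vanishes as \<open>\<eta>\<close> tends to 0.\<close>

definition far_bound :: "real \<Rightarrow> real \<Rightarrow> (real \<times> real) \<times> (real \<times> real) \<Rightarrow> ennreal" where
  "far_bound t C = (\<lambda>((s, a), (s', b)). ennreal C * (indicator {0..t} s * (size_weight a *
     (ennreal (\<bar>s' - s\<bar> powr (p - 2)) * indicator {0..t} s' * size_weight b))))"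

definition near_bound :: "real \<Rightarrow> real \<Rightarrow> real \<Rightarrow> (real \<times> real) \<times> (real \<times> real) \<Rightarrow> ennreal" where
  "near_bound t C \<eta> = (\<lambda>((s, a), (s', b)). ennreal (C * \<eta> powr (p - 2)) * (indicator {0..t} s * (tail_weight a *
     (tail_weight ((s' - s) / \<eta>) * tail_weight ((b - ((s' - s) / \<eta> + a)) / 1)))))"

lemma far_bound_measurable [measurable]: "far_bound t C \<in> borel_measurable (plane \<Otimes>\<^sub>M plane)"
  unfolding far_bound_def case_prod_beta' by measurable

lemma near_bound_measurable [measurable]: "near_bound t C \<eta> \<in> borel_measurable (plane \<Otimes>\<^sub>M plane)"
  unfolding near_bound_def case_prod_beta' by measurable

lemma far_bound_eq:
  assumes "s \<in> {0..t}" "s' \<in> {0..t}" "0 < a" "0 < b" "0 \<le> C"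
  shows "far_bound t C ((s, a), (s', b)) = ennreal (C * (\<bar>s' - s\<bar> powr (p - 2) * (a / (1 + a powr p)\<^sup>2) * (b / (1 + b powr p)\<^sup>2)))"
proof -
  have "ennreal C * (1 * (ennreal x * 1 * (ennreal w * 1 * (ennreal z * 1)))) = ennreal (C * (w * x * z))"
    if "0 \<le> x" "0 \<le> w" "0 \<le> z" for x w z
    using that assms(5) by (simp flip: ennreal_mult add: mult_ac)
  from this[of "a / (1 + a powr p)\<^sup>2" "\<bar>s' - s\<bar> powr (p - 2)" "b / (1 + b powr p)\<^sup>2"] show ?thesis
    using assms by (simp add: far_bound_def size_weight_def)
qed

lemma near_bound_eq:
  assumes "s \<in> {0..t}" "0 \<le> C"
  shows "near_bound t C \<eta> ((s, a), (s', b)) = ennreal (C * \<eta> powr (p - 2) * (1 / (1 + \<bar>a\<bar> powr p)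
    * (1 / (1 + \<bar>(s' - s) / \<eta>\<bar> powr p) * (1 / (1 + \<bar>b - ((s' - s) / \<eta> + a)\<bar> powr p)))))"
proof -
  have "ennreal c * (1 * (ennreal x * (ennreal w * ennreal z))) = ennreal (c * (x * (w * z)))"
    if "0 \<le> c" "0 \<le> x" "0 \<le> w" "0 \<le> z" for c x w z
    using that by (simp flip: ennreal_mult)
  moreover have "0 \<le> 1 / (1 + \<bar>x\<bar> powr p)" for x by simp
  moreover have "indicator {0..t} s = (1 :: ennreal)" using assms by simp
  moreover have "0 \<le> C * \<eta> powr (p - 2)" using assms by simp
  ultimately show ?thesis
    by (simp only: near_bound_def tail_weight_def prod.case div_by_1)
qed

text \<open>The integral factors into two copies of \<open>beta_int\<close> and a time integral of
  |s' - s|^(p-2). It is evaluated exactly because, for the right constant, it is the limiting second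
  moment.\<close>

lemma nn_integral_far_bound:
  assumes "0 \<le> C" "0 < t"
  shows "(\<integral>\<^sup>+x. far_bound t C x \<partial>(plane \<Otimes>\<^sub>M plane)) = ennreal (C * beta_int\<^sup>2 * (2 * t powr p / (p * (p - 1))))"
proof -
  have inner: "(\<integral>\<^sup>+z'. far_bound t C ((s, a), z') \<partial>plane)
      = ennreal (C * beta_int / (p - 1)) * ((ennreal (s powr (p - 1) + (t - s) powr (p - 1)) * indicator {0..t} s) * size_weight a)" for s a
  proof -
    have "(\<integral>\<^sup>+z'. far_bound t C ((s, a), z') \<partial>plane)
      = (\<integral>\<^sup>+z'. ennreal C * (indicator {0..t} s * size_weight a) *
          ((ennreal (\<bar>fst z' - s\<bar> powr (p - 2)) * indicator {0..t} (fst z')) * size_weight (snd z')) \<partial>plane)"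
      by (simp add: far_bound_def case_prod_beta' mult_ac)
    also have "\<dots> = ennreal C * (indicator {0..t} s * size_weight a) *
        (\<integral>\<^sup>+z'. (ennreal (\<bar>fst z' - s\<bar> powr (p - 2)) * indicator {0..t} (fst z')) * size_weight (snd z') \<partial>plane)"
      by (rule nn_integral_cmult) measurable
    also have "(\<integral>\<^sup>+z'. (ennreal (\<bar>fst z' - s\<bar> powr (p - 2)) * indicator {0..t} (fst z')) * size_weight (snd z') \<partial>plane)
      = (\<integral>\<^sup>+s'. \<integral>\<^sup>+b. (ennreal (\<bar>s' - s\<bar> powr (p - 2)) * indicator {0..t} s') * size_weight b \<partial>lborel \<partial>lborel)"
      by (subst lborel.nn_integral_fst[symmetric]) auto
    also have "\<dots> = (\<integral>\<^sup>+s'. (ennreal (\<bar>s' - s\<bar> powr (p - 2)) * indicator {0..t} s') \<partial>lborel) * ennreal beta_int"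
      by (simp add: nn_integral_cmult nn_integral_multc nn_integral_size_weight)
    also have "ennreal C * (indicator {0..t} s * size_weight a) * \<dots>
      = ennreal (C * beta_int / (p - 1)) * ((ennreal (s powr (p - 1) + (t - s) powr (p - 1)) * indicator {0..t} s) * size_weight a)"
    proof (cases "s \<in> {0..t}")
      case True
      have "ennreal C * ennreal (u / (p - 1)) * ennreal beta_int = ennreal (C * beta_int / (p - 1)) * ennreal u"
        if "0 \<le> u" for u
        using assms p_gt_1 beta_int_nonneg that by (simp flip: ennreal_mult add: mult_ac)
      from this[of "s powr (p - 1) + (t - s) powr (p - 1)"]
      have "ennreal C * ennreal ((s powr (p - 1) + (t - s) powr (p - 1)) / (p - 1)) * ennreal beta_int
        = ennreal (C * beta_int / (p - 1)) * ennreal (s powr (p - 1) + (t - s) powr (p - 1))"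
        by (simp only: add_nonneg_nonneg powr_ge_zero)
      note eq = this
      have int: "(\<integral>\<^sup>+r. ennreal (\<bar>r - s\<bar> powr (p - 2)) * indicator {0..t} r \<partial>lborel)
          = ennreal ((s powr (p - 1) + (t - s) powr (p - 1)) / (p - 1))"
        using True by (intro nn_integral_abs_powr) auto
      have ind: "indicator {0..t} s = (1 :: ennreal)" using True by simp
      let ?E = "ennreal ((s powr (p - 1) + (t - s) powr (p - 1)) / (p - 1))"
        and ?S = "ennreal (s powr (p - 1) + (t - s) powr (p - 1))"
      have "ennreal C * (1 * size_weight a) * (?E * ennreal beta_int) = (ennreal C * ?E * ennreal beta_int) * size_weight a"
        by (simp only: mult_1 mult_ac)
      also have "\<dots> = ennreal (C * beta_int / (p - 1)) * ?S * size_weight a" unfolding eq ..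
      also have "\<dots> = ennreal (C * beta_int / (p - 1)) * ((?S * 1) * size_weight a)"
        by (simp only: mult_1_right mult.assoc)
      finally show ?thesis unfolding int ind .
    qed simp
    finally show ?thesis .
  qed
  have "(\<integral>\<^sup>+x. far_bound t C x \<partial>(plane \<Otimes>\<^sub>M plane))
    = (\<integral>\<^sup>+s. \<integral>\<^sup>+a. ennreal (C * beta_int / (p - 1)) * ((ennreal (s powr (p - 1) + (t - s) powr (p - 1)) * indicator {0..t} s) * size_weight a) \<partial>lborel \<partial>lborel)"
  proof -
    have "(\<lambda>z. \<integral>\<^sup>+z'. far_bound t C (z, z') \<partial>plane) \<in> borel_measurable plane" by measurable
    from lborel.nn_integral_fst[OF this]
    show ?thesis unfolding nn_integral_plane_pair[OF far_bound_measurable] by (simp add: inner)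
  qed
  also have "\<dots> = ennreal (C * beta_int / (p - 1)) * (ennreal (2 * t powr p / p) * ennreal beta_int)"
    using nn_integral_powr_sum[OF assms(2)] by (simp add: nn_integral_cmult nn_integral_multc nn_integral_size_weight)
  also have "\<dots> = ennreal (C * beta_int\<^sup>2 * (2 * t powr p / (p * (p - 1))))"
    using assms p_gt_1 beta_int_nonneg by (simp flip: ennreal_mult add: power2_eq_square mult_ac)
  finally show ?thesis .
qed

text \<open>Integration in b, s' and a produces three copies of \<open>tail_int\<close>; rescaling
  s' contributes a factor eta, and eta^(p-2) eta tends to 0 as p > 1.\<close>

lemma nn_integral_near_bound:
  assumes "0 \<le> C" "0 < t" "0 < \<eta>"
  shows "(\<integral>\<^sup>+x. near_bound t C \<eta> x \<partial>(plane \<Otimes>\<^sub>M plane)) = ennreal (C * t * \<eta> powr (p - 1)) * tail_int ^ 3"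
proof -
  have sh: "(\<integral>\<^sup>+x. tail_weight ((x - d) / c) \<partial>lborel) = ennreal c * tail_int" if "0 < c" for c d
    unfolding tail_weight_def by (rule nn_integral_shifted_tail[OF that])
  have T: "(\<integral>\<^sup>+x. tail_weight x \<partial>lborel) = tail_int" by (simp add: tail_weight_def tail_int_def)
  have inner: "(\<integral>\<^sup>+z'. near_bound t C \<eta> ((s, a), z') \<partial>plane)
      = ennreal (C * \<eta> powr (p - 2)) * ennreal \<eta> * tail_int\<^sup>2 * (indicator {0..t} s * tail_weight a)" for s a
  proof -
    have "(\<lambda>z'. near_bound t C \<eta> ((s, a), z')) \<in> borel_measurable plane" by measurable
    from lborel.nn_integral_fst[OF this]
    have "(\<integral>\<^sup>+z'. near_bound t C \<eta> ((s, a), z') \<partial>plane) = (\<integral>\<^sup>+s'. \<integral>\<^sup>+b. near_bound t C \<eta> ((s, a), (s', b)) \<partial>lborel \<partial>lborel)"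
      by simp
    also have "\<dots> = (\<integral>\<^sup>+s'. ennreal (C * \<eta> powr (p - 2)) * (indicator {0..t} s * (tail_weight a * (tail_weight ((s' - s) / \<eta>) * (ennreal 1 * tail_int)))) \<partial>lborel)"
      by (simp add: near_bound_def nn_integral_cmult sh[of 1, simplified])
    also have "\<dots> = ennreal (C * \<eta> powr (p - 2)) * (indicator {0..t} s * (tail_weight a * ((ennreal \<eta> * tail_int) * (ennreal 1 * tail_int))))"
      by (simp add: nn_integral_cmult nn_integral_multc sh[OF assms(3)])
    finally show ?thesis by (simp add: power2_eq_square mult_ac)
  qed
  have "(\<integral>\<^sup>+x. near_bound t C \<eta> x \<partial>(plane \<Otimes>\<^sub>M plane))
    = (\<integral>\<^sup>+s. \<integral>\<^sup>+a. ennreal (C * \<eta> powr (p - 2)) * ennreal \<eta> * tail_int\<^sup>2 * (indicator {0..t} s * tail_weight a) \<partial>lborel \<partial>lborel)"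
  proof -
    have "(\<lambda>z. \<integral>\<^sup>+z'. near_bound t C \<eta> (z, z') \<partial>plane) \<in> borel_measurable plane" by measurable
    from lborel.nn_integral_fst[OF this]
    show ?thesis unfolding nn_integral_plane_pair[OF near_bound_measurable] by (simp add: inner)
  qed
  also have "\<dots> = ennreal (C * \<eta> powr (p - 2)) * ennreal \<eta> * tail_int\<^sup>2 * (ennreal t * tail_int)"
    using assms by (simp add: nn_integral_cmult nn_integral_multc T)
  also have "\<dots> = (ennreal (C * \<eta> powr (p - 2)) * ennreal \<eta> * ennreal t) * tail_int ^ 3"
    by (simp add: power2_eq_square power3_eq_cube mult_ac)
  also have "ennreal (C * \<eta> powr (p - 2)) * ennreal \<eta> * ennreal t = ennreal (C * t * \<eta> powr (p - 1))"
  proof -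
    have "\<eta> powr (p - 2) * \<eta> = \<eta> powr (p - 1)" using assms powr_add[of \<eta> "p - 2" 1] by simp
    then have "C * \<eta> powr (p - 2) * \<eta> * t = C * t * \<eta> powr (p - 1)" by (simp add: mult_ac)
    then show ?thesis using assms by (simp flip: ennreal_mult)
  qed
  finally show ?thesis .
qed

end

section \<open>The limit of the second moment\<close>

context planar_fbm
begin

lemma kern_measurable:
  assumes "0 < \<epsilon>" "0 \<le> s" "0 \<le> r" shows "kern \<epsilon> s r \<in> borel_measurable M"
proof -
  have [measurable]: "inc 1 s r \<in> borel_measurable M" "inc 2 s r \<in> borel_measurable M"
    using assms by (auto intro!: component.span_measurable[OF inc_span])
  show ?thesis unfolding kern_eq[OF assms(1), abs_def] by measurable
qed

text \<open>The exponent is 2 (2p - 1) - 3p = p - 2, from the two scaling factors and eps^3. The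
  value 0 on pairs of equal times concerns a null set only.\<close>

definition cov_kernel :: "real \<Rightarrow> real \<Rightarrow> (real \<times> real) \<times> (real \<times> real) \<Rightarrow> real" where
  "cov_kernel t \<eta> x = (if fst x \<in> time_domain t \<eta> \<and> snd x \<in> time_domain t \<eta> \<and> fst (snd x) \<noteq> fst (fst x)
     then \<eta> powr (p - 2) * (inc_cov (snd (fst x)) (snd (snd x)) ((fst (snd x) - fst (fst x)) / \<eta>)
       / (inc_det (snd (fst x)) (snd (snd x)) ((fst (snd x) - fst (fst x)) / \<eta>))\<^sup>2) / (4 * pi\<^sup>2)
     else 0)"

lemma cov_kernel_measurable [measurable]: "cov_kernel t \<eta> \<in> borel_measurable (plane \<Otimes>\<^sub>M plane)"
  unfolding cov_kernel_def inc_det_def inc_cov_def by measurable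

lemma cov_kernel_nonneg: "0 \<le> cov_kernel t \<eta> x"
  by (auto simp: cov_kernel_def time_domain_def intro!: divide_nonneg_nonneg mult_nonneg_nonneg inc_cov_nonneg)

lemma expectation_scaled_kern_product:
  assumes "0 < \<eta>" "fst z' \<noteq> fst z"
  shows "expectation (\<lambda>\<omega>. scaled_kern t \<eta> z \<omega> * scaled_kern t \<eta> z' \<omega>) = cov_kernel t \<eta> (z, z')"
proof (cases "z \<in> time_domain t \<eta> \<and> z' \<in> time_domain t \<eta>")
  case True
  obtain s a s' b where z: "z = (s, a)" "z' = (s', b)" by (cases z, cases z') auto
  have d: "0 \<le> s" "0 < a" "\<eta> * a \<le> s" "0 \<le> s'" "0 < b" "\<eta> * b \<le> s'" using True by (auto simp: time_domain_def z)
  let ?e = "\<eta> powr p" and ?y = "(s' - s) / \<eta>"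
  have e: "0 < ?e" using assms by simp
  have r: "0 \<le> s - \<eta> * a" "0 \<le> s' - \<eta> * b" using d by auto
  have "expectation (\<lambda>\<omega>. scaled_kern t \<eta> z \<omega> * scaled_kern t \<eta> z' \<omega>)
    = expectation (\<lambda>\<omega>. (\<eta> powr (2 * p - 1))\<^sup>2 * (rkern ?e s (s - \<eta> * a) \<omega> * rkern ?e s' (s' - \<eta> * b) \<omega>))"
    using True by (simp add: scaled_kern_def z power2_eq_square mult_ac)
  also have "\<dots> = (\<eta> powr (2 * p - 1))\<^sup>2 * expectation (\<lambda>\<omega>. rkern ?e s (s - \<eta> * a) \<omega> * rkern ?e s' (s' - \<eta> * b) \<omega>)"
    by (rule integral_mult_right_zero)
  also have "expectation (\<lambda>\<omega>. rkern ?e s (s - \<eta> * a) \<omega> * rkern ?e s' (s' - \<eta> * b) \<omega>)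
    = expectation (\<lambda>\<omega>. kern ?e s (s - \<eta> * a) \<omega> * kern ?e s' (s' - \<eta> * b) \<omega>)"
  proof (rule integral_cong_AE)
    show "(\<lambda>\<omega>. rkern ?e s (s - \<eta> * a) \<omega> * rkern ?e s' (s' - \<eta> * b) \<omega>) \<in> borel_measurable M" by measurable
    show "(\<lambda>\<omega>. kern ?e s (s - \<eta> * a) \<omega> * kern ?e s' (s' - \<eta> * b) \<omega>) \<in> borel_measurable M"
      by (intro borel_measurable_times kern_measurable e d r)
    show "AE \<omega> in M. rkern ?e s (s - \<eta> * a) \<omega> * rkern ?e s' (s' - \<eta> * b) \<omega> = kern ?e s (s - \<eta> * a) \<omega> * kern ?e s' (s' - \<eta> * b) \<omega>"
      using AE_rkern_eq_kern[OF e d(1) r(1)] AE_rkern_eq_kern[OF e d(4) r(2)] by eventually_elim simp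
  qed
  also have "\<dots> = inc_cov a b ?y / (4 * pi\<^sup>2 * ?e ^ 3 * (inc_det a b ?y)\<^sup>2)"
    by (rule expectation_kern_mult_kern) (use assms d in auto)
  also have "(\<eta> powr (2 * p - 1))\<^sup>2 * \<dots> = (\<eta> powr (2 * p - 1))\<^sup>2 / ?e ^ 3 * (inc_cov a b ?y / (inc_det a b ?y)\<^sup>2) / (4 * pi\<^sup>2)"
    by simp
  also have "(\<eta> powr (2 * p - 1))\<^sup>2 / ?e ^ 3 = \<eta> powr (p - 2)"
  proof -
    have "(\<eta> powr (2 * p - 1))\<^sup>2 = \<eta> powr (p - 2) * ?e ^ 3"
      using assms by (simp add: power2_eq_square power3_eq_cube flip: powr_add)
    then show ?thesis using e by simp
  qed
  finally show ?thesis using True assms by (simp add: cov_kernel_def z)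
next
  case False
  then have "scaled_kern t \<eta> z \<omega> * scaled_kern t \<eta> z' \<omega> = 0" for \<omega> by (auto simp: scaled_kern_def)
  then have "expectation (\<lambda>\<omega>. scaled_kern t \<eta> z \<omega> * scaled_kern t \<eta> z' \<omega>) = 0" by (simp only:) simp
  then show ?thesis using False by (auto simp: cov_kernel_def)
qed

text \<open>Positive correlation makes the integrand nonnegative, so that the estimates below can
  use extended nonnegative integrals.\<close>

lemma expectation_scaled_DSLT_square_eq:
  assumes "0 < \<eta>" "0 < t"
  shows "ennreal (expectation (\<lambda>\<omega>. (scaled_DSLT t \<eta> \<omega>)\<^sup>2)) = (\<integral>\<^sup>+x. ennreal (cov_kernel t \<eta> x) \<partial>(plane \<Otimes>\<^sub>M plane))"
proof -
  let ?E = "\<lambda>z z'. expectation (\<lambda>\<omega>. scaled_kern t \<eta> z \<omega> * scaled_kern t \<eta> z' \<omega>)"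
  note V = expectation_scaled_DSLT_square[OF assms]
  have eq: "AE z' in plane. ?E z z' = cov_kernel t \<eta> (z, z')" for z
    using AE_plane_fst_neq[of "fst z"] by eventually_elim (rule expectation_scaled_kern_product[OF assms(1)])
  have nn: "AE z' in plane. 0 \<le> ?E z z'" for z
    using eq[of z] by eventually_elim (simp add: cov_kernel_nonneg)
  have "(\<integral>\<^sup>+x. ennreal (cov_kernel t \<eta> x) \<partial>(plane \<Otimes>\<^sub>M plane)) = (\<integral>\<^sup>+z. \<integral>\<^sup>+z'. ennreal (cov_kernel t \<eta> (z, z')) \<partial>plane \<partial>plane)"
    by (rule nn_integral_plane_pair) measurable
  also have "\<dots> = (\<integral>\<^sup>+z. \<integral>\<^sup>+z'. ennreal (?E z z') \<partial>plane \<partial>plane)"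
  proof (rule nn_integral_cong, rule nn_integral_cong_AE)
    fix z show "AE z' in plane. ennreal (cov_kernel t \<eta> (z, z')) = ennreal (?E z z')"
      using eq[of z] by eventually_elim simp
  qed
  also have "\<dots> = (\<integral>\<^sup>+z. ennreal (\<integral>z'. ?E z z' \<partial>plane) \<partial>plane)"
    by (intro nn_integral_cong nn_integral_eq_integral V(2) nn)
  also have "\<dots> = ennreal (\<integral>z. \<integral>z'. ?E z z' \<partial>plane \<partial>plane)"
    by (intro nn_integral_eq_integral V(3) AE_I2 integral_nonneg_AE nn)
  finally show ?thesis unfolding V(1) ..
qed

text \<open>The minimum is the part dominated independently of eta, to which dominated convergence
  applies; the excess is at most \<open>near_bound\<close>, whose integral vanishes in the
  limit.\<close>

lemma cov_kernel_le:
  obtains C where "0 < C"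
    "\<And>t \<eta> x. 0 < \<eta> \<Longrightarrow> ennreal (cov_kernel t \<eta> x) \<le> min (ennreal (cov_kernel t \<eta> x)) (far_bound t C x) + near_bound t C \<eta> x"
proof -
  obtain C where C: "0 < C"
    "\<And>a b y. \<lbrakk>0 < a; 0 < b; y \<noteq> 0\<rbrakk> \<Longrightarrow> inc_cov a b y / (inc_det a b y)\<^sup>2
      \<le> C * (a * b * \<bar>y\<bar> powr (p - 2) / ((1 + a powr p)\<^sup>2 * (1 + b powr p)\<^sup>2))
        + C * (a powr p / ((1 + a powr p)\<^sup>2 * ((1 + \<bar>y\<bar> powr p) * (1 + \<bar>y + a - b\<bar> powr p))))"
    using inc_cov_det_bound by blast
  have "ennreal (cov_kernel t \<eta> x) \<le> far_bound t C x + near_bound t C \<eta> x" if \<eta>: "0 < \<eta>" for t \<eta> x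
  proof (cases "fst x \<in> time_domain t \<eta> \<and> snd x \<in> time_domain t \<eta> \<and> fst (snd x) \<noteq> fst (fst x)")
    case True
    obtain s a s' b where x: "x = ((s, a), (s', b))" by (metis surj_pair)
    have d: "s \<in> {0..t}" "0 < a" "s' \<in> {0..t}" "0 < b" "s' \<noteq> s" using True by (auto simp: time_domain_def x)
    define y where "y = (s' - s) / \<eta>"
    have y: "y \<noteq> 0" using d \<eta> by (simp add: y_def)
    define u v where "u = C * (\<bar>s' - s\<bar> powr (p - 2) * (a / (1 + a powr p)\<^sup>2) * (b / (1 + b powr p)\<^sup>2))"
      and "v = C * \<eta> powr (p - 2) * (1 / (1 + \<bar>a\<bar> powr p) * (1 / (1 + \<bar>y\<bar> powr p) * (1 / (1 + \<bar>b - (y + a)\<bar> powr p))))"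
    have u: "\<eta> powr (p - 2) * (C * (a * b * \<bar>y\<bar> powr (p - 2) / ((1 + a powr p)\<^sup>2 * (1 + b powr p)\<^sup>2))) = u"
    proof -
      have "\<eta> powr (p - 2) * \<bar>y\<bar> powr (p - 2) = \<bar>s' - s\<bar> powr (p - 2)"
        using \<eta> by (simp add: y_def powr_divide)
      moreover have "h * (C * (a * b * z / (q * q'))) = C * (h * z * (a / q) * (b / q'))" for h z q q' :: real
        by (simp add: mult_ac)
      ultimately show ?thesis unfolding u_def by (simp only:)
    qed
    have v: "\<eta> powr (p - 2) * (C * (a powr p / ((1 + a powr p)\<^sup>2 * ((1 + \<bar>y\<bar> powr p) * (1 + \<bar>y + a - b\<bar> powr p))))) \<le> v"
    proof -
      have "a powr p / (1 + a powr p)\<^sup>2 \<le> (1 + a powr p) / (1 + a powr p)\<^sup>2"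
        by (intro divide_right_mono) auto
      also have "\<dots> = 1 / (1 + \<bar>a\<bar> powr p)"
        using d add_pos_nonneg[of 1 "a powr p"] by (simp add: power2_eq_square)
      finally have "a powr p / (1 + a powr p)\<^sup>2 \<le> 1 / (1 + \<bar>a\<bar> powr p)" .
      then have "C * \<eta> powr (p - 2) * (a powr p / (1 + a powr p)\<^sup>2 * (1 / (1 + \<bar>y\<bar> powr p) * (1 / (1 + \<bar>y + a - b\<bar> powr p))))
        \<le> C * \<eta> powr (p - 2) * (1 / (1 + \<bar>a\<bar> powr p) * (1 / (1 + \<bar>y\<bar> powr p) * (1 / (1 + \<bar>y + a - b\<bar> powr p))))"
        using C(1) by (intro mult_left_mono mult_right_mono mult_nonneg_nonneg divide_nonneg_nonneg add_nonneg_nonneg) auto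
      moreover have "\<bar>b - (y + a)\<bar> = \<bar>y + a - b\<bar>" by (simp add: abs_minus_commute)
      ultimately show ?thesis unfolding v_def by (simp add: mult_ac)
    qed
    have "cov_kernel t \<eta> x = \<eta> powr (p - 2) * (inc_cov a b y / (inc_det a b y)\<^sup>2) / (4 * pi\<^sup>2)"
      using True by (simp add: cov_kernel_def x y_def)
    also have "\<dots> \<le> \<eta> powr (p - 2) * (inc_cov a b y / (inc_det a b y)\<^sup>2) / 1"
    proof (intro divide_left_mono)
      have "1 * 1 \<le> 4 * pi\<^sup>2" using pi_ge_two by (intro mult_mono one_le_power) auto
      then show "1 \<le> 4 * pi\<^sup>2" by simp
    qed (use d inc_cov_nonneg[of a b y] in auto)
    also have "\<dots> \<le> u + v"
      using mult_left_mono[OF C(2)[OF d(2,4) y], of "\<eta> powr (p - 2)"] u v by (simp add: distrib_left)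
    finally have "cov_kernel t \<eta> x \<le> u + v" .
    moreover have "0 \<le> u" "0 \<le> v" using C(1) d by (auto simp: u_def v_def)
    moreover have "far_bound t C x = ennreal u"
      unfolding x u_def using d C(1) by (intro far_bound_eq) auto
    moreover have "near_bound t C \<eta> x = ennreal v"
      unfolding x v_def y_def using d C(1) by (intro near_bound_eq) auto
    ultimately show ?thesis by (simp flip: ennreal_plus)
  next
    case False
    show ?thesis unfolding cov_kernel_def if_not_P[OF False] by simp
  qed
  then show ?thesis using C(1) by (intro that[of C]) (auto simp: min_def add_increasing2)
qed

definition cov_limit :: "real \<Rightarrow> (real \<times> real) \<times> (real \<times> real) \<Rightarrow> real" where
  "cov_limit t x = (case x of ((s, a), (s', b)) \<Rightarrow>
     if 0 < s \<and> s \<le> t \<and> 0 < s' \<and> s' \<le> t \<and> 0 < a \<and> 0 < b \<and> s' \<noteq> s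
     then a * b * (p * (p - 1) / 2) * \<bar>s' - s\<bar> powr (p - 2) / ((1 + a powr p) * (1 + b powr p))\<^sup>2 / (4 * pi\<^sup>2) else 0)"

lemma cov_kernel_tendsto:
  assumes \<eta>: "\<And>n. 0 < \<eta> n" "\<eta> \<longlonglongrightarrow> 0"
  shows "(\<lambda>n. cov_kernel t (\<eta> n) x) \<longlonglongrightarrow> cov_limit t x"
proof -
  obtain s a s' b where x: "x = ((s, a), (s', b))" by (metis surj_pair)
  show ?thesis
  proof (cases "0 < s \<and> s \<le> t \<and> 0 < s' \<and> s' \<le> t \<and> 0 < a \<and> 0 < b \<and> s' \<noteq> s")
    case True
    then have z: "s' - s \<noteq> 0" and ab: "0 < a" "0 < b" by auto
    let ?y = "\<lambda>n. (s' - s) / \<eta> n"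
    have l: "(\<lambda>n. \<eta> n * a) \<longlonglongrightarrow> 0" "(\<lambda>n. \<eta> n * b) \<longlonglongrightarrow> 0"
      using \<eta>(2) by (auto intro!: tendsto_eq_intros)
    have ev: "\<forall>\<^sub>F n in sequentially. \<eta> n * a < s" "\<forall>\<^sub>F n in sequentially. \<eta> n * b < s'"
      using order_tendstoD(2)[OF l(1)] order_tendstoD(2)[OF l(2)] True by auto
    note lim = inc_cov_scaling_limit[OF ab z \<eta>]
    \<comment> \<open>Removing the scaling by eta^(2-p), which tends to 0 as p < 2, shows that the
      covariance itself vanishes; D then tends to the product of its diagonal entries.\<close>
    have "(\<lambda>n. \<eta> n powr (2 - p) * (\<eta> n powr (p - 2) * inc_cov a b (?y n))) \<longlonglongrightarrow> 0 powr (2 - p) * (a * b * (p * (p - 1) / 2) * \<bar>s' - s\<bar> powr (p - 2))"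
      using p_lt_2 \<eta> by (intro tendsto_mult lim tendsto_powr2) (auto intro: always_eventually less_imp_le)
    moreover have "\<eta> n powr (2 - p) * (\<eta> n powr (p - 2) * inc_cov a b (?y n)) = inc_cov a b (?y n)" for n
    proof -
      have "\<eta> n powr (2 - p) * \<eta> n powr (p - 2) = 1" using \<eta>(1)[of n] by (simp flip: powr_add)
      then show ?thesis by (simp only: mult.assoc[symmetric] mult_1)
    qed
    ultimately have "(\<lambda>n. inc_cov a b (?y n)) \<longlonglongrightarrow> 0" using p_lt_2 by simp
    then have D: "(\<lambda>n. inc_det a b (?y n)) \<longlonglongrightarrow> (1 + a powr p) * (1 + b powr p)"
      unfolding inc_det_def by (auto intro!: tendsto_eq_intros)
    have D0: "((1 + a powr p) * (1 + b powr p))\<^sup>2 \<noteq> 0"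
      using add_pos_nonneg[of 1 "a powr p"] add_pos_nonneg[of 1 "b powr p"] by simp
    have "(\<lambda>n. \<eta> n powr (p - 2) * inc_cov a b (?y n) / (inc_det a b (?y n))\<^sup>2 / (4 * pi\<^sup>2)) \<longlonglongrightarrow> cov_limit t x"
      using True tendsto_divide[OF tendsto_divide[OF lim tendsto_power[OF D] D0] tendsto_const[of "4 * pi\<^sup>2"]]
      by (simp add: cov_limit_def x)
    moreover have "\<forall>\<^sub>F n in sequentially. \<eta> n powr (p - 2) * inc_cov a b (?y n) / (inc_det a b (?y n))\<^sup>2 / (4 * pi\<^sup>2) = cov_kernel t (\<eta> n) x"
      using ev by eventually_elim (use True in \<open>auto simp: cov_kernel_def x time_domain_def\<close>)
    ultimately show ?thesis by (rule Lim_transform_eventually)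
  next
    case False
    have "cov_kernel t (\<eta> n) x = 0" for n
    proof -
      have "0 < s" if "0 < a" "\<eta> n * a \<le> s" for s a using mult_pos_pos[OF \<eta>(1)[of n] that(1)] that(2) by linarith
      then show ?thesis using False by (auto simp: cov_kernel_def x time_domain_def)
    qed
    moreover have "cov_limit t x = 0" using False by (auto simp: cov_limit_def x)
    ultimately show ?thesis by simp
  qed
qed

text \<open>With this constant the bound is an equality wherever \<open>cov_limit\<close> is given
  by its formula, so the limiting integral is that of \<open>far_bound\<close>.\<close>

lemma cov_limit_le: "ennreal (cov_limit t x) \<le> far_bound t (p * (p - 1) / (8 * pi\<^sup>2)) x"
proof -
  obtain s a s' b where x: "x = ((s, a), (s', b))" by (metis surj_pair)
  show ?thesis
  proof (cases "0 < s \<and> s \<le> t \<and> 0 < s' \<and> s' \<le> t \<and> 0 < a \<and> 0 < b \<and> s' \<noteq> s")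
    case True
    have "cov_limit t x = p * (p - 1) / (8 * pi\<^sup>2) * (\<bar>s' - s\<bar> powr (p - 2) * (a / (1 + a powr p)\<^sup>2) * (b / (1 + b powr p)\<^sup>2))"
      using True by (simp add: cov_limit_def x power_mult_distrib mult_ac)
    then show ?thesis
      using True p_gt_1 far_bound_eq[of s t s' a b "p * (p - 1) / (8 * pi\<^sup>2)"] by (simp add: x)
  next
    case False
    then have "cov_limit t x = 0" by (auto simp: cov_limit_def x)
    then show ?thesis by simp
  qed
qed

definition limit_var :: "real \<Rightarrow> real" where
  "limit_var t = (beta_int / (2 * pi))\<^sup>2 * t powr p"

text \<open>An upper bound suffices, since the mean square distance to the candidate limit is
  nonnegative.\<close>

lemma eventually_scaled_DSLT_square_le:
  assumes t: "0 < t" and \<eta>: "\<And>n. 0 < \<eta> n" "\<eta> \<longlonglongrightarrow> 0" and e: "0 < e"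
  shows "\<forall>\<^sub>F n in sequentially. expectation (\<lambda>\<omega>. (scaled_DSLT t (\<eta> n) \<omega>)\<^sup>2) \<le> limit_var t + e"
proof -
  let ?Q = "plane \<Otimes>\<^sub>M plane"
  obtain C where C: "0 < C"
    "\<And>t \<eta> x. 0 < \<eta> \<Longrightarrow> ennreal (cov_kernel t \<eta> x) \<le> min (ennreal (cov_kernel t \<eta> x)) (far_bound t C x) + near_bound t C \<eta> x"
    using cov_kernel_le by blast
  let ?c = "\<lambda>n x. min (ennreal (cov_kernel t (\<eta> n) x)) (far_bound t C x)"
  have lm: "cov_limit t \<in> borel_measurable ?Q"
    unfolding cov_limit_def case_prod_beta' by measurable
  have 1: "(\<lambda>n. \<integral>\<^sup>+x. ?c n x \<partial>?Q) \<longlonglongrightarrow> (\<integral>\<^sup>+x. min (ennreal (cov_limit t x)) (far_bound t C x) \<partial>?Q)"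
  proof (rule nn_integral_dominated_convergence[where w = "far_bound t C"])
    show "(\<integral>\<^sup>+x. far_bound t C x \<partial>?Q) < \<infinity>"
      using C(1) by (simp add: nn_integral_far_bound[OF _ t])
    show "AE x in ?Q. (\<lambda>n. ?c n x) \<longlonglongrightarrow> min (ennreal (cov_limit t x)) (far_bound t C x)"
      by (intro AE_I2 tendsto_min tendsto_const tendsto_ennrealI cov_kernel_tendsto \<eta>)
  qed (use lm in auto)
  have "(\<lambda>n. tail_int ^ 3 * ennreal (C * t * \<eta> n powr (p - 1))) \<longlonglongrightarrow> tail_int ^ 3 * ennreal (C * t * 0 powr (p - 1))"
  proof (intro ennreal_tendsto_cmult tendsto_ennrealI tendsto_mult tendsto_const tendsto_powr2)
    show "tail_int ^ 3 < \<top>" using tail_int_finite by (simp add: power3_eq_cube ennreal_mult_less_top)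
  qed (use \<eta> p_gt_1 in \<open>auto intro: always_eventually less_imp_le\<close>)
  then have 2: "(\<lambda>n. \<integral>\<^sup>+x. near_bound t C (\<eta> n) x \<partial>?Q) \<longlonglongrightarrow> 0"
    using C(1) \<eta>(1) by (simp add: nn_integral_near_bound[OF _ t] mult.commute)
  \<comment> \<open>The constant \<open>C\<close> may lie below that of \<open>cov_limit_le\<close>,
    so the truncated limit is only bounded above; this is all that is claimed.\<close>
  have le: "(\<integral>\<^sup>+x. min (ennreal (cov_limit t x)) (far_bound t C x) \<partial>?Q) \<le> ennreal (limit_var t)"
  proof -
    have "(\<integral>\<^sup>+x. min (ennreal (cov_limit t x)) (far_bound t C x) \<partial>?Q) \<le> (\<integral>\<^sup>+x. far_bound t (p * (p - 1) / (8 * pi\<^sup>2)) x \<partial>?Q)"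
      by (intro nn_integral_mono min.coboundedI1 cov_limit_le)
    also have "\<dots> = ennreal (p * (p - 1) / (8 * pi\<^sup>2) * beta_int\<^sup>2 * (2 * t powr p / (p * (p - 1))))"
      using p_gt_1 by (intro nn_integral_far_bound t) auto
    also have "p * (p - 1) / (8 * pi\<^sup>2) * beta_int\<^sup>2 * (2 * t powr p / (p * (p - 1))) = limit_var t"
      using p_gt_1 by (simp add: limit_var_def power_divide power_mult_distrib)
    finally show ?thesis .
  qed
  have "0 \<le> limit_var t" by (simp add: limit_var_def)
  with e le have "(\<integral>\<^sup>+x. min (ennreal (cov_limit t x)) (far_bound t C x) \<partial>?Q) + 0 < ennreal (limit_var t + e)"
    unfolding add_0_right by (intro order_le_less_trans[OF le] ennreal_lessI) auto
  from order_tendstoD(2)[OF tendsto_add[OF 1 2] this]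
  show ?thesis
  proof eventually_elim
    case (elim n)
    have "ennreal (expectation (\<lambda>\<omega>. (scaled_DSLT t (\<eta> n) \<omega>)\<^sup>2)) = (\<integral>\<^sup>+x. ennreal (cov_kernel t (\<eta> n) x) \<partial>?Q)"
      by (rule expectation_scaled_DSLT_square_eq[OF \<eta>(1) t])
    also have "\<dots> \<le> (\<integral>\<^sup>+x. ?c n x + near_bound t C (\<eta> n) x \<partial>?Q)"
      by (intro nn_integral_mono C(2) \<eta>)
    also have "\<dots> = (\<integral>\<^sup>+x. ?c n x \<partial>?Q) + (\<integral>\<^sup>+x. near_bound t C (\<eta> n) x \<partial>?Q)"
      by (rule nn_integral_add) measurable
    also have "\<dots> \<le> ennreal (limit_var t + e)" using elim by (rule less_imp_le)
    finally have "ennreal (expectation (\<lambda>\<omega>. (scaled_DSLT t (\<eta> n) \<omega>)\<^sup>2)) \<le> ennreal (limit_var t + e)" .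
    then show ?case using \<open>0 \<le> limit_var t\<close> e by (subst (asm) ennreal_le_iff) auto
  qed
qed

end

section \<open>The cross moment with the terminal value\<close>

context planar_fbm
begin

text \<open>Minus the cross moment of a rescaled kernel with B_t. Half of the numerator is the
  covariance of the increment with B_t; 4 pi combines this half with 2 pi, and eta^(2p-1) / eps^2
  leaves 1 / eta.\<close>

definition mean_kernel :: "real \<Rightarrow> real \<Rightarrow> real \<times> real \<Rightarrow> real" where
  "mean_kernel t \<eta> z = (if z \<in> time_domain t \<eta>
     then (\<bar>fst z\<bar> powr p - \<bar>fst z - \<eta> * snd z\<bar> powr p + \<bar>t - fst z + \<eta> * snd z\<bar> powr p - \<bar>t - fst z\<bar> powr p) / \<eta>
       / (4 * pi * (1 + snd z powr p)\<^sup>2) else 0)"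

lemma mean_kernel_measurable [measurable]: "mean_kernel t \<eta> \<in> borel_measurable plane"
  unfolding mean_kernel_def by measurable

lemma abs_powr_diff:
  assumes "0 \<le> u" "u < v" "v \<le> t"
  shows "0 \<le> \<bar>v\<bar> powr p - \<bar>u\<bar> powr p" "\<bar>v\<bar> powr p - \<bar>u\<bar> powr p \<le> (v - u) * (p * t powr (p - 1))"
proof -
  obtain x where x: "u < x" "x < v" "\<bar>v\<bar> powr p - \<bar>u\<bar> powr p = (v - u) * (p * (spow x))"
    using MVT2[OF assms(2), of "\<lambda>x. \<bar>x\<bar> powr p" "\<lambda>x. p * (spow x)"] DERIV_abs_powr by blast
  have "0 < x" using x assms by linarith
  then have eq: "\<bar>v\<bar> powr p - \<bar>u\<bar> powr p = (v - u) * (p * x powr (p - 1))" using x(3) by simp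
  show "0 \<le> \<bar>v\<bar> powr p - \<bar>u\<bar> powr p" unfolding eq using assms p_gt_1 by (intro mult_nonneg_nonneg) auto
  have "x powr (p - 1) \<le> t powr (p - 1)" using \<open>0 < x\<close> x assms p_gt_1 by (intro powr_mono2) auto
  then show "\<bar>v\<bar> powr p - \<bar>u\<bar> powr p \<le> (v - u) * (p * t powr (p - 1))"
    unfolding eq using assms p_gt_1 by (intro mult_left_mono) auto
qed

text \<open>Each of the two differences of p-th powers is at most eta a p t^(p-1), which cancels 1 /
  eta and gives a dominating function independent of eta.\<close>

lemma mean_kernel_bounds:
  assumes "0 < \<eta>" "0 < t"
  shows "0 \<le> mean_kernel t \<eta> z"
    and "ennreal (mean_kernel t \<eta> z) \<le> ennreal (p * t powr (p - 1)) * (indicator {0..t} (fst z) * size_weight (snd z))"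
proof -
  have *: "0 \<le> mean_kernel t \<eta> z \<and> ennreal (mean_kernel t \<eta> z) \<le> ennreal (p * t powr (p - 1)) * (indicator {0..t} (fst z) * size_weight (snd z))"
  proof (cases "z \<in> time_domain t \<eta>")
    case True
    obtain s a where z: "z = (s, a)" by (cases z)
    have d: "0 \<le> s" "s \<le> t" "0 < a" "\<eta> * a \<le> s" using True by (auto simp: time_domain_def z)
    have ea: "0 < \<eta> * a" using assms d by simp
    let ?K = "\<bar>s\<bar> powr p - \<bar>s - \<eta> * a\<bar> powr p + \<bar>t - s + \<eta> * a\<bar> powr p - \<bar>t - s\<bar> powr p"
    have 1: "0 \<le> \<bar>s\<bar> powr p - \<bar>s - \<eta> * a\<bar> powr p" "\<bar>s\<bar> powr p - \<bar>s - \<eta> * a\<bar> powr p \<le> \<eta> * a * (p * t powr (p - 1))"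
      using abs_powr_diff[of "s - \<eta> * a" s t] d ea by auto
    have 2: "0 \<le> \<bar>t - s + \<eta> * a\<bar> powr p - \<bar>t - s\<bar> powr p" "\<bar>t - s + \<eta> * a\<bar> powr p - \<bar>t - s\<bar> powr p \<le> \<eta> * a * (p * t powr (p - 1))"
      using abs_powr_diff[of "t - s" "t - s + \<eta> * a" t] d ea by auto
    have l: "0 < 1 + a powr p" by (simp add: add_pos_nonneg)
    have eq: "mean_kernel t \<eta> z = ?K / \<eta> / (4 * pi * (1 + a powr p)\<^sup>2)" using True by (simp add: mean_kernel_def z)
    have nn: "0 \<le> mean_kernel t \<eta> z" unfolding eq using 1 2 assms by (intro divide_nonneg_nonneg) auto
    have "?K / \<eta> \<le> (2 * (\<eta> * a * (p * t powr (p - 1)))) / \<eta>" using 1 2 assms by (intro divide_right_mono) auto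
    also have "\<dots> = 2 * (a * (p * t powr (p - 1)))" using assms by simp
    finally have "mean_kernel t \<eta> z \<le> 2 * (a * (p * t powr (p - 1))) / (4 * pi * (1 + a powr p)\<^sup>2)"
      unfolding eq by (intro divide_right_mono) auto
    also have "\<dots> \<le> 2 * (a * (p * t powr (p - 1))) / (2 * (1 + a powr p)\<^sup>2)"
    proof (rule divide_left_mono)
      show "2 * (1 + a powr p)\<^sup>2 \<le> 4 * pi * (1 + a powr p)\<^sup>2" using pi_ge_two by (intro mult_right_mono) auto
    qed (use d p_gt_1 l in auto)
    also have "\<dots> = p * t powr (p - 1) * (a / (1 + a powr p)\<^sup>2)" by simp
    finally have "ennreal (mean_kernel t \<eta> z) \<le> ennreal (p * t powr (p - 1) * (a / (1 + a powr p)\<^sup>2))"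
      by (rule ennreal_leI)
    also have "\<dots> = ennreal (p * t powr (p - 1)) * ennreal (a / (1 + a powr p)\<^sup>2)"
      using p_gt_1 by (intro ennreal_mult') auto
    also have "\<dots> = ennreal (p * t powr (p - 1)) * (indicator {0..t} (fst z) * size_weight (snd z))"
      using d by (simp add: z size_weight_def)
    finally show ?thesis using nn by blast
  qed (simp add: mean_kernel_def)
  show "0 \<le> mean_kernel t \<eta> z"
    "ennreal (mean_kernel t \<eta> z) \<le> ennreal (p * t powr (p - 1)) * (indicator {0..t} (fst z) * size_weight (snd z))"
    using * by auto
qed

lemma expectation_scaled_kern_mult_X:
  assumes "0 < \<eta>" "0 < t"
  shows "expectation (\<lambda>\<omega>. scaled_kern t \<eta> z \<omega> * X 1 t \<omega>) = - mean_kernel t \<eta> z"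
proof (cases "z \<in> time_domain t \<eta>")
  case True
  obtain s a where z: "z = (s, a)" by (cases z)
  have d: "0 \<le> s" "s \<le> t" "0 < a" "\<eta> * a \<le> s" using True by (auto simp: time_domain_def z)
  let ?e = "\<eta> powr p" and ?K = "\<bar>s\<bar> powr p - \<bar>s - \<eta> * a\<bar> powr p + \<bar>t - s + \<eta> * a\<bar> powr p - \<bar>t - s\<bar> powr p"
  have e: "0 < ?e" using assms by simp
  have r: "0 \<le> s - \<eta> * a" using d by auto
  have [measurable]: "X 1 t \<in> borel_measurable M" using assms by (intro X_measurable) auto
  have "expectation (\<lambda>\<omega>. scaled_kern t \<eta> z \<omega> * X 1 t \<omega>) = \<eta> powr (2 * p - 1) * expectation (\<lambda>\<omega>. rkern ?e s (s - \<eta> * a) \<omega> * X 1 t \<omega>)"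
  proof -
    have "scaled_kern t \<eta> z \<omega> * X 1 t \<omega> = \<eta> powr (2 * p - 1) * (rkern ?e s (s - \<eta> * a) \<omega> * X 1 t \<omega>)" for \<omega>
      using True by (simp add: scaled_kern_def z)
    then show ?thesis by (simp only: integral_mult_right_zero)
  qed
  also have "expectation (\<lambda>\<omega>. rkern ?e s (s - \<eta> * a) \<omega> * X 1 t \<omega>) = expectation (\<lambda>\<omega>. kern ?e s (s - \<eta> * a) \<omega> * X 1 t \<omega>)"
  proof (rule integral_cong_AE)
    show "(\<lambda>\<omega>. rkern ?e s (s - \<eta> * a) \<omega> * X 1 t \<omega>) \<in> borel_measurable M" by measurable
    show "(\<lambda>\<omega>. kern ?e s (s - \<eta> * a) \<omega> * X 1 t \<omega>) \<in> borel_measurable M"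
      using kern_measurable[OF e d(1) r] by measurable
    show "AE \<omega> in M. rkern ?e s (s - \<eta> * a) \<omega> * X 1 t \<omega> = kern ?e s (s - \<eta> * a) \<omega> * X 1 t \<omega>"
      using AE_rkern_eq_kern[OF e d(1) r] by eventually_elim simp
  qed
  also have "\<dots> = - expectation (\<lambda>\<omega>. inc 1 s (s - \<eta> * a) \<omega> * X 1 t \<omega>) / (2 * pi * ?e\<^sup>2 * (1 + a powr p)\<^sup>2)"
    by (rule expectation_kern_mult_X) (use assms d in auto)
  also have "expectation (\<lambda>\<omega>. inc 1 s (s - \<eta> * a) \<omega> * X 1 t \<omega>) = ?K / 2"
  proof -
    have "\<bar>t - (s - \<eta> * a)\<bar> = \<bar>t - s + \<eta> * a\<bar>" by (simp add: algebra_simps)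
    then show ?thesis using covariance_inc_X[OF d(1) r, of t 1] assms d r by (simp only: abs_of_nonneg)
  qed
  also have "\<eta> powr (2 * p - 1) * (- (?K / 2) / (2 * pi * ?e\<^sup>2 * (1 + a powr p)\<^sup>2))
    = - ((\<eta> powr (2 * p - 1) / ?e\<^sup>2) * (?K / (4 * pi * (1 + a powr p)\<^sup>2)))"
    by simp
  also have "\<eta> powr (2 * p - 1) / ?e\<^sup>2 = 1 / \<eta>"
    using assms by (simp add: power2_eq_square powr_diff flip: powr_add)
  finally show ?thesis using True by (simp add: mean_kernel_def z)
next
  case False
  then have "scaled_kern t \<eta> z \<omega> * X 1 t \<omega> = 0" for \<omega> by (simp add: scaled_kern_def)
  then have "expectation (\<lambda>\<omega>. scaled_kern t \<eta> z \<omega> * X 1 t \<omega>) = 0" by (simp only:) simp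
  then show ?thesis using False by (simp add: mean_kernel_def)
qed

lemma X_square:
  assumes "0 < t"
  shows "expectation (\<lambda>\<omega>. (X j t \<omega>)\<^sup>2) = t powr p" "integrable M (\<lambda>\<omega>. (X j t \<omega>)\<^sup>2)" "integrable M (X j t)"
  using covariance[of t t j] assms component.span_square_integrable[OF X_span, of t j]
    component.span_integrable[OF X_span, of t j] p_gt_1 by (auto simp: power2_eq_square)

definition mean_limit :: "real \<Rightarrow> real \<times> real \<Rightarrow> ennreal" where
  "mean_limit t z = ennreal (p / (4 * pi)) *
     ((ennreal (fst z powr (p - 1) + (t - fst z) powr (p - 1)) * indicator {0..t} (fst z)) * size_weight (snd z))"

text \<open>The line s = 0 is excluded: there the domain contains no point with a > 0, so the kernel
  vanishes although \<open>mean_limit\<close> does not.\<close>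

lemma mean_kernel_tendsto:
  assumes t: "0 < t" and \<eta>: "\<And>n. 0 < \<eta> n" "\<eta> \<longlonglongrightarrow> 0" and z0: "fst z \<noteq> 0"
  shows "(\<lambda>n. ennreal (mean_kernel t (\<eta> n) z)) \<longlonglongrightarrow> mean_limit t z"
proof -
  obtain s a where z: "z = (s, a)" by (cases z)
  show ?thesis
  proof (cases "0 < s \<and> s \<le> t \<and> 0 < a")
    case True
    then have s: "0 < s" "s \<le> t" and a: "0 < a" by auto
    have l: "(\<lambda>n. \<eta> n * a) \<longlonglongrightarrow> 0" using \<eta>(2) by (auto intro!: tendsto_eq_intros)
    have ne: "\<forall>\<^sub>F n in sequentially. \<eta> n * a \<noteq> 0" "\<forall>\<^sub>F n in sequentially. - (\<eta> n * a) \<noteq> 0"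
      using \<eta>(1) a by (auto intro!: always_eventually) (metis less_irrefl)+
    have l0: "filterlim (\<lambda>n. \<eta> n * a) (at 0) sequentially" "filterlim (\<lambda>n. - (\<eta> n * a)) (at 0) sequentially"
      using l ne tendsto_minus[OF l] by (auto simp: filterlim_at)
    \<comment> \<open>The numerator splits into difference quotients of |x|^p at s with step -eta a
      and at t - s with step eta a. Differentiability at 0 covers s = t.\<close>
    have d1: "(\<lambda>n. (\<bar>s + - (\<eta> n * a)\<bar> powr p - \<bar>s\<bar> powr p) / - (\<eta> n * a)) \<longlonglongrightarrow> p * (spow s)"
      by (rule filterlim_compose[OF DERIV_abs_powr[of s, unfolded DERIV_def] l0(2)])
    have d2: "(\<lambda>n. (\<bar>t - s + \<eta> n * a\<bar> powr p - \<bar>t - s\<bar> powr p) / (\<eta> n * a)) \<longlonglongrightarrow> p * (spow (t - s))"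
      by (rule filterlim_compose[OF DERIV_abs_powr[of "t - s", unfolded DERIV_def] l0(1)])
    let ?c = "a / (4 * pi * (1 + a powr p)\<^sup>2)"
    let ?L = "?c * (p * s powr (p - 1) + p * (t - s) powr (p - 1))"
    have "(\<lambda>n. ?c * ((\<bar>s + - (\<eta> n * a)\<bar> powr p - \<bar>s\<bar> powr p) / - (\<eta> n * a) + (\<bar>t - s + \<eta> n * a\<bar> powr p - \<bar>t - s\<bar> powr p) / (\<eta> n * a)))
      \<longlonglongrightarrow> ?c * (p * (spow s) + p * (spow (t - s)))"
      by (intro tendsto_mult tendsto_const tendsto_add d1 d2)
    moreover have "p * (spow s) + p * (spow (t - s)) = p * s powr (p - 1) + p * (t - s) powr (p - 1)"
      using s p_gt_1 by (auto simp: sgn_if)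
    moreover have "\<forall>\<^sub>F n in sequentially. ?c * ((\<bar>s + - (\<eta> n * a)\<bar> powr p - \<bar>s\<bar> powr p) / - (\<eta> n * a) + (\<bar>t - s + \<eta> n * a\<bar> powr p - \<bar>t - s\<bar> powr p) / (\<eta> n * a))
      = mean_kernel t (\<eta> n) z"
      using order_tendstoD(2)[OF l s(1)]
    proof eventually_elim
      case (elim n)
      have dm: "z \<in> time_domain t (\<eta> n)" using elim s a by (simp add: time_domain_def z)
      have "a / c * ((u - v) / - (\<eta> n * a) + (w - x) / (\<eta> n * a)) = (v - u + w - x) / \<eta> n / c" for c u v w x :: real
        using a \<eta>(1)[of n] by (simp add: divide_simps)
      then show ?case using dm unfolding mean_kernel_def by (simp only: if_True z fst_conv snd_conv) simp
    qed
    ultimately have "(\<lambda>n. mean_kernel t (\<eta> n) z) \<longlonglongrightarrow> ?L" by (simp add: Lim_transform_eventually)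
    then have "(\<lambda>n. ennreal (mean_kernel t (\<eta> n) z)) \<longlonglongrightarrow> ennreal ?L" by (rule tendsto_ennrealI)
    also have "ennreal ?L = mean_limit t z"
    proof -
      have "ennreal (p / (4 * pi)) * (ennreal u * ennreal v) = ennreal (p / (4 * pi) * (u * v))" if "0 \<le> u" "0 \<le> v" for u v
        using that p_gt_1 by (simp flip: ennreal_mult)
      from this[of "s powr (p - 1) + (t - s) powr (p - 1)" "a / (1 + a powr p)\<^sup>2"]
      have "mean_limit t z = ennreal (p / (4 * pi) * ((s powr (p - 1) + (t - s) powr (p - 1)) * (a / (1 + a powr p)\<^sup>2)))"
        using s a by (simp add: mean_limit_def z size_weight_def)
      also have "p / (4 * pi) * ((s powr (p - 1) + (t - s) powr (p - 1)) * (a / (1 + a powr p)\<^sup>2)) = ?L"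
        by (simp add: distrib_left distrib_right add_divide_distrib mult_ac)
      finally show ?thesis ..
    qed
    finally show ?thesis .
  next
    case False
    have "mean_kernel t (\<eta> n) z = 0" for n
      using False z0 by (auto simp: mean_kernel_def time_domain_def z)
    moreover have "mean_limit t z = 0" using False z0 by (auto simp: mean_limit_def z size_weight_def indicator_def)
    ultimately show ?thesis by simp
  qed
qed

lemma nn_integral_mean_limit:
  assumes "0 < t" shows "(\<integral>\<^sup>+z. mean_limit t z \<partial>plane) = ennreal (beta_int / (2 * pi) * t powr p)"
proof -
  have [measurable]: "mean_limit t \<in> borel_measurable plane" unfolding mean_limit_def by measurable
  have "(\<integral>\<^sup>+z. mean_limit t z \<partial>plane) = (\<integral>\<^sup>+s. \<integral>\<^sup>+a. mean_limit t (s, a) \<partial>lborel \<partial>lborel)"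
    by (rule lborel.nn_integral_fst[symmetric]) measurable
  also have "\<dots> = ennreal (p / (4 * pi)) * (ennreal (2 * t powr p / p) * ennreal beta_int)"
    using nn_integral_powr_sum[OF assms] by (simp add: mean_limit_def nn_integral_cmult nn_integral_multc nn_integral_size_weight)
  also have "\<dots> = ennreal (beta_int / (2 * pi) * t powr p)"
  proof -
    have "ennreal (p / (4 * pi)) * (ennreal u * ennreal v) = ennreal (p / (4 * pi) * (u * v))" if "0 \<le> u" "0 \<le> v" for u v
      using that p_gt_1 by (simp flip: ennreal_mult)
    moreover have "p / (4 * pi) * (2 * t powr p / p * beta_int) = beta_int / (2 * pi) * t powr p" using p_gt_1 by simp
    moreover have "0 \<le> 2 * t powr p / p" using p_gt_1 by simp
    ultimately show ?thesis using beta_int_nonneg by (simp only:)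
  qed
  finally show ?thesis .
qed

lemma expectation_scaled_DSLT_mult_X_tendsto:
  assumes t: "0 < t" and \<eta>: "\<And>n. 0 < \<eta> n" "\<eta> \<longlonglongrightarrow> 0"
  shows "(\<lambda>n. expectation (\<lambda>\<omega>. scaled_DSLT t (\<eta> n) \<omega> * X 1 t \<omega>)) \<longlonglongrightarrow> - (beta_int / (2 * pi) * t powr p)"
proof -
  have eq: "expectation (\<lambda>\<omega>. scaled_DSLT t (\<eta> n) \<omega> * X 1 t \<omega>) = - (\<integral>z. mean_kernel t (\<eta> n) z \<partial>plane)"
    and int: "integrable plane (mean_kernel t (\<eta> n))" for n
    using expectation_scaled_DSLT_mult[OF \<eta>(1)[of n] t X_square(3)[OF t, of 1]]
    unfolding expectation_scaled_kern_mult_X[OF \<eta>(1) t] by auto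
  have "(\<lambda>n. \<integral>\<^sup>+z. ennreal (mean_kernel t (\<eta> n) z) \<partial>plane) \<longlonglongrightarrow> (\<integral>\<^sup>+z. mean_limit t z \<partial>plane)"
  proof (rule nn_integral_dominated_convergence[where w = "\<lambda>z. ennreal (p * t powr (p - 1)) * (indicator {0..t} (fst z) * size_weight (snd z))"])
    show "mean_limit t \<in> borel_measurable plane" unfolding mean_limit_def by measurable
    show "AE z in plane. (\<lambda>n. ennreal (mean_kernel t (\<eta> n) z)) \<longlonglongrightarrow> mean_limit t z"
      using AE_plane_fst_neq[of 0] by eventually_elim (rule mean_kernel_tendsto[OF t \<eta>])
    show "AE z in plane. ennreal (mean_kernel t (\<eta> n) z) \<le> ennreal (p * t powr (p - 1)) * (indicator {0..t} (fst z) * size_weight (snd z))" for n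
      by (intro AE_I2 mean_kernel_bounds(2) \<eta> t)
    have "(\<integral>\<^sup>+z. ennreal (p * t powr (p - 1)) * (indicator {0..t} (fst z) * size_weight (snd z)) \<partial>plane)
      = (\<integral>\<^sup>+s. \<integral>\<^sup>+a. ennreal (p * t powr (p - 1)) * (indicator {0..t} s * size_weight a) \<partial>lborel \<partial>lborel)"
      by (subst lborel.nn_integral_fst[symmetric]) auto
    also have "\<dots> = ennreal (p * t powr (p - 1)) * (ennreal t * ennreal beta_int)"
      using t by (simp add: nn_integral_cmult nn_integral_multc nn_integral_size_weight)
    also have "\<dots> < \<infinity>" by (simp add: ennreal_mult_less_top)
    finally show "(\<integral>\<^sup>+z. ennreal (p * t powr (p - 1)) * (indicator {0..t} (fst z) * size_weight (snd z)) \<partial>plane) < \<infinity>" .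
  qed measurable
  moreover have "(\<integral>\<^sup>+z. ennreal (mean_kernel t (\<eta> n) z) \<partial>plane) = ennreal (\<integral>z. mean_kernel t (\<eta> n) z \<partial>plane)" for n
    by (intro nn_integral_eq_integral int AE_I2 mean_kernel_bounds(1) \<eta> t)
  ultimately have "(\<lambda>n. ennreal (\<integral>z. mean_kernel t (\<eta> n) z \<partial>plane)) \<longlonglongrightarrow> ennreal (beta_int / (2 * pi) * t powr p)"
    by (simp only: nn_integral_mean_limit[OF t])
  then have "(\<lambda>n. \<integral>z. mean_kernel t (\<eta> n) z \<partial>plane) \<longlonglongrightarrow> beta_int / (2 * pi) * t powr p"
  proof (rule tendsto_ennreal_iff[THEN iffD1, rotated 2])
    show "\<forall>\<^sub>F n in sequentially. 0 \<le> (\<integral>z. mean_kernel t (\<eta> n) z \<partial>plane)"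
      by (intro always_eventually allI Bochner_Integration.integral_nonneg mean_kernel_bounds(1) \<eta> t)
    show "0 \<le> beta_int / (2 * pi) * t powr p" using beta_int_nonneg by simp
  qed
  then show ?thesis unfolding eq by (rule tendsto_minus)
qed

section \<open>Mean square convergence\<close>

text \<open>The coefficient is the limiting cross moment divided by E B_t^2 = t^p, that is, the
  projection coefficient onto B_t.\<close>

definition limit_rv :: "real \<Rightarrow> 'a \<Rightarrow> real" where "limit_rv t \<omega> = - (beta_int / (2 * pi)) * X 1 t \<omega>"

lemma scaled_DSLT_minus_limit:
  assumes "0 < \<eta>" "0 < t"
  shows "integrable M (\<lambda>\<omega>. (scaled_DSLT t \<eta> \<omega> - limit_rv t \<omega>)\<^sup>2)"
    and "expectation (\<lambda>\<omega>. (scaled_DSLT t \<eta> \<omega> - limit_rv t \<omega>)\<^sup>2)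
      = expectation (\<lambda>\<omega>. (scaled_DSLT t \<eta> \<omega>)\<^sup>2) + 2 * (beta_int / (2 * pi)) * expectation (\<lambda>\<omega>. scaled_DSLT t \<eta> \<omega> * X 1 t \<omega>) + limit_var t"
proof -
  let ?c = "beta_int / (2 * pi)"
  note [measurable] = scaled_DSLT_measurable[OF assms]
  have [measurable]: "X 1 t \<in> borel_measurable M" using assms by (intro X_measurable) auto
  have iVX: "integrable M (\<lambda>\<omega>. scaled_DSLT t \<eta> \<omega> * X 1 t \<omega>)"
  proof (rule Bochner_Integration.integrable_bound)
    show "integrable M (\<lambda>\<omega>. (scaled_DSLT t \<eta> \<omega>)\<^sup>2 + (X 1 t \<omega>)\<^sup>2)" using scaled_DSLT_integrable_square(1)[OF assms] X_square(2)[OF assms(2)] by auto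
  show "AE \<omega> in M. norm (scaled_DSLT t \<eta> \<omega> * X 1 t \<omega>) \<le> norm ((scaled_DSLT t \<eta> \<omega>)\<^sup>2 + (X 1 t \<omega>)\<^sup>2)"
    using abs_mult_le_sum_squares by (intro AE_I2) simp
  qed measurable
  have eq: "(\<lambda>\<omega>. (scaled_DSLT t \<eta> \<omega> - limit_rv t \<omega>)\<^sup>2) = (\<lambda>\<omega>. (scaled_DSLT t \<eta> \<omega>)\<^sup>2 + 2 * ?c * (scaled_DSLT t \<eta> \<omega> * X 1 t \<omega>) + ?c\<^sup>2 * (X 1 t \<omega>)\<^sup>2)"
  proof -
    have "(v - (- c * x))\<^sup>2 = v\<^sup>2 + 2 * c * (v * x) + c\<^sup>2 * x\<^sup>2" for v c x :: real
      by (simp add: power2_eq_square algebra_simps)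
    then show ?thesis by (simp only: limit_rv_def)
  qed
  note i = scaled_DSLT_integrable_square(1)[OF assms] integrable_mult_right[OF iVX, of "2 * ?c"] integrable_mult_right[OF X_square(2)[OF assms(2), of 1], of "?c\<^sup>2"]
  show "integrable M (\<lambda>\<omega>. (scaled_DSLT t \<eta> \<omega> - limit_rv t \<omega>)\<^sup>2)" unfolding eq by (intro Bochner_Integration.integrable_add i)
  have "expectation (\<lambda>\<omega>. (scaled_DSLT t \<eta> \<omega>)\<^sup>2 + 2 * ?c * (scaled_DSLT t \<eta> \<omega> * X 1 t \<omega>) + ?c\<^sup>2 * (X 1 t \<omega>)\<^sup>2)
    = expectation (\<lambda>\<omega>. (scaled_DSLT t \<eta> \<omega>)\<^sup>2) + expectation (\<lambda>\<omega>. 2 * ?c * (scaled_DSLT t \<eta> \<omega> * X 1 t \<omega>)) + expectation (\<lambda>\<omega>. ?c\<^sup>2 * (X 1 t \<omega>)\<^sup>2)"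
    by (subst Bochner_Integration.integral_add; (intro Bochner_Integration.integrable_add i)?) (subst Bochner_Integration.integral_add; (intro i)?; rule refl)
  then show "expectation (\<lambda>\<omega>. (scaled_DSLT t \<eta> \<omega> - limit_rv t \<omega>)\<^sup>2)
      = expectation (\<lambda>\<omega>. (scaled_DSLT t \<eta> \<omega>)\<^sup>2) + 2 * ?c * expectation (\<lambda>\<omega>. scaled_DSLT t \<eta> \<omega> * X 1 t \<omega>) + limit_var t"
    unfolding eq by (simp only: integral_mult_right_zero X_square(1)[OF assms(2)] limit_var_def)
qed

lemma scaled_DSLT_tendsto_limit:
  assumes t: "0 < t" and \<eta>: "\<And>n. 0 < \<eta> n" "\<eta> \<longlonglongrightarrow> 0"
  shows "(\<lambda>n. expectation (\<lambda>\<omega>. (scaled_DSLT t (\<eta> n) \<omega> - limit_rv t \<omega>)\<^sup>2)) \<longlonglongrightarrow> 0"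
proof (rule order_tendstoI)
  fix e :: real assume "e < 0"
  moreover have "0 \<le> expectation (\<lambda>\<omega>. (scaled_DSLT t (\<eta> n) \<omega> - limit_rv t \<omega>)\<^sup>2)" for n by (intro Bochner_Integration.integral_nonneg) simp
  ultimately show "\<forall>\<^sub>F n in sequentially. e < expectation (\<lambda>\<omega>. (scaled_DSLT t (\<eta> n) \<omega> - limit_rv t \<omega>)\<^sup>2)"
    by (intro always_eventually allI) (rule order_less_le_trans)
next
  fix e :: real assume e: "0 < e"
  let ?c = "beta_int / (2 * pi)"
  have "(\<lambda>n. 2 * ?c * expectation (\<lambda>\<omega>. scaled_DSLT t (\<eta> n) \<omega> * X 1 t \<omega>)) \<longlonglongrightarrow> 2 * ?c * - (?c * t powr p)"
    by (intro tendsto_mult tendsto_const expectation_scaled_DSLT_mult_X_tendsto t \<eta>)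
  \<comment> \<open>The contributions limit_var + e/2, -2 limit_var + e/2 and limit_var add up to
    e.\<close>
  moreover have "2 * ?c * - (?c * t powr p) < - 2 * limit_var t + e / 2"
    using e by (simp add: limit_var_def power2_eq_square)
  ultimately have "\<forall>\<^sub>F n in sequentially. 2 * ?c * expectation (\<lambda>\<omega>. scaled_DSLT t (\<eta> n) \<omega> * X 1 t \<omega>) < - 2 * limit_var t + e / 2"
    by (rule order_tendstoD)
  moreover have "\<forall>\<^sub>F n in sequentially. expectation (\<lambda>\<omega>. (scaled_DSLT t (\<eta> n) \<omega>)\<^sup>2) \<le> limit_var t + e / 2"
    using e by (intro eventually_scaled_DSLT_square_le t \<eta>) auto
  ultimately show "\<forall>\<^sub>F n in sequentially. expectation (\<lambda>\<omega>. (scaled_DSLT t (\<eta> n) \<omega> - limit_rv t \<omega>)\<^sup>2) < e"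
    by eventually_elim (unfold scaled_DSLT_minus_limit(2)[OF \<eta>(1) t], linarith)
qed

lemma limit_rv_law:
  assumes "0 < t" shows "limit_rv t \<in> borel_measurable M" "distr M borel (limit_rv t) = normal_law 0 (limit_var t)"
proof -
  have Z: "limit_rv t = (\<lambda>\<omega>. - (beta_int / (2 * pi)) * X 1 t \<omega>)" by (simp add: limit_rv_def[abs_def])
  have span: "limit_rv t \<in> span 1" unfolding Z using assms by (intro linear_span_on_scale X_span) auto
  then show "limit_rv t \<in> borel_measurable M" by (rule component.span_measurable)
  have "expectation (\<lambda>\<omega>. (limit_rv t \<omega>)\<^sup>2) = limit_var t"
    unfolding Z power_mult_distrib integral_mult_right_zero X_square(1)[OF assms] by (simp add: limit_var_def)
  then show "distr M borel (limit_rv t) = normal_law 0 (limit_var t)"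
    using component.span_normal_law[OF span] by simp
qed

end

section \<open>Convergence in distribution\<close>

text \<open>Chebyshev's inequality confines the distribution function at x between those of
  \<open>Z\<close> at x - h and x + h, up to the probability that |X_n - Z| is at least h;
  continuity at x chooses h.\<close>

lemma (in prob_space) cdf_distr_tendsto_of_mean_square:
  fixes X :: "nat \<Rightarrow> 'a \<Rightarrow> real"
  assumes X [measurable]: "\<And>n. X n \<in> borel_measurable M" and Z [measurable]: "Z \<in> borel_measurable M"
    and int: "\<And>n. integrable M (\<lambda>\<omega>. (X n \<omega> - Z \<omega>)\<^sup>2)"
    and lim: "(\<lambda>n. expectation (\<lambda>\<omega>. (X n \<omega> - Z \<omega>)\<^sup>2)) \<longlonglongrightarrow> 0"
    and cont: "isCont (cdf (distr M borel Z)) x"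
  shows "(\<lambda>n. cdf (distr M borel (X n)) x) \<longlonglongrightarrow> cdf (distr M borel Z) x"
proof (rule tendstoI)
  fix e :: real assume e: "0 < e"
  have cdf: "cdf (distr M borel Y) y = prob {\<omega> \<in> space M. Y \<omega> \<le> y}" if [measurable]: "Y \<in> borel_measurable M" for Y y
    unfolding cdf_def2 by (subst measure_distr) (auto intro!: arg_cong[where f = prob])
  let ?F = "\<lambda>y. prob {\<omega> \<in> space M. Z \<omega> \<le> y}"
  have "(?F \<longlongrightarrow> ?F x) (at x)" using cont unfolding isCont_def cdf[OF Z] .
  from tendstoD[OF this, of "e / 2"] e obtain d where d: "0 < d" "\<And>y. y \<noteq> x \<Longrightarrow> dist y x < d \<Longrightarrow> dist (?F y) (?F x) < e / 2"
    by (auto simp: eventually_at)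
  define h where "h = d / 2"
  have h: "0 < h" "\<bar>?F (x + h) - ?F x\<bar> < e / 2" "\<bar>?F (x - h) - ?F x\<bar> < e / 2"
    using d(1) d(2)[of "x + h"] d(2)[of "x - h"] by (auto simp: h_def dist_real_def)
  let ?P = "\<lambda>n. prob {\<omega> \<in> space M. h \<le> \<bar>X n \<omega> - Z \<omega>\<bar>}"
  have P: "?P n \<le> expectation (\<lambda>\<omega>. (X n \<omega> - Z \<omega>)\<^sup>2) / h\<^sup>2" for n
    by (rule second_moment_method[OF _ int h(1)]) measurable
  have up: "prob {\<omega> \<in> space M. X n \<omega> \<le> x} \<le> ?F (x + h) + ?P n" for n
  proof -
    have "prob {\<omega> \<in> space M. X n \<omega> \<le> x} \<le> prob ({\<omega> \<in> space M. Z \<omega> \<le> x + h} \<union> {\<omega> \<in> space M. h \<le> \<bar>X n \<omega> - Z \<omega>\<bar>})"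
      by (intro finite_measure_mono) auto
    also have "\<dots> \<le> ?F (x + h) + ?P n" by (intro measure_Un_le) auto
    finally show ?thesis .
  qed
  have lo: "?F (x - h) \<le> prob {\<omega> \<in> space M. X n \<omega> \<le> x} + ?P n" for n
  proof -
    have "?F (x - h) \<le> prob ({\<omega> \<in> space M. X n \<omega> \<le> x} \<union> {\<omega> \<in> space M. h \<le> \<bar>X n \<omega> - Z \<omega>\<bar>})"
      by (intro finite_measure_mono) auto
    also have "\<dots> \<le> prob {\<omega> \<in> space M. X n \<omega> \<le> x} + ?P n" by (intro measure_Un_le) auto
    finally show ?thesis .
  qed
  have "0 < e / 2 * h\<^sup>2" using e h(1) by simp
  from order_tendstoD(2)[OF lim this]
  show "\<forall>\<^sub>F n in sequentially. dist (cdf (distr M borel (X n)) x) (cdf (distr M borel Z) x) < e"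
  proof eventually_elim
    case (elim n)
    have "?P n < e / 2" using P[of n] elim h(1) by (intro order_le_less_trans[OF P]) (simp add: divide_less_eq)
    then show ?case unfolding cdf[OF X] cdf[OF Z] dist_real_def using up[of n] lo[of n] h(2,3) by linarith
  qed
qed

text \<open>The iterated path integral is uncontrolled on the null set of irregular paths, so it is
  measurable only for the completed measure; its law there is that of the regular version.\<close>

lemma distr_completion_eq:
  fixes f g :: "'a \<Rightarrow> real"
  assumes N: "N \<in> null_sets M" and g: "g \<in> borel_measurable M"
    and eq: "\<And>\<omega>. \<omega> \<in> space M \<Longrightarrow> \<omega> \<notin> N \<Longrightarrow> f \<omega> = g \<omega>"
  shows "f \<in> borel_measurable (completion M)" "distr (completion M) borel f = distr M borel g"
proof -
  have gc: "g \<in> borel_measurable (completion M)" using g by (rule measurable_completion)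
  have Nc: "N \<in> null_sets (completion M)" using N by (rule null_sets_completionI)
  show f: "f \<in> borel_measurable (completion M)"
  proof (rule measurableI)
    fix A :: "real set" assume A: "A \<in> sets borel"
    have e: "f -` A \<inter> space M = (g -` A \<inter> space M - N) \<union> (f -` A \<inter> space M \<inter> N)"
      using eq by auto
    have 1: "g -` A \<inter> space M \<in> sets (completion M)" using measurable_sets[OF gc A] by simp
    have 2: "f -` A \<inter> space M \<inter> N \<in> null_sets (completion M)"
      using Nc by (rule null_sets_completion_subset[rotated]) auto
    show "f -` A \<inter> space (completion M) \<in> sets (completion M)"
      unfolding space_completion
      by (subst e) (rule sets.Un[OF sets.Diff[OF 1 null_setsD2[OF Nc]] null_setsD2[OF 2]])
  qed simp
  have "AE \<omega> in completion M. f \<omega> = g \<omega>"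
    using AE_not_in[OF Nc] AE_space by eventually_elim (use eq in auto)
  then have "distr (completion M) borel f = distr (completion M) borel g"
    using f gc by (intro distr_cong_AE) auto
  also have "\<dots> = distr M borel g" using g by (rule distr_completion)
  finally show "distr (completion M) borel f = distr M borel g" .
qed

lemma (in planar_fbm) converges_in_distribution_DSLT:
  assumes t: "0 < t"
  shows "converges_in_distribution (completion M)
    (\<lambda>\<epsilon> \<omega>. \<epsilon> powr (2 - 2 / p) * approx_DSLT B 1 t \<epsilon> \<omega>) (normal_law 0 (limit_var t)) (at_right 0)"
proof -
  have scale: "\<epsilon> powr (2 - 2 / p) * approx_DSLT B 1 t \<epsilon> \<omega> = scaled_DSLT t (\<epsilon> powr (1 / p)) \<omega>"
    if "0 < \<epsilon>" "\<omega> \<in> space M" "\<omega> \<notin> irregular" for \<epsilon> \<omega>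
  proof -
    have "(\<epsilon> powr (1 / p)) powr p = \<epsilon>" "(\<epsilon> powr (1 / p)) powr (2 * p - 2) = \<epsilon> powr (2 - 2 / p)"
      using that p_gt_1 by (simp_all add: powr_powr diff_divide_distrib)
    then show ?thesis using approx_DSLT_eq_scaled_DSLT[of "\<epsilon> powr (1 / p)" t \<omega>] that t by simp
  qed
  have Vm: "scaled_DSLT t (\<epsilon> powr (1 / p)) \<in> borel_measurable M" if "0 < \<epsilon>" for \<epsilon>
    using that t by (intro scaled_DSLT_measurable) auto
  have D: "(\<lambda>\<omega>. \<epsilon> powr (2 - 2 / p) * approx_DSLT B 1 t \<epsilon> \<omega>) \<in> borel_measurable (completion M)"
    "distr (completion M) borel (\<lambda>\<omega>. \<epsilon> powr (2 - 2 / p) * approx_DSLT B 1 t \<epsilon> \<omega>) = distr M borel (scaled_DSLT t (\<epsilon> powr (1 / p)))"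
    if "0 < \<epsilon>" for \<epsilon>
    by (rule distr_completion_eq[OF irregular_null Vm[OF that] scale[OF that]]; assumption)+
  show ?thesis unfolding converges_in_distribution_def
  proof (intro conjI allI impI)
    show "\<forall>\<^sub>F \<epsilon> in at_right 0. (\<lambda>\<omega>. \<epsilon> powr (2 - 2 / p) * approx_DSLT B 1 t \<epsilon> \<omega>) \<in> borel_measurable (completion M)"
      using eventually_at_right_less[of 0] by eventually_elim (rule D(1))
    fix x assume x: "isCont (cdf (normal_law 0 (limit_var t))) x"
    show "((\<lambda>\<epsilon>. cdf (distr (completion M) borel (\<lambda>\<omega>. \<epsilon> powr (2 - 2 / p) * approx_DSLT B 1 t \<epsilon> \<omega>)) x)
        \<longlongrightarrow> cdf (normal_law 0 (limit_var t)) x) (at_right 0)"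
      unfolding tendsto_at_iff_sequentially
    proof (intro allI impI)
      fix \<epsilon> :: "nat \<Rightarrow> real" assume "\<forall>i. \<epsilon> i \<in> {0<..} - {0}" and lim: "\<epsilon> \<longlonglongrightarrow> 0"
      then have pos: "0 < \<epsilon> n" for n by auto
      have "(\<lambda>n. \<epsilon> n powr (1 / p)) \<longlonglongrightarrow> 0 powr (1 / p)"
        using p_gt_1 pos lim by (intro tendsto_powr2) (auto intro!: always_eventually less_imp_le)
      then have \<eta>: "(\<lambda>n. \<epsilon> n powr (1 / p)) \<longlonglongrightarrow> 0" by simp
      have \<eta>_pos: "0 < \<epsilon> n powr (1 / p)" for n using pos[of n] by simp
      have "(\<lambda>n. cdf (distr M borel (scaled_DSLT t (\<epsilon> n powr (1 / p)))) x) \<longlonglongrightarrow> cdf (distr M borel (limit_rv t)) x"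
        by (rule cdf_distr_tendsto_of_mean_square[OF Vm[OF pos] limit_rv_law(1)[OF t] scaled_DSLT_minus_limit(1)[OF \<eta>_pos t] scaled_DSLT_tendsto_limit[OF t \<eta>_pos \<eta>]])
          (use x limit_rv_law(2)[OF t] in simp)
      then show "((\<lambda>\<epsilon>. cdf (distr (completion M) borel (\<lambda>\<omega>. \<epsilon> powr (2 - 2 / p) * approx_DSLT B 1 t \<epsilon> \<omega>)) x) \<circ> \<epsilon>)
          \<longlonglongrightarrow> cdf (normal_law 0 (limit_var t)) x"
        unfolding o_def D(2)[OF pos] limit_rv_law(2)[OF t] .
    qed
  qed
qed

lemma Beta_2_left:
  assumes "0 < (z :: real)" shows "Beta 2 z = 1 / (z * (z + 1))"
proof -
  have "z \<notin> \<int>\<^sub>\<le>\<^sub>0" "z + 1 \<notin> \<int>\<^sub>\<le>\<^sub>0" using assms by (auto elim!: nonpos_Ints_cases)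
  then have "Gamma (z + 1) = z * Gamma z" "Gamma (z + 1 + 1) = (z + 1) * Gamma (z + 1)"
    by (simp_all only: Gamma_plus1 not_False_eq_True)
  moreover have "Gamma (2 :: real) = 1" using Gamma_fact[of 1, where 'a = real] by simp
  moreover have "Gamma z \<noteq> 0" using Gamma_real_pos[OF assms] by simp
  moreover have "2 + z = z + 1 + 1" by simp
  ultimately have "Beta 2 z = Gamma z / (z * (z + 1) * Gamma z)"
    unfolding Beta_def by (simp only: mult_1 mult_ac)
  then show ?thesis using \<open>Gamma z \<noteq> 0\<close> by simp
qed

theorem theorem1p5:
  fixes M :: "'w measure"
    and B :: "real \<Rightarrow> 'w \<Rightarrow> real ^ 2"
    and H t :: real
  assumes "prob_space M"
    and "1 / 2 < H" and "H < 1"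
    and "0 < t"
    and "vector_fractional_brownian_motion H M B"
  shows "converges_in_distribution (completion M)
    (\<lambda>\<epsilon> \<omega>. \<epsilon> powr (2 - 1 / H) * approx_DSLT B 1 t \<epsilon> \<omega>)
    (normal_law 0
      ((2 * H - 1) * t powr (2 * H) / (8 * pi\<^sup>2 * H)
        * Beta 2 (2 * H - 1) * (Beta (1 / H) ((4 * H - 2) / (2 * H)))\<^sup>2))
    (at_right 0)"
proof -
  interpret prob_space M by fact
  interpret planar_fbm M "2 * H" B
    by unfold_locales (use assms in auto)
  have e: "2 / (2 * H) = 1 / H" "(4 * H - 2) / (2 * H) = 2 - 1 / H" using assms(2) by (simp_all add: field_simps)
  \<comment> \<open>This turns the prefactor into 1 / (16 pi^2 H^2), the square of 1 / (2 pi * 2H)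
    that occurs in \<open>limit_var\<close>.\<close>
  have "(2 * H - 1) * Beta 2 (2 * H - 1) = 1 / (2 * H)"
    using assms(2) Beta_2_left[of "2 * H - 1"] by simp
  moreover have "(2 * H - 1) * T / (8 * pi\<^sup>2 * H) * b * c = ((2 * H - 1) * b) * (T / (8 * pi\<^sup>2 * H) * c)" for T b c :: real
    by simp
  ultimately have "(2 * H - 1) * t powr (2 * H) / (8 * pi\<^sup>2 * H) * Beta 2 (2 * H - 1) * (Beta (1 / H) (2 - 1 / H))\<^sup>2
    = 1 / (2 * H) * (t powr (2 * H) / (8 * pi\<^sup>2 * H) * (Beta (1 / H) (2 - 1 / H))\<^sup>2)"
    by (simp only:)
  also have "\<dots> = limit_var t"
    unfolding limit_var_def beta_int_def e(1) by (simp add: power_divide power2_eq_square mult_ac)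
  finally show ?thesis using converges_in_distribution_DSLT[OF assms(4)] unfolding e by (simp only:)
qed

end
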